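(* For $k\in\{pp,pl,tc\}$ let $H_k(T,R)$ be the event that the time dependent model $k$ (Poisson process, perturbed lattice, triangular cluster, respectively) has no points in $D_R=\{z\in\mathbb{C}:|z|\le R\}$ for all $t\in[0,T]$. (1) For the Poisson process, for every $R>0$, $$\lim_{T\to\infty}\frac1T\log\mathbb{P}(H_{pp}(T,R))=0.$$ (2) Let $k=pl$ or $k=tc$. For every $R_*>16$ and $T_*>0$ there exist positive constants $c_1,c_2$ depending only on $T_*$ and $R_*$ such that for all $R>R_*$ $$\limsup_{T\to\infty}\frac1T\log\mathbb{P}(H_k(T,R))\le -c_1R^4\quad\text{and}\quad \liminf_{T\to\infty}\frac1T\log\mathbb{P}(H_k(T,R))\ge -c_2R^4.$$
   Context: A complex Brownian motion is $B=\frac1{\sqrt2}(B_1+iB_2)$ with $B_1,B_2$ independent standard real Brownian motions. Let $\zeta_{k,\ell}(t)$, $k,\ell\in\mathbb{Z}$, be i.i.d. complex stationary Ornstein-Uhlenbeck processes, each distributed as $e^{-t/2}B(e^t)$ where $B$ is a complex Brownian motion started from $0$. A constant $c>0$ is fixed as a parameter of the models. The three time dependent models are: - Poisson process ($pp$): at time $0$ the points form a Poisson process in $\mathbb{C}$ with intensity $\pi^{-1}$ times Lebesgue measure, and the points then move as independent planar (complex) Brownian motions. - Perturbed lattice ($pl$): at time $t$ the points are $\{\sqrt{\pi}(k+i\ell)+c\,\zeta_{k,\ell}(t):k,\ell\in\mathbb{Z}\}$. - Triangular cluster ($tc$): at time $t$ the points are $\{\sqrt{3\pi}(k+i\ell)+c\,e^{2\pi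 i m/3}\zeta_{k,\ell}(t):k,\ell\in\mathbb{Z},\ m=0,1,2\}$. *)

theory Defs
  imports "HOL-Probability.Probability"
begin

(* Processes are written W t \<omega> and only their values at times t \<ge> 0 matter. *)

definition continuous_paths ::
    "'w measure \<Rightarrow> (real \<Rightarrow> 'w \<Rightarrow> 'a::topological_space) \<Rightarrow> bool" where
  "continuous_paths M W \<longleftrightarrow> (\<forall>\<omega>\<in>space M. continuous_on {0..} (\<lambda>t. W t \<omega>))"

definition path_space :: "(real \<Rightarrow> 'a::topological_space) measure" where
  "path_space = (\<Pi>\<^sub>M t\<in>{0..}. borel)"

definition path_of :: "(real \<Rightarrow> 'w \<Rightarrow> 'a) \<Rightarrow> 'w \<Rightarrow> real \<Rightarrow> 'a" where
  "path_of W \<omega> = (\<lambda>t\<in>{0..}. W t \<omega>)"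

(* Finite sequences of times are covered by the infinite sequences \<tau> that are eventually
   constant: the extra increments vanish. *)
definition brownian_motion :: "'w measure \<Rightarrow> (real \<Rightarrow> 'w \<Rightarrow> real) \<Rightarrow> bool" where
  "brownian_motion M W \<longleftrightarrow>
     prob_space M \<and>
     (\<forall>t\<ge>0. W t \<in> borel_measurable M) \<and>
     (\<forall>\<omega>\<in>space M. W 0 \<omega> = 0) \<and>
     continuous_paths M W \<and>
     (\<forall>s t. 0 \<le> s \<and> s < t \<longrightarrow>
        distributed M lborel (\<lambda>\<omega>. W t \<omega> - W s \<omega>) (normal_density 0 (sqrt (t - s)))) \<and>
     (\<forall>\<tau>::nat \<Rightarrow> real. mono \<tau> \<and> 0 \<le> \<tau> 0 \<longrightarrow>
        prob_space.indep_vars M (\<lambda>_. borel) (\<lambda>i \<omega>. W (\<tau> (Suc i)) \<omega> - W (\<tau> i) \<omega>) UNIV)"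

definition complex_brownian_motion :: "'w measure \<Rightarrow> (real \<Rightarrow> 'w \<Rightarrow> complex) \<Rightarrow> bool" where
  "complex_brownian_motion M B \<longleftrightarrow>
     (\<exists>B1 B2. brownian_motion M B1 \<and> brownian_motion M B2 \<and>
        prob_space.indep_var M path_space (path_of B1) path_space (path_of B2) \<and>
        (\<forall>t\<ge>0. \<forall>\<omega>\<in>space M.
           B t \<omega> = of_real (1 / sqrt 2) * (of_real (B1 t \<omega>) + \<i> * of_real (B2 t \<omega>))))"

(* Equality in law with exp (- t / 2) B (exp t), where B may live on another probability space N.
   Placing N on the type of complex paths loses nothing: every complex Brownian motion has the
   same law as the coordinate process on the continuous paths started from 0. *)
definition complex_ou_process :: "'w measure \<Rightarrow> (real \<Rightarrow> 'w \<Rightarrow> complex) \<Rightarrow> bool" where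
  "complex_ou_process M Z \<longleftrightarrow>
     prob_space M \<and>
     (\<forall>t\<ge>0. Z t \<in> borel_measurable M) \<and>
     continuous_paths M Z \<and>
     (\<exists>(N :: (real \<Rightarrow> complex) measure) B. complex_brownian_motion N B \<and>
        distr M path_space (path_of Z) =
        distr N path_space (path_of (\<lambda>t \<omega>. of_real (exp (- t / 2)) * B (exp t) \<omega>)))"

definition independent_processes ::
    "'w measure \<Rightarrow> ('i \<Rightarrow> real \<Rightarrow> 'w \<Rightarrow> 'a::topological_space) \<Rightarrow> bool" where
  "independent_processes M W \<longleftrightarrow>
     prob_space.indep_vars M (\<lambda>_. path_space) (\<lambda>i. path_of (W i)) UNIV"

definition iid_ou_family :: "'w measure \<Rightarrow> (int \<times> int \<Rightarrow> real \<Rightarrow> 'w \<Rightarrow> complex) \<Rightarrow> bool" where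
  "iid_ou_family M \<zeta> \<longleftrightarrow>
     prob_space M \<and> (\<forall>p. complex_ou_process M (\<zeta> p)) \<and> independent_processes M \<zeta>"

(* A Poisson process of infinite total intensity, given by an enumeration X of its points
   (in arbitrary order). *)
definition poisson_points ::
    "'w measure \<Rightarrow> 'a::topological_space measure \<Rightarrow> (nat \<Rightarrow> 'w \<Rightarrow> 'a) \<Rightarrow> bool" where
  "poisson_points M \<mu> X \<longleftrightarrow>
     prob_space M \<and>
     (\<forall>j. X j \<in> borel_measurable M) \<and>
     (\<forall>A\<in>sets borel. emeasure \<mu> A < \<infinity> \<longrightarrow>
        (AE \<omega> in M. finite {j. X j \<omega> \<in> A}) \<and>
        (\<forall>n. measure M {\<omega>\<in>space M. card {j. X j \<omega> \<in> A} = n} =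
             measure \<mu> A ^ n / fact n * exp (- measure \<mu> A))) \<and>
     (\<forall>A::nat \<Rightarrow> 'a set.
        range A \<subseteq> sets borel \<and> disjoint_family A \<and> (\<forall>i. emeasure \<mu> (A i) < \<infinity>) \<longrightarrow>
        prob_space.indep_vars M (\<lambda>_. count_space UNIV) (\<lambda>i \<omega>. card {j. X j \<omega> \<in> A i}) UNIV)"

(* B j is the displacement of the point started at X j. Independence of the two families is
   independence of the sigma-algebras they generate. *)
definition poisson_model ::
    "'w measure \<Rightarrow> (nat \<Rightarrow> 'w \<Rightarrow> complex) \<Rightarrow> (nat \<Rightarrow> real \<Rightarrow> 'w \<Rightarrow> complex) \<Rightarrow> bool" where
  "poisson_model M X B \<longleftrightarrow>
     poisson_points M (scale_measure (ennreal (1 / pi)) lborel) X \<and>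
     (\<forall>j. complex_brownian_motion M (B j)) \<and>
     independent_processes M B \<and>
     prob_space.indep_set M
       (sets (vimage_algebra (space M) (\<lambda>\<omega> j. X j \<omega>) (\<Pi>\<^sub>M j\<in>UNIV. borel)))
       (sets (vimage_algebra (space M) (\<lambda>\<omega> j. path_of (B j) \<omega>) (\<Pi>\<^sub>M j\<in>UNIV. path_space)))"

definition poisson_positions ::
    "(nat \<Rightarrow> 'w \<Rightarrow> complex) \<Rightarrow> (nat \<Rightarrow> real \<Rightarrow> 'w \<Rightarrow> complex) \<Rightarrow> real \<Rightarrow> 'w \<Rightarrow> complex set" where
  "poisson_positions X B t \<omega> = {X j \<omega> + B j t \<omega> | j. True}"

definition perturbed_lattice ::
    "real \<Rightarrow> (int \<times> int \<Rightarrow> real \<Rightarrow> 'w \<Rightarrow> complex) \<Rightarrow> real \<Rightarrow> 'w \<Rightarrow> complex set" where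
  "perturbed_lattice c \<zeta> t \<omega> =
     {of_real (sqrt pi) * (of_int k + \<i> * of_int l) + of_real c * \<zeta> (k, l) t \<omega> | k l. True}"

definition triangular_cluster ::
    "real \<Rightarrow> (int \<times> int \<Rightarrow> real \<Rightarrow> 'w \<Rightarrow> complex) \<Rightarrow> real \<Rightarrow> 'w \<Rightarrow> complex set" where
  "triangular_cluster c \<zeta> t \<omega> =
     {of_real (sqrt (3 * pi)) * (of_int k + \<i> * of_int l)
        + of_real c * exp (2 * of_real pi * \<i> * of_nat m / 3) * \<zeta> (k, l) t \<omega> | k l m.
      m \<in> {0, 1, 2}}"

definition hole_event ::
    "'w measure \<Rightarrow> (real \<Rightarrow> 'w \<Rightarrow> complex set) \<Rightarrow> real \<Rightarrow> real \<Rightarrow> 'w set" where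
  "hole_event M P T R = {\<omega>\<in>space M. \<forall>t\<in>{0..T}. P t \<omega> \<inter> cball 0 R = {}}"

(* The library's ln has ln 0 = 0; here log 0 = -\<infinity>. *)
definition log_prob :: "real \<Rightarrow> ereal" where
  "log_prob p = (if p = 0 then - \<infinity> else ereal (ln p))"

definition hole_rate ::
    "'w measure \<Rightarrow> (real \<Rightarrow> 'w \<Rightarrow> complex set) \<Rightarrow> real \<Rightarrow> real \<Rightarrow> ereal" where
  "hole_rate M P R T = ereal (1 / T) * log_prob (measure M (hole_event M P T R))"

end

theory Submission
  imports Defs
begin

text \<open>
  Poisson model. Points are thinned independently, so the hole probability is at least
  \<open>exp (- \<Sum> q z)\<close>, where \<open>q z\<close> bounds the probability that a Brownian motion started in the unit
  cell at \<open>z\<close> hits the disc before time \<open>T\<close>. Decomposing at the first visit and counting the time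
  spent near the disc, \<open>q z\<close> is at most the expected occupation time divided by a multiple of \<open>ln T\<close>,
  by planar recurrence. Summed over \<open>z\<close> the occupation times are \<open>O(T)\<close>, so the exponent is
  \<open>O(T / ln T)\<close>.

  Lattice models. The sites are independent, and an Ornstein--Uhlenbeck process at the times
  \<open>i ln 2\<close> is a rescaled Brownian motion at the times \<open>2 ^ i\<close>. Upper bound: each of the order of \<open>R\<^sup>2\<close>
  sites within \<open>R / 2\<close> of the origin keeps its process outside a disc of radius \<open>r = R / (2 c)\<close>. With the
  Lyapunov function \<open>exp (|z|\<^sup>2 / 2)\<close> each step costs a factor \<open>exp (- \<kappa> r\<^sup>2)\<close>; for small \<open>r\<close> a constant
  is added to the Lyapunov function to exploit the killing inside the disc. Lower bound: the processes
  of the sites within \<open>K R\<close> are held outside a disc of radius \<open>\<rho>\<close> of order \<open>R\<close>, in steps of length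
  \<open>1 / \<rho>\<^sup>2\<close> that each succeed with a fixed probability; the process of a site at distance \<open>d > K R\<close> is
  confined to a disc of radius \<open>d / (4 c)\<close>, at a rate summable over the lattice.
\<close>

section \<open>Complex Brownian motion\<close>

text \<open>Probabilities are estimated at finitely many fixed times, where independence of
  increments suffices. First passages are taken on a time grid, and bounds that do not depend on the
  mesh are carried to all times by path continuity along dyadic refinements. The Ornstein-Uhlenbeck
  processes are known only in law, so they enter through path-space events that can be transferred
  to a Brownian motion. The exponent R^4 is a number of sites of order R^2 times a rate of order R^2
  per site. The latter arises because at distance r from 0 the process is pulled inwards with speed
  of order r: over a time d the noise, of size sqrt d, offsets the pull, of size r d, with a fixed
  probability only if d is at most of order 1 / r^2. Hence there are of order r^2 steps per unit of
  time, each at a fixed cost. The constants for the lattice models must be uniform over all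
  probability spaces and all R, so auxiliary lemmas place the existential constant before the
  quantifier over measures.\<close>

lemma (in prob_space) prob_indep_vars_ball:
  assumes X: "indep_vars M' X I" and J: "finite J" "J \<subseteq> I"
    and A: "\<And>i. i \<in> J \<Longrightarrow> A i \<in> sets (M' i)"
  shows "prob {\<omega>\<in>space M. \<forall>i\<in>J. X i \<omega> \<in> A i} = (\<Prod>i\<in>J. prob {\<omega>\<in>space M. X i \<omega> \<in> A i})"
proof (cases "J = {}")
  case True
  then show ?thesis by (simp add: prob_space)
next
  case False
  have "{\<omega>\<in>space M. \<forall>i\<in>J. X i \<omega> \<in> A i} = (\<Inter>i\<in>J. X i -` A i \<inter> space M)"
    using False by auto
  moreover have "X i -` A i \<inter> space M = {\<omega>\<in>space M. X i \<omega> \<in> A i}" for i by auto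
  ultimately show ?thesis
    using indep_varsD[OF X False J A] by simp
qed

text \<open>Agreement is required only on \<open>space M\<close>, because the definitions tie a
  complex process to its real components there and nowhere else.\<close>

lemma (in prob_space) indep_vars_cong_space:
  assumes X: "indep_vars M' X I" and eq: "\<And>i \<omega>. i \<in> I \<Longrightarrow> \<omega> \<in> space M \<Longrightarrow> Y i \<omega> = X i \<omega>"
  shows "indep_vars M' Y I"
proof -
  have "Y i -` A \<inter> space M = X i -` A \<inter> space M" if "i \<in> I" for i A
    using eq that by auto
  moreover have "Y i \<in> measurable M (M' i) \<longleftrightarrow> X i \<in> measurable M (M' i)" if "i \<in> I" for i
    by (rule measurable_cong) (use eq that in auto)
  ultimately show ?thesis
    using X unfolding indep_vars_def2 by (simp cong: indep_sets_cong)
qed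

lemma (in prob_space) indep_var_cong_space:
  assumes X: "indep_var S X T Y"
    and eq: "\<And>\<omega>. \<omega> \<in> space M \<Longrightarrow> X' \<omega> = X \<omega>" "\<And>\<omega>. \<omega> \<in> space M \<Longrightarrow> Y' \<omega> = Y \<omega>"
  shows "indep_var S X' T Y'"
  using X unfolding indep_var_def
  by (rule indep_vars_cong_space) (auto simp: eq split: bool.split)

lemma (in prob_space) prob_indep_var:
  assumes "indep_var S X T Y" "A \<in> sets S" "B \<in> sets T"
  shows "prob {\<omega>\<in>space M. X \<omega> \<in> A \<and> Y \<omega> \<in> B}
       = prob {\<omega>\<in>space M. X \<omega> \<in> A} * prob {\<omega>\<in>space M. Y \<omega> \<in> B}"
proof -
  have *: "prob ((\<lambda>x. (X x, Y x)) -` (A \<times> B) \<inter> space M)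
      = prob (X -` A \<inter> space M) * prob (Y -` B \<inter> space M)"
    by (rule indep_varD[OF assms])
  have "(\<lambda>x. (X x, Y x)) -` (A \<times> B) \<inter> space M = {\<omega>\<in>space M. X \<omega> \<in> A \<and> Y \<omega> \<in> B}"
    "X -` A \<inter> space M = {\<omega>\<in>space M. X \<omega> \<in> A}" "Y -` B \<inter> space M = {\<omega>\<in>space M. Y \<omega> \<in> B}"
    by auto
  with * show ?thesis by simp
qed

lemma space_path_space: "space (path_space :: (real \<Rightarrow> 'a::topological_space) measure) = extensional {0..}"
  by (auto simp: path_space_def space_PiM PiE_def)

lemma path_of_in_space [simp]: "path_of W \<omega> \<in> space path_space"
  by (auto simp: space_path_space path_of_def)

lemma path_of_apply [simp]: "0 \<le> t \<Longrightarrow> path_of W \<omega> t = W t \<omega>"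
  by (simp add: path_of_def)

lemma measurable_path_of:
  assumes "\<And>t. 0 \<le> t \<Longrightarrow> W t \<in> borel_measurable M"
  shows "path_of W \<in> measurable M path_space"
  unfolding path_of_def path_space_def by (rule measurable_restrict) (use assms in auto)

lemma measurable_path_eval:
  "0 \<le> t \<Longrightarrow> (\<lambda>f. f t) \<in> borel_measurable path_space"
  unfolding path_space_def by (rule measurable_component_singleton) auto

section \<open>The complex Gaussian law and the increments of complex Brownian motion\<close>

abbreviation std_normal :: "real measure" where
  "std_normal \<equiv> density lborel (\<lambda>x. ennreal (std_normal_density x))"

text \<open>The circularly symmetric Gaussian law with E |x|^2 = \<open>v\<close>: real and
  imaginary parts are independent of variance \<open>v / 2\<close>, matching the factor 1 / sqrt 2
  in a complex Brownian motion. \<open>cgauss 0\<close> is the point mass at 0.\<close>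

definition cgauss :: "real \<Rightarrow> complex measure" where
  "cgauss v = distr (std_normal \<Otimes>\<^sub>M std_normal) borel
     (\<lambda>(x, y). of_real (sqrt (v / 2)) * Complex x y)"

lemma prob_space_std_normal: "prob_space std_normal"
  by (rule prob_space_normal_density) simp

lemma measurable_Complex [measurable (raw)]:
  assumes "f \<in> borel_measurable M" "g \<in> borel_measurable M"
  shows "(\<lambda>x. Complex (f x) (g x)) \<in> borel_measurable M"
  unfolding Complex_eq using assms by measurable

lemma cgauss_measurable [measurable]:
  "(\<lambda>(x, y). of_real a * Complex x y) \<in> borel_measurable (std_normal \<Otimes>\<^sub>M std_normal)"
  by measurable

lemma sets_cgauss [measurable_cong, simp]: "sets (cgauss v) = sets borel"
  by (simp add: cgauss_def)

lemma space_cgauss [simp]: "space (cgauss v) = UNIV"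
  by (simp add: cgauss_def)

lemma prob_space_cgauss: "prob_space (cgauss v)"
proof -
  interpret S: prob_space std_normal by (rule prob_space_std_normal)
  interpret P: pair_prob_space std_normal std_normal ..
  show ?thesis unfolding cgauss_def by (rule P.prob_space_distr) measurable
qed

lemma cgauss_scale:
  assumes "0 \<le> a" "0 \<le> v"
  shows "distr (cgauss v) borel (\<lambda>x. of_real a * x) = cgauss (a\<^sup>2 * v)"
proof -
  have "sqrt (a\<^sup>2 * v / 2) = a * sqrt (v / 2)"
    using assms by (simp add: real_sqrt_mult real_sqrt_divide)
  then show ?thesis
    unfolding cgauss_def
    by (subst distr_distr) (auto simp: comp_def case_prod_beta' mult.assoc intro!: distr_cong)
qed

lemma brownian_motion_increment:
  assumes "brownian_motion M W" "0 \<le> s" "s < t"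
  shows "distr M borel (\<lambda>\<omega>. (W t \<omega> - W s \<omega>) / sqrt (t - s)) = std_normal"
proof -
  interpret prob_space M using assms(1) by (simp add: brownian_motion_def)
  have "distributed M lborel (\<lambda>\<omega>. W t \<omega> - W s \<omega>) (normal_density 0 (sqrt (t - s)))"
    using assms unfolding brownian_motion_def by blast
  then have "distributed M lborel (\<lambda>\<omega>. (W t \<omega> - W s \<omega> - 0) / sqrt (t - s)) std_normal_density"
    using assms by (subst (asm) normal_standard_normal_convert) auto
  then have "distr M lborel (\<lambda>\<omega>. (W t \<omega> - W s \<omega>) / sqrt (t - s)) = std_normal"
    by (simp add: distributed_distr_eq_density)
  moreover have "distr M lborel (\<lambda>\<omega>. (W t \<omega> - W s \<omega>) / sqrt (t - s))
      = distr M borel (\<lambda>\<omega>. (W t \<omega> - W s \<omega>) / sqrt (t - s))"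
    by (rule distr_cong) auto
  ultimately show ?thesis by simp
qed

lemma complex_brownian_motionE:
  assumes "complex_brownian_motion M B"
  obtains B1 B2 where "brownian_motion M B1" "brownian_motion M B2"
    "prob_space.indep_var M path_space (path_of B1) path_space (path_of B2)"
    "\<And>t \<omega>. 0 \<le> t \<Longrightarrow> \<omega> \<in> space M \<Longrightarrow> B t \<omega> = of_real (1 / sqrt 2) * Complex (B1 t \<omega>) (B2 t \<omega>)"
  using assms unfolding complex_brownian_motion_def Complex_eq by blast

lemma cbm_prob_space: "complex_brownian_motion M B \<Longrightarrow> prob_space M"
  by (auto simp: complex_brownian_motion_def brownian_motion_def)

lemma cbm_measurable:
  assumes "complex_brownian_motion M B" "0 \<le> t"
  shows "B t \<in> borel_measurable M"
proof -
  obtain B1 B2 where B: "brownian_motion M B1" "brownian_motion M B2"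
    "\<And>t \<omega>. 0 \<le> t \<Longrightarrow> \<omega> \<in> space M \<Longrightarrow> B t \<omega> = of_real (1 / sqrt 2) * Complex (B1 t \<omega>) (B2 t \<omega>)"
    using complex_brownian_motionE[OF assms(1)] by metis
  have [measurable]: "B1 t \<in> borel_measurable M" "B2 t \<in> borel_measurable M"
    using B assms(2) by (auto simp: brownian_motion_def)
  have "(\<lambda>\<omega>. of_real (1 / sqrt 2) * Complex (B1 t \<omega>) (B2 t \<omega>)) \<in> borel_measurable M"
    by measurable
  then show ?thesis using B(3)[OF assms(2)] by (subst measurable_cong) auto
qed

lemma cbm_0:
  assumes "complex_brownian_motion M B" "\<omega> \<in> space M"
  shows "B 0 \<omega> = 0"
  using complex_brownian_motionE[OF assms(1)] assms(2)
  by (metis (no_types, lifting) brownian_motion_def complex_of_real_def mult_zero_right of_real_0 order_refl)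

lemma cbm_continuous:
  assumes "complex_brownian_motion M B" "\<omega> \<in> space M"
  shows "continuous_on {0..} (\<lambda>t. B t \<omega>)"
proof -
  obtain B1 B2 where B: "brownian_motion M B1" "brownian_motion M B2"
    "\<And>t \<omega>. 0 \<le> t \<Longrightarrow> \<omega> \<in> space M \<Longrightarrow> B t \<omega> = of_real (1 / sqrt 2) * Complex (B1 t \<omega>) (B2 t \<omega>)"
    using complex_brownian_motionE[OF assms(1)] by metis
  have c: "continuous_on {0..} (\<lambda>t. B1 t \<omega>)" "continuous_on {0..} (\<lambda>t. B2 t \<omega>)"
    using B assms(2) by (auto simp: brownian_motion_def continuous_paths_def)
  have "continuous_on {0..} (\<lambda>t. of_real (1 / sqrt 2) * Complex (B1 t \<omega>) (B2 t \<omega>))"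
    unfolding Complex_eq by (intro continuous_intros c)
  then show ?thesis by (subst continuous_on_cong[OF refl B(3)]) (use assms in auto)
qed

lemma cbm_increment:
  assumes "complex_brownian_motion M B" "0 \<le> s" "s \<le> t"
  shows "distr M borel (\<lambda>\<omega>. B t \<omega> - B s \<omega>) = cgauss (t - s)"
proof (cases "s = t")
  \<comment> \<open>The definition gives the law of an increment only for \<open>s < t\<close>; for
    \<open>s = t\<close> both sides are the point mass at 0.\<close>
  case True
  interpret prob_space M using assms(1) by (rule cbm_prob_space)
  interpret S: prob_space std_normal by (rule prob_space_std_normal)
  interpret P: pair_prob_space std_normal std_normal ..
  have "(\<lambda>(x, y). of_real (sqrt (0 / 2)) * Complex x y) = (\<lambda>_. 0)" by auto
  then have "cgauss 0 = distr (std_normal \<Otimes>\<^sub>M std_normal) borel (\<lambda>_. 0)"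
    unfolding cgauss_def by simp
  also have "\<dots> = distr M borel (\<lambda>_. 0)"
    by (rule measure_eqI) (auto simp: emeasure_distr emeasure_space_1 P.emeasure_space_1 indicator_def
        simp flip: space_pair_measure split: if_splits)
  finally show ?thesis using True by simp
next
  case False
  then have st: "s < t" using assms by simp
  interpret prob_space M using assms(1) by (rule cbm_prob_space)
  obtain B1 B2 where B: "brownian_motion M B1" "brownian_motion M B2"
    "indep_var path_space (path_of B1) path_space (path_of B2)"
    "\<And>t \<omega>. 0 \<le> t \<Longrightarrow> \<omega> \<in> space M \<Longrightarrow> B t \<omega> = of_real (1 / sqrt 2) * Complex (B1 t \<omega>) (B2 t \<omega>)"
    using complex_brownian_motionE[OF assms(1)] by metis
  define X where "X W \<omega> = (W t \<omega> - W s \<omega>) / sqrt (t - s)" for W and \<omega> :: 'a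
  have [measurable]: "(\<lambda>f. f s) \<in> borel_measurable path_space"
    "(\<lambda>f. f t) \<in> borel_measurable path_space"
    using assms by (auto intro: measurable_path_eval)
  have "indep_var borel ((\<lambda>p. (p t - p s) / sqrt (t - s)) \<circ> path_of B1)
          borel ((\<lambda>p. (p t - p s) / sqrt (t - s)) \<circ> path_of B2)"
    by (rule indep_var_compose[OF B(3)]) measurable
  moreover have "(\<lambda>p. (p t - p s) / sqrt (t - s)) \<circ> path_of W = X W" for W :: "real \<Rightarrow> 'a \<Rightarrow> real"
    using assms by (auto simp: X_def)
  ultimately have ind: "indep_var borel (X B1) borel (X B2)" by simp
  have [measurable]: "X B1 \<in> borel_measurable M" "X B2 \<in> borel_measurable M"
    using indep_var_rv1[OF ind] indep_var_rv2[OF ind] by auto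
  have X: "distr M borel (X B1) = std_normal" "distr M borel (X B2) = std_normal"
    using brownian_motion_increment[OF B(1) assms(2) st] brownian_motion_increment[OF B(2) assms(2) st]
    unfolding X_def by auto
  have "std_normal \<Otimes>\<^sub>M std_normal = distr M (borel \<Otimes>\<^sub>M borel) (\<lambda>\<omega>. (X B1 \<omega>, X B2 \<omega>))"
    using ind unfolding indep_var_distribution_eq X by simp
  then have "cgauss (t - s) = distr M borel (\<lambda>\<omega>. of_real (sqrt ((t - s) / 2)) * Complex (X B1 \<omega>) (X B2 \<omega>))"
    unfolding cgauss_def by (simp add: distr_distr comp_def)
  also have "\<dots> = distr M borel (\<lambda>\<omega>. B t \<omega> - B s \<omega>)"
  proof (rule distr_cong)
    fix \<omega> assume \<omega>: "\<omega> \<in> space M"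
    have c: "of_real (sqrt ((t - s) / 2)) * Complex (a / sqrt (t - s)) (b / sqrt (t - s))
        = of_real (1 / sqrt 2) * Complex a b" for a b
      using st by (simp add: complex_eq_iff real_sqrt_divide)
    show "of_real (sqrt ((t - s) / 2)) * Complex (X B1 \<omega>) (X B2 \<omega>) = B t \<omega> - B s \<omega>"
      using st assms \<omega> unfolding X_def c
      by (simp add: B(4) complex_eq_iff diff_divide_distrib)
  qed auto
  finally show ?thesis by simp
qed

lemma cbm_law:
  assumes "complex_brownian_motion M B" "0 \<le> t"
  shows "distr M borel (B t) = cgauss t"
proof -
  have "distr M borel (\<lambda>\<omega>. B t \<omega> - B 0 \<omega>) = cgauss t"
    using cbm_increment[OF assms(1), of 0 t] assms(2) by simp
  moreover have "distr M borel (\<lambda>\<omega>. B t \<omega> - B 0 \<omega>) = distr M borel (B t)"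
    by (rule distr_cong) (auto simp: cbm_0[OF assms(1)])
  ultimately show ?thesis by simp
qed

text \<open>Independence over \<open>i\<close> is known for each real component, and independence
  between the components is known for whole paths. A finite family of component increments splits
  into an event of the first path and one of the second, so all of them are jointly independent;
  pairing the two with the same \<open>i\<close> gives the complex increments.\<close>

lemma cbm_indep_increments:
  assumes "complex_brownian_motion M B" and \<tau>: "mono (\<tau> :: nat \<Rightarrow> real)" "0 \<le> \<tau> 0"
  shows "prob_space.indep_vars M (\<lambda>_. borel) (\<lambda>i \<omega>. B (\<tau> (Suc i)) \<omega> - B (\<tau> i) \<omega>) UNIV"
proof -
  interpret prob_space M using assms(1) by (rule cbm_prob_space)
  obtain B1 B2 where B: "brownian_motion M B1" "brownian_motion M B2"
    "indep_var path_space (path_of B1) path_space (path_of B2)"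
    "\<And>t \<omega>. 0 \<le> t \<Longrightarrow> \<omega> \<in> space M \<Longrightarrow> B t \<omega> = of_real (1 / sqrt 2) * Complex (B1 t \<omega>) (B2 t \<omega>)"
    using complex_brownian_motionE[OF assms(1)] by metis
  have pos: "0 \<le> \<tau> i" for i using \<tau> monoD[OF \<tau>(1), of 0 i] by simp
  define D where "D W i \<omega> = W (\<tau> (Suc i)) \<omega> - W (\<tau> i) \<omega>" for W :: "real \<Rightarrow> 'a \<Rightarrow> real" and i \<omega>
  have D: "indep_vars (\<lambda>_. borel) (D B1) UNIV" "indep_vars (\<lambda>_. borel) (D B2) UNIV"
    using B(1,2) \<tau> unfolding brownian_motion_def D_def by auto
  define X where "X p = D (if fst p then B1 else B2) (snd p)" for p :: "bool \<times> nat"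
  have rv: "D B1 i \<in> borel_measurable M" "D B2 i \<in> borel_measurable M" for i
    using D by (auto simp: indep_vars_def)
  have Xrv: "X p \<in> borel_measurable M" for p
    using rv by (auto simp: X_def)
  have DB: "D W i \<omega> = (\<lambda>f. f (\<tau> (Suc i)) - f (\<tau> i)) (path_of W \<omega>)" for W i \<omega>
    by (simp add: D_def pos)
  have ind: "indep_vars (\<lambda>_. borel) X UNIV"
    unfolding indep_vars_def2
  proof (rule conjI, use Xrv in blast, rule indep_setsI)
    fix A and J :: "(bool \<times> nat) set"
    assume J: "J \<noteq> {}" "finite J" "\<forall>j\<in>J. A j \<in> {X j -` A \<inter> space M |A. A \<in> sets borel}"
    then have "\<forall>j\<in>J. \<exists>C. A j = X j -` C \<inter> space M \<and> C \<in> sets borel" by simp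
    from bchoice[OF this] obtain C
      where C: "\<And>j. j \<in> J \<Longrightarrow> C j \<in> sets borel" "\<And>j. j \<in> J \<Longrightarrow> A j = X j -` C j \<inter> space M"
      by blast
    define J' where "J' b = {i. (b, i) \<in> J}" for b
    have fin: "finite (J' b)" for b
      by (rule finite_subset[of _ "snd ` J"]) (use J in \<open>force simp: J'_def\<close>)+
    have JJ: "J = (Pair True ` J' True) \<union> (Pair False ` J' False)"
    proof (intro set_eqI)
      fix p :: "bool \<times> nat"
      show "p \<in> J \<longleftrightarrow> p \<in> (Pair True ` J' True) \<union> (Pair False ` J' False)"
        by (cases p; cases "fst p") (auto simp: J'_def)
    qed
    \<comment> \<open>The part of the event that concerns component \<open>b\<close>, expressed
      through its path so that independence of the two paths applies.\<close>
    define E where "E b = {f \<in> space path_space. \<forall>i\<in>J' b. f (\<tau> (Suc i)) - f (\<tau> i) \<in> C (b, i)}" for b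
    have E: "E b \<in> sets path_space" for b
      unfolding E_def
    proof (rule sets.sets_Collect_finite_All)
      fix i assume "i \<in> J' b"
      then have "C (b, i) \<in> sets borel" by (auto simp: J'_def C)
      moreover have "(\<lambda>f. f (\<tau> (Suc i)) - f (\<tau> i)) \<in> borel_measurable (path_space :: (real \<Rightarrow> real) measure)"
        by (intro borel_measurable_diff measurable_path_eval pos)
      ultimately show "{f \<in> space path_space. f (\<tau> (Suc i)) - f (\<tau> i) \<in> C (b, i)} \<in> sets path_space"
        by measurable
    qed (rule fin)
    have E1: "path_of B1 \<omega> \<in> E True \<longleftrightarrow> (\<forall>i\<in>J' True. D B1 i \<omega> \<in> C (True, i))" for \<omega>
      by (auto simp: E_def DB)
    have E2: "path_of B2 \<omega> \<in> E False \<longleftrightarrow> (\<forall>i\<in>J' False. D B2 i \<omega> \<in> C (False, i))" for \<omega>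
      by (auto simp: E_def DB)
    have "(\<Inter>j\<in>J. A j) = {\<omega>\<in>space M. path_of B1 \<omega> \<in> E True \<and> path_of B2 \<omega> \<in> E False}"
      unfolding E1 E2 using J(1) C(2) by (auto simp: J'_def X_def split: if_splits)
    then have "prob (\<Inter>j\<in>J. A j) = prob {\<omega>\<in>space M. \<forall>i\<in>J' True. D B1 i \<omega> \<in> C (True, i)}
        * prob {\<omega>\<in>space M. \<forall>i\<in>J' False. D B2 i \<omega> \<in> C (False, i)}"
      using prob_indep_var[OF B(3) E E, of True False] by (simp add: E1 E2)
    also have "\<dots> = (\<Prod>i\<in>J' True. prob {\<omega>\<in>space M. D B1 i \<omega> \<in> C (True, i)})
        * (\<Prod>i\<in>J' False. prob {\<omega>\<in>space M. D B2 i \<omega> \<in> C (False, i)})"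
      by (intro arg_cong2[where f="(*)"] prob_indep_vars_ball[OF D(1)] prob_indep_vars_ball[OF D(2)])
        (use fin C in \<open>auto simp: J'_def\<close>)
    also have "\<dots> = (\<Prod>j\<in>Pair True ` J' True. prob (A j)) * (\<Prod>j\<in>Pair False ` J' False. prob (A j))"
      by (intro arg_cong2[where f="(*)"])
        (auto simp: prod.reindex inj_on_def J'_def C X_def vimage_def Int_def conj_commute intro!: prod.cong)
    also have "\<dots> = (\<Prod>j\<in>Pair True ` J' True \<union> Pair False ` J' False. prob (A j))"
      by (rule prod.union_disjoint[symmetric]) (use fin in auto)
    also have "\<dots> = (\<Prod>j\<in>J. prob (A j))"
      unfolding JJ[symmetric] ..
    finally show "prob (\<Inter>j\<in>J. A j) = (\<Prod>j\<in>J. prob (A j))" .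
  qed (use Xrv in \<open>auto intro: measurable_sets\<close>)
  \<comment> \<open>The index blocks \<open>UNIV \<times> {i}\<close> are disjoint, and each
    contains the two component increments of interval \<open>i\<close>.\<close>
  have "indep_vars (\<lambda>i. PiM (UNIV \<times> {i}) (\<lambda>_. borel)) (\<lambda>i \<omega>. \<lambda>p\<in>UNIV \<times> {i}. X p \<omega>) UNIV"
    by (rule indep_vars_restrict[OF ind]) (auto simp: disjoint_family_on_def)
  then have "indep_vars (\<lambda>_. borel)
      (\<lambda>i \<omega>. (\<lambda>f. of_real (1 / sqrt 2) * Complex (f (True, i)) (f (False, i))) (\<lambda>p\<in>UNIV \<times> {i}. X p \<omega>)) UNIV"
    by (rule indep_vars_compose2) measurable
  moreover have "B (\<tau> (Suc i)) \<omega> - B (\<tau> i) \<omega>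
      = (\<lambda>f. of_real (1 / sqrt 2) * Complex (f (True, i)) (f (False, i))) (\<lambda>p\<in>UNIV \<times> {i}. X p \<omega>)"
    if "\<omega> \<in> space M" for i \<omega>
    using B(4)[OF pos that] by (simp add: X_def D_def complex_eq_iff field_simps)
  ultimately show ?thesis
    by (elim indep_vars_cong_space) simp
qed

section \<open>Gaussian tails and a maximal inequality\<close>

text \<open>The Markov property on a time grid, in the form used for every Brownian estimate below:
  past positions and future displacements are partial sums over disjoint sets of independent
  increments.\<close>

lemma cbm_past_future:
  assumes cbm: "complex_brownian_motion M B" and \<tau>: "mono (\<tau> :: nat \<Rightarrow> real)" "0 \<le> \<tau> 0"
  shows "prob_space.indep_var M
    (PiM {..k} (\<lambda>_. borel)) (\<lambda>\<omega>. \<lambda>i\<in>{..k}. B (\<tau> i) \<omega>)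
    (PiM {..l} (\<lambda>_. borel)) (\<lambda>\<omega>. \<lambda>j\<in>{..l}. B (\<tau> (k + j)) \<omega> - B (\<tau> k) \<omega>)"
proof -
  interpret prob_space M using cbm by (rule cbm_prob_space)
  \<comment> \<open>Prepending the time 0 makes the position at \<open>\<tau> 0\<close> itself an
    increment, so that \<open>D i\<close> ends at time \<open>\<tau> i\<close>.\<close>
  define \<sigma> where "\<sigma> = case_nat 0 \<tau>"
  have \<sigma>: "mono \<sigma>" "0 \<le> \<sigma> 0"
    using \<tau> by (auto simp: \<sigma>_def mono_iff_le_Suc split: nat.split)
  define D where "D i \<omega> = B (\<sigma> (Suc i)) \<omega> - B (\<sigma> i) \<omega>" for i \<omega>
  have "indep_vars (\<lambda>_. borel) D UNIV"
    unfolding D_def by (rule cbm_indep_increments[OF cbm \<sigma>])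
  from indep_var_restrict[OF this, of "{..k}" "{Suc k..k + l}"]
  have "indep_var (PiM {..k} (\<lambda>_. borel)) (\<lambda>\<omega>. \<lambda>i\<in>{..k}. D i \<omega>)
      (PiM {Suc k..k + l} (\<lambda>_. borel)) (\<lambda>\<omega>. \<lambda>i\<in>{Suc k..k + l}. D i \<omega>)"
    by auto
  then have "indep_var
      (PiM {..k} (\<lambda>_. borel)) ((\<lambda>f. \<lambda>i\<in>{..k}. \<Sum>j\<le>i. f j) \<circ> (\<lambda>\<omega>. \<lambda>i\<in>{..k}. D i \<omega>))
      (PiM {..l} (\<lambda>_. borel)) ((\<lambda>f. \<lambda>j\<in>{..l}. \<Sum>i<j. f (Suc k + i)) \<circ> (\<lambda>\<omega>. \<lambda>i\<in>{Suc k..k + l}. D i \<omega>))"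
    by (rule indep_var_compose)
      (intro measurable_restrict borel_measurable_sum measurable_component_singleton; auto)+
  then show ?thesis
  proof (rule indep_var_cong_space)
    fix \<omega> assume \<omega>: "\<omega> \<in> space M"
    have "(\<Sum>j\<le>i. D j \<omega>) = B (\<tau> i) \<omega>" for i
      by (induction i) (auto simp: D_def \<sigma>_def cbm_0[OF cbm \<omega>])
    moreover have "(\<Sum>j\<le>i. (\<lambda>i\<in>{..k}. D i \<omega>) j) = (\<Sum>j\<le>i. D j \<omega>)" if "i \<le> k" for i
      by (rule sum.cong) (use that in auto)
    ultimately show "(\<lambda>i\<in>{..k}. B (\<tau> i) \<omega>)
        = ((\<lambda>f. \<lambda>i\<in>{..k}. \<Sum>j\<le>i. f j) \<circ> (\<lambda>\<omega>. \<lambda>i\<in>{..k}. D i \<omega>)) \<omega>"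
      by (auto intro!: restrict_ext simp del: restrict_apply)
    have "(\<Sum>i<j. D (Suc k + i) \<omega>) = B (\<tau> (k + j)) \<omega> - B (\<tau> k) \<omega>" for j
      by (induction j) (auto simp: D_def \<sigma>_def)
    moreover have "(\<Sum>i<j. (\<lambda>i\<in>{Suc k..k + l}. D i \<omega>) (Suc k + i)) = (\<Sum>i<j. D (Suc k + i) \<omega>)"
      if "j \<le> l" for j
      by (rule sum.cong) (use that in auto)
    ultimately show "(\<lambda>j\<in>{..l}. B (\<tau> (k + j)) \<omega> - B (\<tau> k) \<omega>)
        = ((\<lambda>f. \<lambda>j\<in>{..l}. \<Sum>i<j. f (Suc k + i)) \<circ> (\<lambda>\<omega>. \<lambda>i\<in>{Suc k..k + l}. D i \<omega>)) \<omega>"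
      by (auto intro!: restrict_ext simp del: restrict_apply)
  qed
qed

text \<open>Completing the square: integrand times standard density is a constant multiple of the
  normal density with mean \<open>b * a / (1 - b)\<close> and standard deviation
  \<open>1 / sqrt (1 - b)\<close>, which makes sense because \<open>b < 1\<close>.\<close>

lemma nn_integral_std_normal_exp_sq:
  assumes b: "0 \<le> b" "b < 1"
  shows "(\<integral>\<^sup>+x. ennreal (exp (b / 2 * (a + x)\<^sup>2)) \<partial>std_normal)
       = ennreal (exp (b * a\<^sup>2 / (2 * (1 - b))) / sqrt (1 - b))"
proof -
  let ?\<mu> = "b * a / (1 - b)" and ?\<sigma> = "1 / sqrt (1 - b)"
  let ?c = "exp (b * a\<^sup>2 / (2 * (1 - b))) / sqrt (1 - b)"
  have pos: "0 < 1 - b" using b by simp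
  have eq: "std_normal_density x * exp (b / 2 * (a + x)\<^sup>2) = ?c * normal_density ?\<mu> ?\<sigma> x" for x
  proof -
    have "- x\<^sup>2 / 2 + b / 2 * (a + x)\<^sup>2 = b * a\<^sup>2 / (2 * (1 - b)) + (- (x - ?\<mu>)\<^sup>2 / (2 * ?\<sigma>\<^sup>2))"
    proof -
      have "x - ?\<mu> = ((1 - b) * x - b * a) / (1 - b)"
        using pos by (simp add: field_simps)
      then have "(x - ?\<mu>)\<^sup>2 / (2 * ?\<sigma>\<^sup>2) = ((1 - b) * x - b * a)\<^sup>2 / (2 * (1 - b))"
        using pos by (simp add: power_divide power2_eq_square)
      moreover have "- x\<^sup>2 / 2 + b / 2 * (a + x)\<^sup>2 = (b * a\<^sup>2 - ((1 - b) * x - b * a)\<^sup>2) / (2 * (1 - b))"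
        using pos by (simp add: field_simps power2_eq_square)
      ultimately show ?thesis by (simp add: diff_divide_distrib)
    qed
    then have "exp (- x\<^sup>2 / 2) * exp (b / 2 * (a + x)\<^sup>2)
        = exp (b * a\<^sup>2 / (2 * (1 - b))) * exp (- (x - ?\<mu>)\<^sup>2 / (2 * ?\<sigma>\<^sup>2))"
      by (simp flip: exp_add)
    moreover have "sqrt (2 * pi * ?\<sigma>\<^sup>2) = sqrt (2 * pi) / sqrt (1 - b)"
      using pos by (simp add: real_sqrt_mult real_sqrt_divide power_divide)
    ultimately show ?thesis
      using pos unfolding std_normal_density_def normal_density_def by (simp add: field_simps)
  qed
  have nn: "0 \<le> exp y / sqrt (1 - b)" for y
    by (intro divide_nonneg_nonneg) (use b in auto)
  have eq': "ennreal (std_normal_density x) * ennreal (exp (b / 2 * (a + x)\<^sup>2))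
      = ennreal ?c * ennreal (normal_density ?\<mu> ?\<sigma> x)" for x
    by (subst (1 2) ennreal_mult[symmetric]) (simp_all only: eq normal_density_nonneg exp_ge_zero nn)
  have "(\<integral>\<^sup>+x. ennreal (exp (b / 2 * (a + x)\<^sup>2)) \<partial>std_normal)
      = (\<integral>\<^sup>+x. ennreal ?c * ennreal (normal_density ?\<mu> ?\<sigma> x) \<partial>lborel)"
    unfolding eq'[symmetric] by (rule nn_integral_density) measurable
  also have "\<dots> = ennreal ?c * (\<integral>\<^sup>+x. ennreal (normal_density ?\<mu> ?\<sigma> x) \<partial>lborel)"
    by (rule nn_integral_cmult) simp
  also have "(\<integral>\<^sup>+x. ennreal (normal_density ?\<mu> ?\<sigma> x) \<partial>lborel) = 1"
    using pos by (subst nn_integral_eq_integral) auto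
  finally show ?thesis by simp
qed

lemma nn_integral_cgauss_prod:
  assumes [measurable]: "f \<in> borel_measurable borel" "g \<in> borel_measurable borel"
  shows "(\<integral>\<^sup>+x. f (Re x) * g (Im x) \<partial>cgauss v)
       = (\<integral>\<^sup>+x. f (sqrt (v / 2) * x) \<partial>std_normal) * (\<integral>\<^sup>+y. g (sqrt (v / 2) * y) \<partial>std_normal)"
proof -
  interpret S: prob_space std_normal by (rule prob_space_std_normal)
  interpret P: pair_prob_space std_normal std_normal ..
  have "(\<integral>\<^sup>+x. f (Re x) * g (Im x) \<partial>cgauss v)
      = (\<integral>\<^sup>+p. f (sqrt (v / 2) * fst p) * g (sqrt (v / 2) * snd p) \<partial>(std_normal \<Otimes>\<^sub>M std_normal))"
    unfolding cgauss_def
    by (subst nn_integral_distr) (auto simp: case_prod_beta' intro!: nn_integral_cong)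
  also have "\<dots> = (\<integral>\<^sup>+x. \<integral>\<^sup>+y. f (sqrt (v / 2) * x) * g (sqrt (v / 2) * y) \<partial>std_normal \<partial>std_normal)"
    by (subst S.nn_integral_fst[symmetric]) auto
  also have "\<dots> = (\<integral>\<^sup>+x. f (sqrt (v / 2) * x) \<partial>std_normal) * (\<integral>\<^sup>+y. g (sqrt (v / 2) * y) \<partial>std_normal)"
    by (simp add: nn_integral_cmult nn_integral_multc)
  finally show ?thesis .
qed

lemma nn_integral_cgauss_exp:
  assumes b: "0 < b" "b < 1"
  shows "(\<integral>\<^sup>+x. ennreal (exp (b * (cmod (z + x))\<^sup>2)) \<partial>cgauss 1)
       = ennreal (exp (b * (cmod z)\<^sup>2 / (1 - b)) / (1 - b))"
proof -
  have pos: "0 < 1 - b" using b by simp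
  have nn: "0 \<le> exp y / sqrt (1 - b)" for y
    by (intro divide_nonneg_nonneg) (use b in auto)
  have half: "b * (sqrt 2 * y)\<^sup>2 / (2 * (1 - b)) = b * y\<^sup>2 / (1 - b)" for y
    using pos by (simp add: power_mult_distrib divide_simps)
  \<comment> \<open>Each component of \<open>cgauss 1\<close> has variance 1/2; pulling out sqrt 2
    restores a standard normal variable and halves \<open>b\<close>.\<close>
  have *: "b * (a + sqrt (1 / 2) * x)\<^sup>2 = b / 2 * (sqrt 2 * a + x)\<^sup>2" for a x :: real
  proof -
    have "a + sqrt (1 / 2) * x = (sqrt 2 * a + x) / sqrt 2"
      by (simp add: real_sqrt_divide field_simps)
    then show ?thesis by (simp add: power_divide)
  qed
  have "(\<integral>\<^sup>+x. ennreal (exp (b * (cmod (z + x))\<^sup>2)) \<partial>cgauss 1)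
     = (\<integral>\<^sup>+x. ennreal (exp (b * (Re z + Re x)\<^sup>2)) * ennreal (exp (b * (Im z + Im x)\<^sup>2)) \<partial>cgauss 1)"
    by (simp add: cmod_power2 distrib_left exp_add ennreal_mult)
  also have "\<dots> = (\<integral>\<^sup>+x. ennreal (exp (b / 2 * (sqrt 2 * Re z + x)\<^sup>2)) \<partial>std_normal)
      * (\<integral>\<^sup>+x. ennreal (exp (b / 2 * (sqrt 2 * Im z + x)\<^sup>2)) \<partial>std_normal)"
    by (subst nn_integral_cgauss_prod) (auto simp: *)
  also have "\<dots> = ennreal (exp (b * (sqrt 2 * Re z)\<^sup>2 / (2 * (1 - b))) / sqrt (1 - b)
      * (exp (b * (sqrt 2 * Im z)\<^sup>2 / (2 * (1 - b))) / sqrt (1 - b)))"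
    unfolding nn_integral_std_normal_exp_sq[OF less_imp_le[OF b(1)] b(2)]
    by (rule ennreal_mult[symmetric]) (rule nn)+
  also have "exp (b * (sqrt 2 * Re z)\<^sup>2 / (2 * (1 - b))) / sqrt (1 - b)
      * (exp (b * (sqrt 2 * Im z)\<^sup>2 / (2 * (1 - b))) / sqrt (1 - b))
      = exp (b * (cmod z)\<^sup>2 / (1 - b)) / (1 - b)"
    unfolding half using pos
    by (simp add: cmod_power2 distrib_left add_divide_distrib flip: exp_add)
  finally show ?thesis .
qed

text \<open>Markov's inequality for exp (|x|^2 / 2) under \<open>cgauss 1\<close>, whose mean is 2.
  That moment is the factor 2, and staying at half the critical exponent is why the rate is 1 / (2
  v) and not 1 / v.\<close>

lemma cgauss_tail:
  assumes "0 < v" "0 \<le> a"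
  shows "measure (cgauss v) {x. a \<le> cmod x} \<le> 2 * exp (- a\<^sup>2 / (2 * v))"
proof -
  interpret prob_space "cgauss 1" by (rule prob_space_cgauss)
  interpret V: prob_space "cgauss v" by (rule prob_space_cgauss)
  have v: "cgauss v = distr (cgauss 1) borel (\<lambda>x. of_real (sqrt v) * x)"
    using cgauss_scale[of "sqrt v" 1] assms by simp
  have m: "(\<lambda>x. of_real (sqrt v) * x) \<in> borel_measurable (cgauss 1)" by measurable
  have "emeasure (cgauss v) {x. a \<le> cmod x} = emeasure (cgauss 1) {x. a \<le> sqrt v * cmod x}"
    unfolding v by (subst emeasure_distr[OF m]) (auto simp: norm_mult assms less_imp_le intro!: arg_cong[where f="emeasure _"])
  also have "\<dots> = (\<integral>\<^sup>+x. indicator {x. a \<le> sqrt v * cmod x} x \<partial>cgauss 1)"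
    by simp
  also have "\<dots> \<le> (\<integral>\<^sup>+x. ennreal (exp (- a\<^sup>2 / (2 * v))) * ennreal (exp (1 / 2 * (cmod (0 + x))\<^sup>2)) \<partial>cgauss 1)"
  proof (rule nn_integral_mono)
    fix x
    have "1 \<le> exp (- a\<^sup>2 / (2 * v)) * exp (1 / 2 * (cmod x)\<^sup>2)" if "a \<le> sqrt v * cmod x"
    proof -
      have "a\<^sup>2 \<le> (sqrt v * cmod x)\<^sup>2" using that assms by (intro power_mono) auto
      then have "a\<^sup>2 \<le> v * (cmod x)\<^sup>2" using assms by (simp add: power_mult_distrib)
      then have "a\<^sup>2 / (2 * v) \<le> (cmod x)\<^sup>2 / 2" using assms by (simp add: field_simps)
      then show ?thesis by (simp flip: exp_add)
    qed
    then show "indicator {x. a \<le> sqrt v * cmod x} x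
        \<le> ennreal (exp (- a\<^sup>2 / (2 * v))) * ennreal (exp (1 / 2 * (cmod (0 + x))\<^sup>2))"
      by (auto simp: indicator_def simp flip: ennreal_mult)
  qed
  also have "\<dots> = ennreal (exp (- a\<^sup>2 / (2 * v))) * ennreal 2"
    by (subst nn_integral_cmult) (use nn_integral_cgauss_exp[of "1/2" 0] in auto)
  also have "\<dots> = ennreal (2 * exp (- a\<^sup>2 / (2 * v)))"
    by (subst ennreal_mult[symmetric]) (auto simp: mult.commute)
  finally show ?thesis
    unfolding V.emeasure_eq_measure by (subst (asm) ennreal_le_iff) auto
qed

lemma (in prob_space) prob_distr:
  assumes "X \<in> borel_measurable M" "A \<in> sets borel"
  shows "prob {\<omega>\<in>space M. X \<omega> \<in> A} = measure (distr M borel X) A"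
  using assms by (subst measure_distr) (auto intro!: arg_cong[where f=prob])

text \<open>\<open>v\<close> only dominates \<open>t - s\<close>, so that one bound covers every
  subinterval of a block.\<close>

lemma cbm_tail:
  assumes cbm: "complex_brownian_motion M B" and st: "0 \<le> s" "s \<le> t" "t - s \<le> v" "0 < v" "0 \<le> a"
  shows "measure M {\<omega>\<in>space M. a < cmod (B t \<omega> - B s \<omega>)} \<le> 2 * exp (- a\<^sup>2 / (2 * v))"
proof (cases "s = t")
  case True
  then have "{\<omega>\<in>space M. a < cmod (B t \<omega> - B s \<omega>)} = {}" using st by auto
  then show ?thesis by (simp only:) simp
next
  case False
  interpret prob_space M using cbm by (rule cbm_prob_space)
  interpret V: prob_space "cgauss (t - s)" by (rule prob_space_cgauss)
  have [measurable]: "B t \<in> borel_measurable M" "B s \<in> borel_measurable M"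
    using cbm_measurable[OF cbm] st by auto
  have "prob {\<omega>\<in>space M. a < cmod (B t \<omega> - B s \<omega>)} = measure (cgauss (t - s)) {x. a < cmod x}"
    using prob_distr[of "\<lambda>\<omega>. B t \<omega> - B s \<omega>" "{x. a < cmod x}"] cbm_increment[OF cbm st(1,2)] by simp
  also have "\<dots> \<le> measure (cgauss (t - s)) {x. a \<le> cmod x}"
    by (rule V.finite_measure_mono) auto
  also have "\<dots> \<le> 2 * exp (- a\<^sup>2 / (2 * (t - s)))"
    by (rule cgauss_tail) (use False st in auto)
  also have "\<dots> \<le> 2 * exp (- a\<^sup>2 / (2 * v))"
    using False st by (auto intro!: divide_left_mono)
  finally show ?thesis .
qed

text \<open>Ottaviani's inequality. If the walk first exceeds \<open>h\<close> at step k and then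
  moves by at most \<open>h / 2\<close> up to step \<open>N\<close>, its final displacement exceeds
  \<open>h / 2\<close>; the second event is independent of the first and has probability at least
  1/2. The 8 is twice the 4 from squaring \<open>h / 2\<close>, and the leading 4 is twice the
  factor 2 of the tail bound. The bound does not involve \<open>N\<close>, which allows arbitrarily
  fine grids.\<close>

lemma cbm_maximal_grid:
  assumes cbm: "complex_brownian_motion M B" and \<tau>: "mono (\<tau> :: nat \<Rightarrow> real)" "0 \<le> \<tau> 0"
    and v: "0 < v" "\<tau> N - \<tau> 0 \<le> v" and h: "0 \<le> h"
  shows "measure M {\<omega>\<in>space M. \<exists>j\<le>N. h < cmod (B (\<tau> j) \<omega> - B (\<tau> 0) \<omega>)} \<le> 4 * exp (- h\<^sup>2 / (8 * v))"
proof -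
  interpret prob_space M using cbm by (rule cbm_prob_space)
  define e where "e = exp (- h\<^sup>2 / (8 * v))"
  have pos: "0 \<le> \<tau> i" for i using \<tau> monoD[OF \<tau>(1), of 0 i] by simp
  have B [measurable]: "B (\<tau> i) \<in> borel_measurable M" for i
    using cbm_measurable[OF cbm pos] .
  define Y where "Y i \<omega> = B (\<tau> i) \<omega> - B (\<tau> 0) \<omega>" for i \<omega>
  have Y [measurable]: "Y i \<in> borel_measurable M" for i
    unfolding Y_def by measurable
  have tail: "prob {\<omega>\<in>space M. h / 2 < cmod (B (\<tau> j) \<omega> - B (\<tau> i) \<omega>)} \<le> 2 * e"
    if "i \<le> j" "j \<le> N" for i j
  proof -
    have "\<tau> j - \<tau> i \<le> v" using v monoD[OF \<tau>(1), of 0 i] monoD[OF \<tau>(1), of j N] that by auto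
    with cbm_tail[OF cbm pos monoD[OF \<tau>(1) that(1)] this v(1), of "h / 2"] h
    show ?thesis by (simp add: e_def power_divide)
  qed
  \<comment> \<open>Either the tail bound \<open>2 * e\<close> is at most 1/2, as the doubling below
    requires, or the claimed bound is at least 1.\<close>
  show ?thesis
  proof (cases "2 * e \<le> 1 / 2")
    case False
    then have "1 \<le> 4 * e" by simp
    with prob_le_1 show ?thesis unfolding e_def by (rule order_trans)
  next
    case True
    define E where "E k = {\<omega>\<in>space M. h < cmod (Y k \<omega>) \<and> (\<forall>i<k. cmod (Y i \<omega>) \<le> h)}" for k
    define F where "F k = {\<omega>\<in>space M. cmod (B (\<tau> N) \<omega> - B (\<tau> k) \<omega>) \<le> h / 2}" for k
    have [measurable]: "E k \<in> events" "F k \<in> events" for k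
      unfolding E_def F_def by measurable
    have disj: "disjoint_family_on E {..N}" "disjoint_family_on (\<lambda>k. E k \<inter> F k) {..N}"
      unfolding disjoint_family_on_def E_def by (auto simp: linorder_neq_iff)
    have half: "prob (E k) \<le> 2 * prob (E k \<inter> F k)" if k: "k \<le> N" for k
    proof -
      let ?A = "{f \<in> space (PiM {..k} (\<lambda>_. borel)). h < cmod (f k - f 0) \<and> (\<forall>i<k. cmod (f i - f 0) \<le> h)}"
      let ?C = "{f \<in> space (PiM {..N - k} (\<lambda>_. borel)). cmod (f (N - k)) \<le> h / 2}"
      have "prob {\<omega>\<in>space M. (\<lambda>i\<in>{..k}. B (\<tau> i) \<omega>) \<in> ?A \<and> (\<lambda>j\<in>{..N - k}. B (\<tau> (k + j)) \<omega> - B (\<tau> k) \<omega>) \<in> ?C}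
        = prob {\<omega>\<in>space M. (\<lambda>i\<in>{..k}. B (\<tau> i) \<omega>) \<in> ?A}
        * prob {\<omega>\<in>space M. (\<lambda>j\<in>{..N - k}. B (\<tau> (k + j)) \<omega> - B (\<tau> k) \<omega>) \<in> ?C}"
      proof (rule prob_indep_var[OF cbm_past_future[OF cbm \<tau>]])
        have [measurable]: "(\<lambda>f. f i) \<in> borel_measurable (PiM {..k} (\<lambda>_. borel))" if "i \<le> k" for i
          by (rule measurable_component_singleton) (use that in auto)
        have "{f \<in> space (PiM {..k} (\<lambda>_. borel)). \<forall>i\<in>{..<k}. cmod (f i - f 0) \<le> h} \<in> sets (PiM {..k} (\<lambda>_. borel))"
          by (rule sets.sets_Collect_finite_All) auto
        moreover have "{f \<in> space (PiM {..k} (\<lambda>_. borel)). h < cmod (f k - f 0)} \<in> sets (PiM {..k} (\<lambda>_. borel))"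
          by measurable
        ultimately have "{f \<in> space (PiM {..k} (\<lambda>_. borel)). h < cmod (f k - f 0)}
          \<inter> {f \<in> space (PiM {..k} (\<lambda>_. borel)). \<forall>i\<in>{..<k}. cmod (f i - f 0) \<le> h} \<in> sets (PiM {..k} (\<lambda>_. borel))"
          by blast
        then show "?A \<in> sets (PiM {..k} (\<lambda>_. borel))"
          by (rule back_subst[of "\<lambda>x. x \<in> _"]) auto
        have [measurable]: "(\<lambda>f. f (N - k)) \<in> borel_measurable (PiM {..N - k} (\<lambda>_. borel))"
          by (rule measurable_component_singleton) auto
        show "?C \<in> sets (PiM {..N - k} (\<lambda>_. borel))" by measurable
      qed
      moreover have "{\<omega>\<in>space M. (\<lambda>i\<in>{..k}. B (\<tau> i) \<omega>) \<in> ?A} = E k"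
        unfolding E_def Y_def by (auto simp: space_PiM)
      moreover have "{\<omega>\<in>space M. (\<lambda>j\<in>{..N - k}. B (\<tau> (k + j)) \<omega> - B (\<tau> k) \<omega>) \<in> ?C} = F k"
        unfolding F_def using k by (auto simp: space_PiM)
      moreover have "{\<omega>\<in>space M. (\<lambda>i\<in>{..k}. B (\<tau> i) \<omega>) \<in> ?A \<and> (\<lambda>j\<in>{..N - k}. B (\<tau> (k + j)) \<omega> - B (\<tau> k) \<omega>) \<in> ?C} = E k \<inter> F k"
        using calculation(2,3) by blast
      ultimately have *: "prob (E k \<inter> F k) = prob (E k) * prob (F k)" by simp
      have "F k = space M - {\<omega>\<in>space M. h / 2 < cmod (B (\<tau> N) \<omega> - B (\<tau> k) \<omega>)}"
        unfolding F_def by auto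
      then have "prob (F k) = 1 - prob {\<omega>\<in>space M. h / 2 < cmod (B (\<tau> N) \<omega> - B (\<tau> k) \<omega>)}"
        by (simp add: prob_compl)
      with tail[OF k order_refl] True have "1 / 2 \<le> prob (F k)" by simp
      then have "prob (E k) * (1 / 2) \<le> prob (E k) * prob (F k)"
        by (rule mult_left_mono) simp
      with * show ?thesis by simp
    qed
    have "{\<omega>\<in>space M. \<exists>j\<le>N. h < cmod (Y j \<omega>)} \<subseteq> (\<Union>k\<le>N. E k)"
    proof safe
      fix \<omega> j assume \<omega>: "\<omega> \<in> space M" and j: "j \<le> N" "h < cmod (Y j \<omega>)"
      define k where "k = (LEAST k. h < cmod (Y k \<omega>))"
      have "h < cmod (Y k \<omega>)" unfolding k_def by (rule LeastI[of _ j]) (rule j)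
      moreover have "k \<le> j" unfolding k_def by (rule Least_le) (rule j)
      moreover have "\<forall>i<k. cmod (Y i \<omega>) \<le> h"
        unfolding k_def using not_less_Least by (metis linorder_not_le)
      ultimately show "\<omega> \<in> (\<Union>k\<le>N. E k)"
        using \<omega> j unfolding E_def by (intro UN_I[of k]) auto
    qed
    then have "prob {\<omega>\<in>space M. \<exists>j\<le>N. h < cmod (Y j \<omega>)} \<le> prob (\<Union>k\<le>N. E k)"
      by (rule finite_measure_mono) measurable
    also have "\<dots> = (\<Sum>k\<le>N. prob (E k))"
      by (rule finite_measure_finite_Union) (auto simp: disj)
    also have "\<dots> \<le> (\<Sum>k\<le>N. 2 * prob (E k \<inter> F k))"
      by (rule sum_mono) (use half in auto)
    also have "\<dots> = 2 * prob (\<Union>k\<le>N. E k \<inter> F k)"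
      unfolding sum_distrib_left[symmetric]
      by (subst finite_measure_finite_Union) (auto simp: disj)
    also have "prob (\<Union>k\<le>N. E k \<inter> F k) \<le> prob {\<omega>\<in>space M. h / 2 < cmod (B (\<tau> N) \<omega> - B (\<tau> 0) \<omega>)}"
    proof (rule finite_measure_mono)
      show "(\<Union>k\<le>N. E k \<inter> F k) \<subseteq> {\<omega>\<in>space M. h / 2 < cmod (B (\<tau> N) \<omega> - B (\<tau> 0) \<omega>)}"
      proof safe
        fix \<omega> k assume "\<omega> \<in> E k" "\<omega> \<in> F k"
        then have "h < cmod (Y k \<omega>)" "cmod (B (\<tau> N) \<omega> - B (\<tau> k) \<omega>) \<le> h / 2"
          by (auto simp: E_def F_def)
        moreover have "cmod (Y k \<omega>) \<le> cmod (B (\<tau> N) \<omega> - B (\<tau> 0) \<omega>) + cmod (B (\<tau> N) \<omega> - B (\<tau> k) \<omega>)"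
          using norm_triangle_ineq4[of "B (\<tau> N) \<omega> - B (\<tau> 0) \<omega>" "B (\<tau> N) \<omega> - B (\<tau> k) \<omega>"]
          by (simp add: Y_def)
        ultimately show "h / 2 < cmod (B (\<tau> N) \<omega> - B (\<tau> 0) \<omega>)" by linarith
      qed (auto simp: E_def)
    qed measurable
    also have "\<dots> \<le> 2 * e" by (rule tail) auto
    finally show ?thesis unfolding Y_def e_def by simp
  qed
qed

section \<open>Lattice models as families of independent path events\<close>

lemma (in prob_space) prob_INT_decseq_ge:
  assumes "\<And>i::nat. A i \<in> events" "decseq A" "\<And>i. c \<le> prob (A i)"
  shows "c \<le> prob (\<Inter>i. A i)"
proof -
  have "(\<lambda>i. prob (A i)) \<longlonglongrightarrow> prob (\<Inter>i. A i)"
    by (rule finite_Lim_measure_decseq) (use assms in auto)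
  then show ?thesis by (rule LIMSEQ_le_const) (use assms in auto)
qed

text \<open>Enumerating the index type turns the intersection into the limit of a decreasing
  sequence of finite ones.\<close>

lemma (in prob_space) prob_INT_countable_ge:
  fixes A :: "'i::countable \<Rightarrow> 'a set"
  assumes A: "\<And>i. A i \<in> events" and c: "\<And>F. finite F \<Longrightarrow> c \<le> prob {\<omega>\<in>space M. \<forall>i\<in>F. \<omega> \<in> A i}"
  shows "c \<le> prob {\<omega>\<in>space M. \<forall>i. \<omega> \<in> A i}"
proof -
  define E where "E n = {\<omega>\<in>space M. \<forall>i\<in>{i. to_nat i \<le> n}. \<omega> \<in> A i}" for n
  have fin: "finite {i::'i. to_nat i \<le> n}" for n
    using finite_vimageI[of "{..n}" "to_nat :: 'i \<Rightarrow> nat"] by (simp add: vimage_def)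
  have "c \<le> prob (\<Inter>n. E n)"
  proof (rule prob_INT_decseq_ge)
    show "E n \<in> events" for n
      unfolding E_def by (rule sets.sets_Collect_finite_All) (use A fin in auto)
    show "decseq E" by (auto simp: decseq_def E_def)
    show "c \<le> prob (E n)" for n unfolding E_def by (rule c) (rule fin)
  qed
  also have "(\<Inter>n. E n) = {\<omega>\<in>space M. \<forall>i. \<omega> \<in> A i}"
    unfolding E_def by auto
  finally show ?thesis .
qed

text \<open>Times range over an uncountable set, so the event has to be rewritten through countably
  many coordinates. On a compact time interval a continuous path stays in the open set
  \<open>G\<close> exactly if it keeps a positive distance from the complement, and for a fixed
  distance this is a closed condition that can be tested on a countable dense set of times.
  \<open>A\<close> has this meaning on continuous paths only.\<close>

lemma path_event_open:
  fixes G :: "'a::heine_borel set"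
  assumes G: "open G"
  obtains A where "A \<in> sets path_space"
    "\<And>f. continuous_on {0..} f \<Longrightarrow> restrict f {0..} \<in> A \<longleftrightarrow> (\<forall>t\<in>{0..T}. f t \<in> G)"
proof -
  obtain D where D: "countable D" "D \<subseteq> {0..T}" "{0..T} \<subseteq> closure D"
    using separable[of "{0..T}"] by blast
  define F where "F n = {x. \<forall>y\<in>-G. 1 / real (Suc n) \<le> dist x y}" for n
  have closedF: "closed (F n)" for n
  proof -
    have "F n = (\<Inter>y\<in>-G. {x. 1 / real (Suc n) \<le> dist x y})" unfolding F_def by auto
    also have "closed \<dots>" by (intro closed_INT ballI closed_Collect_le continuous_intros)
    finally show ?thesis .
  qed
  define A where "A = (\<Union>n. {f\<in>space path_space. \<forall>t\<in>D. f t \<in> F n})"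
  show thesis
  proof
    have "{f\<in>space path_space. \<forall>t\<in>D. f t \<in> F n} \<in> sets path_space" for n
    proof (rule sets.sets_Collect_countable_All'[OF _ D(1)])
      fix t assume "t \<in> D"
      then have "0 \<le> t" using D by auto
      then have [measurable]: "(\<lambda>f. f t) \<in> borel_measurable (path_space :: (real \<Rightarrow> 'a) measure)"
        by (rule measurable_path_eval)
      have "F n \<in> sets borel" using closedF by (rule borel_closed)
      then show "{f\<in>space path_space. f t \<in> F n} \<in> sets path_space" by measurable
    qed
    then show "A \<in> sets path_space" unfolding A_def by auto
    fix f :: "real \<Rightarrow> 'a" assume f: "continuous_on {0..} f"
    have fT: "continuous_on {0..T} f" by (rule continuous_on_subset[OF f]) auto
    have "restrict f {0..} \<in> A \<longleftrightarrow> (\<exists>n. \<forall>t\<in>D. f t \<in> F n)"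
      using D(2) unfolding A_def by (auto simp: space_path_space subset_eq)
    also have "\<dots> \<longleftrightarrow> (\<forall>t\<in>{0..T}. f t \<in> G)"
    proof
      assume "\<exists>n. \<forall>t\<in>D. f t \<in> F n"
      then obtain n where n: "\<forall>t\<in>D. f t \<in> F n" by blast
      have cl: "closure D = {0..T}"
        using D closure_minimal[OF D(2)] by auto
      have "f ` closure D \<subseteq> F n"
        by (rule image_closure_subset) (use n closedF fT cl in auto)
      moreover have "F n \<subseteq> G"
      proof
        fix x assume "x \<in> F n"
        then have "x \<notin> G \<Longrightarrow> 1 / real (Suc n) \<le> dist x x" unfolding F_def by blast
        then show "x \<in> G" by auto
      qed
      ultimately show "\<forall>t\<in>{0..T}. f t \<in> G" using cl by auto
    next
      assume *: "\<forall>t\<in>{0..T}. f t \<in> G"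
      have "compact (f ` {0..T})" by (rule compact_continuous_image[OF fT]) simp
      then obtain d where d: "0 < d" "\<And>x y. x \<in> f ` {0..T} \<Longrightarrow> y \<in> - G \<Longrightarrow> d \<le> dist x y"
      proof -
        have "f ` {0..T} \<inter> - G = {}" using * by blast
        from separate_compact_closed[OF \<open>compact _\<close> _ this] G that show ?thesis
          unfolding Ball_def closed_Compl by blast
      qed
      obtain n where "1 / real (Suc n) < d" using d(1) nat_approx_posE by blast
      have "\<forall>t\<in>D. f t \<in> F n"
      proof
        fix t assume "t \<in> D"
        then have "f t \<in> f ` {0..T}" using D(2) by blast
        then show "f t \<in> F n"
          using d(2)[of "f t"] \<open>1 / real (Suc n) < d\<close> unfolding F_def by fastforce
      qed
      then show "\<exists>n. \<forall>t\<in>D. f t \<in> F n" ..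
    qed
    finally show "restrict f {0..} \<in> A \<longleftrightarrow> (\<forall>t\<in>{0..T}. f t \<in> G)" .
  qed
qed

section \<open>Transfer of path events from Ornstein-Uhlenbeck processes to Brownian motion\<close>

lemma ou_measurable: "complex_ou_process M Z \<Longrightarrow> 0 \<le> t \<Longrightarrow> Z t \<in> borel_measurable M"
  by (simp add: complex_ou_process_def)

lemma ou_continuous: "complex_ou_process M Z \<Longrightarrow> \<omega> \<in> space M \<Longrightarrow> continuous_on {0..} (\<lambda>t. Z t \<omega>)"
  by (simp add: complex_ou_process_def continuous_paths_def)

text \<open>Equality of laws on the product sigma-algebra says nothing directly about uncountably
  many times; for open \<open>G\<close> the staying event is a path event by
  \<open>path_event_open\<close>. Measurability is exported too, for comparing events on the
  Brownian side.\<close>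

lemma ou_transfer:
  assumes "complex_ou_process M Z"
  obtains N :: "(real \<Rightarrow> complex) measure" and B where "complex_brownian_motion N B"
    "\<And>G T. open G \<Longrightarrow> measure M {\<omega>\<in>space M. \<forall>t\<in>{0..T}. Z t \<omega> \<in> G}
       = measure N {\<omega>\<in>space N. \<forall>t\<in>{0..T}. of_real (exp (- t / 2)) * B (exp t) \<omega> \<in> G}"
    "\<And>G T. open G \<Longrightarrow>
      {\<omega>\<in>space N. \<forall>t\<in>{0..T}. of_real (exp (- t / 2)) * B (exp t) \<omega> \<in> G} \<in> sets N"
proof -
  define Y where "Y B t \<omega> = of_real (exp (- t / 2)) * B (exp t) \<omega>"
    for B :: "real \<Rightarrow> (real \<Rightarrow> complex) \<Rightarrow> complex" and t \<omega>
  obtain N :: "(real \<Rightarrow> complex) measure" and B where B: "complex_brownian_motion N B"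
    and law: "distr M path_space (path_of Z) = distr N path_space (path_of (Y B))"
    using assms unfolding complex_ou_process_def Y_def by blast
  have mZ: "path_of Z \<in> measurable M path_space"
    by (rule measurable_path_of) (rule ou_measurable[OF assms])
  have mY: "path_of (Y B) \<in> measurable N path_space"
  proof (rule measurable_path_of)
    fix t :: real
    have [measurable]: "B (exp t) \<in> borel_measurable N" by (rule cbm_measurable[OF B]) simp
    show "Y B t \<in> borel_measurable N" unfolding Y_def by measurable
  qed
  have cY: "continuous_on {0..} (\<lambda>t. Y B t \<omega>)" if "\<omega> \<in> space N" for \<omega>
    unfolding Y_def
    by (intro continuous_intros continuous_on_compose2[OF cbm_continuous[OF B that], of _ exp]) auto
  show thesis
  proof
    show "complex_brownian_motion N B" by (rule B)
    fix G :: "complex set" and T :: real assume "open G"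
    from path_event_open[OF this, of T] obtain A where A: "A \<in> sets path_space"
      "\<And>f. continuous_on {0..} f \<Longrightarrow> restrict f {0..} \<in> A \<longleftrightarrow> (\<forall>t\<in>{0..T}. f t \<in> G)" by blast
    have "{\<omega>\<in>space M. \<forall>t\<in>{0..T}. Z t \<omega> \<in> G} = path_of Z -` A \<inter> space M"
      using A(2)[OF ou_continuous[OF assms]] by (auto simp: path_of_def)
    moreover have "{\<omega>\<in>space N. \<forall>t\<in>{0..T}. Y B t \<omega> \<in> G} = path_of (Y B) -` A \<inter> space N"
      using A(2)[OF cY] by (auto simp: path_of_def)
    moreover have "measure M (path_of Z -` A \<inter> space M) = measure N (path_of (Y B) -` A \<inter> space N)"
      using arg_cong[OF law, of "\<lambda>m. measure m A"] A(1) mZ mY by (simp add: measure_distr)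
    ultimately show "measure M {\<omega>\<in>space M. \<forall>t\<in>{0..T}. Z t \<omega> \<in> G}
       = measure N {\<omega>\<in>space N. \<forall>t\<in>{0..T}. of_real (exp (- t / 2)) * B (exp t) \<omega> \<in> G}"
      unfolding Y_def by simp
    have "path_of (Y B) -` A \<inter> space N \<in> sets N" by (rule measurable_sets[OF mY A(1)])
    then show "{\<omega>\<in>space N. \<forall>t\<in>{0..T}. of_real (exp (- t / 2)) * B (exp t) \<omega> \<in> G} \<in> sets N"
      using \<open>{\<omega>\<in>space N. \<forall>t\<in>{0..T}. Y B t \<omega> \<in> G} = _\<close> unfolding Y_def by simp
  qed
qed

text \<open>Independence is that of whole paths, so each staying event is first expressed by a set
  of the path space.\<close>

lemma iid_ou_family_prob:
  assumes iid: "iid_ou_family M \<zeta>" and G: "\<And>p. open (G p)" and F: "finite F"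
  shows "measure M {\<omega>\<in>space M. \<forall>p\<in>F. \<forall>t\<in>{0..T}. \<zeta> p t \<omega> \<in> G p}
       = (\<Prod>p\<in>F. measure M {\<omega>\<in>space M. \<forall>t\<in>{0..T}. \<zeta> p t \<omega> \<in> G p})"
    and "{\<omega>\<in>space M. \<forall>t\<in>{0..T}. \<zeta> p t \<omega> \<in> G p} \<in> sets M"
proof -
  interpret prob_space M using iid by (simp add: iid_ou_family_def)
  have ou: "complex_ou_process M (\<zeta> p)" for p
    using iid unfolding iid_ou_family_def by blast
  have ind: "indep_vars (\<lambda>_. path_space) (\<lambda>p. path_of (\<zeta> p)) UNIV"
    using iid by (simp add: iid_ou_family_def independent_processes_def)
  have "\<forall>p. \<exists>A. A \<in> sets path_space \<and>
      (\<forall>f. continuous_on {0..} f \<longrightarrow> restrict f {0..} \<in> A \<longleftrightarrow> (\<forall>t\<in>{0..T}. f t \<in> G p))"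
    by (rule allI, rule path_event_open[OF G]) blast
  from choice[OF this] obtain A where A: "\<And>p. A p \<in> sets path_space"
    "\<And>p f. continuous_on {0..} f \<Longrightarrow> restrict f {0..} \<in> A p \<longleftrightarrow> (\<forall>t\<in>{0..T}. f t \<in> G p)"
    by blast
  have eq: "path_of (\<zeta> p) \<omega> \<in> A p \<longleftrightarrow> (\<forall>t\<in>{0..T}. \<zeta> p t \<omega> \<in> G p)" if "\<omega> \<in> space M" for p \<omega>
    using A(2)[OF ou_continuous[OF ou that]] by (simp add: path_of_def)
  have "{\<omega>\<in>space M. \<forall>t\<in>{0..T}. \<zeta> p t \<omega> \<in> G p} = {\<omega>\<in>space M. path_of (\<zeta> p) \<omega> \<in> A p}" for p
    using eq by blast
  moreover have "{\<omega>\<in>space M. \<forall>p\<in>F. \<forall>t\<in>{0..T}. \<zeta> p t \<omega> \<in> G p} = {\<omega>\<in>space M. \<forall>p\<in>F. path_of (\<zeta> p) \<omega> \<in> A p}"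
    using eq by blast
  ultimately show "measure M {\<omega>\<in>space M. \<forall>p\<in>F. \<forall>t\<in>{0..T}. \<zeta> p t \<omega> \<in> G p}
       = (\<Prod>p\<in>F. measure M {\<omega>\<in>space M. \<forall>t\<in>{0..T}. \<zeta> p t \<omega> \<in> G p})"
    using prob_indep_vars_ball[OF ind F _ A(1)] by simp
  have "path_of (\<zeta> p) \<in> measurable M path_space"
    using ind unfolding indep_vars_def by blast
  then have "path_of (\<zeta> p) -` A p \<inter> space M \<in> sets M"
    by (rule measurable_sets) (rule A)
  moreover have "path_of (\<zeta> p) -` A p \<inter> space M = {\<omega>\<in>space M. \<forall>t\<in>{0..T}. \<zeta> p t \<omega> \<in> G p}"
    using eq by blast
  ultimately show "{\<omega>\<in>space M. \<forall>t\<in>{0..T}. \<zeta> p t \<omega> \<in> G p} \<in> sets M" by simp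
qed

section \<open>A common form of the two lattice models\<close>

definition site :: "real \<Rightarrow> int \<times> int \<Rightarrow> complex" where
  "site s p = of_real s * (of_int (fst p) + \<i> * of_int (snd p))"

text \<open>Spacing \<open>s\<close> and, at each site, one process seen through the rotations in
  \<open>U\<close>. Taking for \<open>U\<close> the number 1 alone or the three cube roots of unity
  gives the two models; what matters later is that the elements of \<open>U\<close> have modulus
  1.\<close>

definition cluster_lattice ::
    "real \<Rightarrow> complex set \<Rightarrow> real \<Rightarrow> (int \<times> int \<Rightarrow> real \<Rightarrow> 'w \<Rightarrow> complex) \<Rightarrow> real \<Rightarrow> 'w \<Rightarrow> complex set" where
  "cluster_lattice s U c \<zeta> t \<omega> = {site s p + of_real c * u * \<zeta> p t \<omega> | p u. u \<in> U}"

lemma perturbed_lattice_eq: "perturbed_lattice c = cluster_lattice (sqrt pi) {1} c"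
  by (intro ext) (auto simp: perturbed_lattice_def cluster_lattice_def site_def)

lemma triangular_cluster_eq:
  "triangular_cluster c
     = cluster_lattice (sqrt (3 * pi)) ((\<lambda>m::nat. exp (2 * of_real pi * \<i> * of_nat m / 3)) ` {0, 1, 2}) c"
proof (intro ext set_eqI iffI)
  fix \<zeta> :: "int \<times> int \<Rightarrow> real \<Rightarrow> 'a \<Rightarrow> complex" and t \<omega> x
  {
    assume "x \<in> triangular_cluster c \<zeta> t \<omega>"
    then obtain k l and m :: nat where m: "m \<in> {0, 1, 2}"
      "x = of_real (sqrt (3 * pi)) * (of_int k + \<i> * of_int l)
        + of_real c * exp (2 * of_real pi * \<i> * of_nat m / 3) * \<zeta> (k, l) t \<omega>"
      unfolding triangular_cluster_def by blast
    then have "x = site (sqrt (3 * pi)) (k, l)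
        + of_real c * exp (2 * of_real pi * \<i> * of_nat m / 3) * \<zeta> (k, l) t \<omega>"
      by (simp add: site_def)
    with m(1) show "x \<in> cluster_lattice (sqrt (3 * pi)) ((\<lambda>m::nat. exp (2 * of_real pi * \<i> * of_nat m / 3)) ` {0, 1, 2}) c \<zeta> t \<omega>"
      unfolding cluster_lattice_def by blast
  next
    assume "x \<in> cluster_lattice (sqrt (3 * pi)) ((\<lambda>m::nat. exp (2 * of_real pi * \<i> * of_nat m / 3)) ` {0, 1, 2}) c \<zeta> t \<omega>"
    then obtain p u where u: "u \<in> (\<lambda>m::nat. exp (2 * of_real pi * \<i> * of_nat m / 3)) ` {0, 1, 2}"
      and x: "x = site (sqrt (3 * pi)) p + of_real c * u * \<zeta> p t \<omega>"
      unfolding cluster_lattice_def by blast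
    from u obtain m :: nat where m: "m \<in> {0, 1, 2}" "u = exp (2 * of_real pi * \<i> * of_nat m / 3)"
      by blast
    obtain k l where "p = (k, l)" by (cases p)
    with x m(2) have "x = site (sqrt (3 * pi)) (k, l)
        + of_real c * exp (2 * of_real pi * \<i> * of_nat m / 3) * \<zeta> (k, l) t \<omega>"
      by simp
    then have "x = of_real (sqrt (3 * pi)) * (of_int k + \<i> * of_int l)
        + of_real c * exp (2 * of_real pi * \<i> * of_nat m / 3) * \<zeta> (k, l) t \<omega>"
      by (simp add: site_def)
    with m(1) show "x \<in> triangular_cluster c \<zeta> t \<omega>"
      unfolding triangular_cluster_def by blast
  }
qed

text \<open>All points of a cluster are driven by the same process and are dependent. Their
  conditions are therefore gathered into one set per site, and independence is used between sites
  only. The strict inequality makes the set open.\<close>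

definition avoid :: "real \<Rightarrow> complex set \<Rightarrow> real \<Rightarrow> real \<Rightarrow> int \<times> int \<Rightarrow> complex set" where
  "avoid s U c R p = {z. \<forall>u\<in>U. R < cmod (site s p + of_real c * u * z)}"

lemma open_avoid:
  assumes "finite U"
  shows "open (avoid s U c R p)"
proof -
  have "avoid s U c R p = (\<Inter>u\<in>U. {z. R < cmod (site s p + of_real c * u * z)})"
    by (auto simp: avoid_def)
  also have "open \<dots>"
    by (intro open_INT assms ballI open_Collect_less continuous_intros)
  finally show ?thesis .
qed

lemma hole_event_cluster_lattice:
  "hole_event M (cluster_lattice s U c \<zeta>) T R
     = {\<omega>\<in>space M. \<forall>p. \<forall>t\<in>{0..T}. \<zeta> p t \<omega> \<in> avoid s U c R p}"
proof -
  have "cluster_lattice s U c \<zeta> t \<omega> \<inter> cball 0 R = {} \<longleftrightarrow> (\<forall>p. \<zeta> p t \<omega> \<in> avoid s U c R p)" for t \<omega>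
    unfolding cluster_lattice_def avoid_def disjoint_iff mem_cball_0 mem_Collect_eq
    by (auto simp del: split_paired_All split_paired_Ex simp: not_le)
  then show ?thesis unfolding hole_event_def by blast
qed

text \<open>Forgetting all sites outside \<open>F\<close> only enlarges the event.\<close>

lemma cluster_lattice_hole_le:
  assumes iid: "iid_ou_family M \<zeta>" and U: "finite U" and F: "finite F"
  shows "measure M (hole_event M (cluster_lattice s U c \<zeta>) T R)
     \<le> (\<Prod>p\<in>F. measure M {\<omega>\<in>space M. \<forall>t\<in>{0..T}. \<zeta> p t \<omega> \<in> avoid s U c R p})"
proof -
  interpret prob_space M using iid by (simp add: iid_ou_family_def)
  note G = open_avoid[OF U, of s c R]
  have "measure M (hole_event M (cluster_lattice s U c \<zeta>) T R)
      \<le> measure M {\<omega>\<in>space M. \<forall>p\<in>F. \<forall>t\<in>{0..T}. \<zeta> p t \<omega> \<in> avoid s U c R p}"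
  proof (rule finite_measure_mono)
    show "{\<omega>\<in>space M. \<forall>p\<in>F. \<forall>t\<in>{0..T}. \<zeta> p t \<omega> \<in> avoid s U c R p} \<in> events"
      by (rule sets.sets_Collect_finite_All[OF _ F]) (rule iid_ou_family_prob(2)[OF iid G F])
  qed (auto simp: hole_event_cluster_lattice)
  with iid_ou_family_prob(1)[OF iid G F] show ?thesis by simp
qed

text \<open>The bound \<open>b\<close> must not depend on \<open>F\<close>: the hole event is the
  decreasing limit of the events for finite sets of sites.\<close>

lemma cluster_lattice_hole_ge:
  assumes iid: "iid_ou_family M \<zeta>" and U: "finite U"
    and b: "\<And>F. finite F \<Longrightarrow> b \<le> (\<Prod>p\<in>F. measure M {\<omega>\<in>space M. \<forall>t\<in>{0..T}. \<zeta> p t \<omega> \<in> avoid s U c R p})"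
  shows "b \<le> measure M (hole_event M (cluster_lattice s U c \<zeta>) T R)"
proof -
  interpret prob_space M using iid by (simp add: iid_ou_family_def)
  note G = open_avoid[OF U, of s c R]
  have "b \<le> prob {\<omega>\<in>space M. \<forall>p. \<omega> \<in> {\<omega>\<in>space M. \<forall>t\<in>{0..T}. \<zeta> p t \<omega> \<in> avoid s U c R p}}"
  proof (rule prob_INT_countable_ge)
    fix F :: "(int \<times> int) set" assume F: "finite F"
    show "b \<le> prob {\<omega>\<in>space M. \<forall>p\<in>F. \<omega> \<in> {\<omega>\<in>space M. \<forall>t\<in>{0..T}. \<zeta> p t \<omega> \<in> avoid s U c R p}}"
      using b[OF F] iid_ou_family_prob(1)[OF iid G F, of T] by (simp cong: conj_cong)
  qed (rule iid_ou_family_prob(2)[OF iid G finite.emptyI])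
  also have "{\<omega>\<in>space M. \<forall>p. \<omega> \<in> {\<omega>\<in>space M. \<forall>t\<in>{0..T}. \<zeta> p t \<omega> \<in> avoid s U c R p}}
      = hole_event M (cluster_lattice s U c \<zeta>) T R"
    by (auto simp: hole_event_cluster_lattice)
  finally show ?thesis .
qed

section \<open>Avoiding a disc: exponential decay\<close>

lemma (in prob_space) nn_integral_indep_var:
  assumes ind: "indep_var S X T Y" and f: "case_prod f \<in> borel_measurable (S \<Otimes>\<^sub>M T)"
  shows "(\<integral>\<^sup>+\<omega>. f (X \<omega>) (Y \<omega>) \<partial>M) = (\<integral>\<^sup>+\<omega>. \<integral>\<^sup>+\<omega>'. f (X \<omega>) (Y \<omega>') \<partial>M \<partial>M)"
proof -
  have X: "X \<in> measurable M S" and Y: "Y \<in> measurable M T"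
    using indep_var_rv1[OF ind] indep_var_rv2[OF ind] by auto
  interpret Y: prob_space "distr M T Y" by (rule prob_space_distr[OF Y])
  have f': "case_prod f \<in> borel_measurable (distr M S X \<Otimes>\<^sub>M distr M T Y)"
    using f by simp
  have "(\<integral>\<^sup>+\<omega>. f (X \<omega>) (Y \<omega>) \<partial>M)
      = (\<integral>\<^sup>+p. case_prod f p \<partial>distr M (S \<Otimes>\<^sub>M T) (\<lambda>\<omega>. (X \<omega>, Y \<omega>)))"
    using X Y f by (subst nn_integral_distr) auto
  also have "\<dots> = (\<integral>\<^sup>+p. case_prod f p \<partial>(distr M S X \<Otimes>\<^sub>M distr M T Y))"
    using ind unfolding indep_var_distribution_eq by simp
  also have "\<dots> = (\<integral>\<^sup>+x. \<integral>\<^sup>+y. f x y \<partial>distr M T Y \<partial>distr M S X)"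
    by (subst Y.nn_integral_fst[symmetric, OF f']) simp
  also have "\<dots> = (\<integral>\<^sup>+\<omega>. \<integral>\<^sup>+y. f (X \<omega>) y \<partial>distr M T Y \<partial>M)"
    using Y.borel_measurable_nn_integral[OF f'] by (intro nn_integral_distr[OF X]) simp
  also have "\<dots> = (\<integral>\<^sup>+\<omega>. \<integral>\<^sup>+\<omega>'. f (X \<omega>) (Y \<omega>') \<partial>M \<partial>M)"
  proof (rule nn_integral_cong)
    fix \<omega> assume "\<omega> \<in> space M"
    then have "f (X \<omega>) \<in> borel_measurable T"
      using measurable_compose[OF measurable_Pair1'[of "X \<omega>" S T] f] measurable_space[OF X] by simp
    then show "(\<integral>\<^sup>+y. f (X \<omega>) y \<partial>distr M T Y) = (\<integral>\<^sup>+\<omega>'. f (X \<omega>) (Y \<omega>') \<partial>M)"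
      by (intro nn_integral_distr[OF Y]) simp
  qed
  finally show ?thesis .
qed

text \<open>The normalised positions at the times 2^i form a Markov chain that moves from z to (z +
  Y) / sqrt 2 with Y of law \<open>cgauss 1\<close>. The hypothesis \<open>step\<close> says that
  \<open>W\<close> contracts by \<open>\<theta>\<close> on average for the chain killed on entering
  the disc. Iterating it and using that \<open>W\<close> is at least 1 bounds the survival
  probability.\<close>

lemma cbm_lyapunov:
  fixes W :: "complex \<Rightarrow> ennreal"
  assumes cbm: "complex_brownian_motion M B"
    and W [measurable]: "W \<in> borel_measurable borel" and W1: "\<And>z. 1 \<le> W z"
    and step: "\<And>z. r < cmod z \<Longrightarrow>
      (\<integral>\<^sup>+x. W ((z + x) / of_real (sqrt 2)) * indicator {y. r < cmod y} ((z + x) / of_real (sqrt 2)) \<partial>cgauss 1) \<le> \<theta> * W z"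
    and init: "(\<integral>\<^sup>+x. W x \<partial>cgauss 1) \<le> C"
  shows "emeasure M {\<omega>\<in>space M. \<forall>i\<le>n. r < cmod (B (2 ^ i) \<omega> / of_real (sqrt (2 ^ i)))} \<le> \<theta> ^ n * C"
proof -
  interpret prob_space M using cbm by (rule cbm_prob_space)
  define \<tau> where "\<tau> i = (2::real) ^ i" for i :: nat
  have \<tau>: "mono \<tau>" "0 \<le> \<tau> 0" unfolding \<tau>_def by (auto simp: mono_def power_increasing)
  have B [measurable]: "B (\<tau> i) \<in> borel_measurable M" for i
    by (rule cbm_measurable[OF cbm]) (simp add: \<tau>_def)
  define \<zeta> where "\<zeta> i \<omega> = B (\<tau> i) \<omega> / of_real (sqrt (\<tau> i))" for i \<omega>
  have [measurable]: "\<zeta> i \<in> borel_measurable M" for i unfolding \<zeta>_def by measurable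
  define E where "E n = {\<omega>\<in>space M. \<forall>i\<le>n. r < cmod (\<zeta> i \<omega>)}" for n
  have [measurable]: "E n \<in> events" for n unfolding E_def by measurable
  define k where "k y = W (y / of_real (sqrt 2)) * indicator {y. r < cmod y} (y / of_real (sqrt 2))" for y :: complex
  have [measurable]: "k \<in> borel_measurable borel" unfolding k_def by measurable
  have claim: "(\<integral>\<^sup>+\<omega>. indicator (E n) \<omega> * W (\<zeta> n \<omega>) \<partial>M) \<le> \<theta> ^ n * C" for n
  proof (induction n)
    case 0
    have "(\<integral>\<^sup>+\<omega>. indicator (E 0) \<omega> * W (\<zeta> 0 \<omega>) \<partial>M) \<le> (\<integral>\<^sup>+\<omega>. W (B 1 \<omega>) \<partial>M)"
      by (rule nn_integral_mono) (auto simp: indicator_def \<zeta>_def \<tau>_def)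
    also have "\<dots> = (\<integral>\<^sup>+x. W x \<partial>distr M borel (B 1))"
      by (rule nn_integral_distr[symmetric]) (use B[of 0] in \<open>auto simp: \<tau>_def\<close>)
    also have "\<dots> \<le> C" using init by (simp add: cbm_law[OF cbm])
    finally show ?case by simp
  next
    case (Suc n)
    define X where "X \<omega> = (\<lambda>i\<in>{..n}. B (\<tau> i) \<omega>)" for \<omega>
    \<comment> \<open>The increment over [2^n, 2^(n+1)] divided by the square root of the interval's
      length 2^n, hence of law \<open>cgauss 1\<close>.\<close>
    define Y where "Y \<omega> = (B (\<tau> (Suc n)) \<omega> - B (\<tau> n) \<omega>) / of_real (sqrt (\<tau> n))" for \<omega>
    let ?S = "PiM {..n} (\<lambda>_. borel :: complex measure)"
    define e where "e f = (indicator {f\<in>space ?S. \<forall>i\<in>{..n}. r < cmod (f i / of_real (sqrt (\<tau> i)))} f :: ennreal)" for f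
    define z where "z f = f n / of_real (sqrt (\<tau> n))" for f :: "nat \<Rightarrow> complex"
    have comp: "(\<lambda>f. f i) \<in> borel_measurable ?S" if "i \<le> n" for i
      by (rule measurable_component_singleton) (use that in auto)
    have [measurable]: "e \<in> borel_measurable ?S" "z \<in> borel_measurable ?S"
    proof -
      have [measurable]: "(\<lambda>f. f n) \<in> borel_measurable ?S" by (rule comp) simp
      show "z \<in> borel_measurable ?S" unfolding z_def by measurable
      have "{f\<in>space ?S. \<forall>i\<in>{..n}. r < cmod (f i / of_real (sqrt (\<tau> i)))} \<in> sets ?S"
      proof (rule sets.sets_Collect_finite_All)
        fix i assume "i \<in> {..n}"
        then have [measurable]: "(\<lambda>f. f i) \<in> borel_measurable ?S" by (intro comp) simp
        show "{f\<in>space ?S. r < cmod (f i / of_real (sqrt (\<tau> i)))} \<in> sets ?S" by measurable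
      qed simp
      then show "e \<in> borel_measurable ?S" unfolding e_def by measurable
    qed
    let ?T = "PiM {..1::nat} (\<lambda>_. borel :: complex measure)"
    define V where "V \<omega> = (\<lambda>j\<in>{..1::nat}. B (\<tau> (n + j)) \<omega> - B (\<tau> n) \<omega>)" for \<omega>
    have [measurable]: "(\<lambda>f. f 1) \<in> borel_measurable ?T"
      by (rule measurable_component_singleton) auto
    have ind: "indep_var ?S X ?T V"
      unfolding X_def V_def by (rule cbm_past_future[OF cbm \<tau>])
    have VY: "V \<omega> 1 / of_real (sqrt (\<tau> n)) = Y \<omega>" for \<omega>
      by (simp add: V_def Y_def)
    have [measurable]: "Y \<in> borel_measurable M" unfolding Y_def by measurable
    have Ylaw: "distr M borel Y = cgauss 1"
    proof -
      have "distr M borel Y = distr (distr M borel (\<lambda>\<omega>. B (\<tau> (Suc n)) \<omega> - B (\<tau> n) \<omega>)) borel (\<lambda>x. of_real (1 / sqrt (\<tau> n)) * x)"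
        by (subst distr_distr) (auto simp: Y_def comp_def intro!: distr_cong)
      also have "\<dots> = cgauss ((1 / sqrt (\<tau> n))\<^sup>2 * (\<tau> (Suc n) - \<tau> n))"
      proof -
        have "distr M borel (\<lambda>\<omega>. B (\<tau> (Suc n)) \<omega> - B (\<tau> n) \<omega>) = cgauss (\<tau> (Suc n) - \<tau> n)"
          by (rule cbm_increment[OF cbm]) (simp_all add: \<tau>_def)
        then show ?thesis by (simp only:) (rule cgauss_scale; simp add: \<tau>_def)
      qed
      also have "(1 / sqrt (\<tau> n))\<^sup>2 * (\<tau> (Suc n) - \<tau> n) = 1"
        by (simp add: \<tau>_def power_divide)
      finally show ?thesis .
    qed
    have eX: "e (X \<omega>) = indicator (E n) \<omega>" if "\<omega> \<in> space M" for \<omega>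
      using that unfolding e_def E_def X_def \<zeta>_def by (auto simp: indicator_def space_PiM)
    have zX: "z (X \<omega>) = \<zeta> n \<omega>" for \<omega>
      unfolding z_def X_def \<zeta>_def by simp
    have zeta_Suc: "\<zeta> (Suc n) \<omega> = (\<zeta> n \<omega> + Y \<omega>) / of_real (sqrt 2)" for \<omega>
      unfolding \<zeta>_def Y_def \<tau>_def by (simp add: real_sqrt_mult add_divide_distrib[symmetric] mult.commute)
    have E_Suc: "\<omega> \<in> E (Suc n) \<longleftrightarrow> \<omega> \<in> E n \<and> r < cmod (\<zeta> (Suc n) \<omega>)" for \<omega>
      unfolding E_def by (auto simp: le_Suc_eq)
    have "(\<integral>\<^sup>+\<omega>. indicator (E (Suc n)) \<omega> * W (\<zeta> (Suc n) \<omega>) \<partial>M) = (\<integral>\<^sup>+\<omega>. e (X \<omega>) * k (z (X \<omega>) + Y \<omega>) \<partial>M)"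
      by (rule nn_integral_cong) (auto simp: eX zX k_def zeta_Suc[symmetric] E_Suc indicator_def)
    also have "\<dots> = (\<integral>\<^sup>+\<omega>. \<integral>\<^sup>+\<omega>'. e (X \<omega>) * k (z (X \<omega>) + Y \<omega>') \<partial>M \<partial>M)"
      using nn_integral_indep_var[OF ind, of "\<lambda>f v. e f * k (z f + v 1 / of_real (sqrt (\<tau> n)))"]
      unfolding VY by simp
    also have "\<dots> = (\<integral>\<^sup>+\<omega>. \<integral>\<^sup>+y. e (X \<omega>) * k (z (X \<omega>) + y) \<partial>cgauss 1 \<partial>M)"
      unfolding Ylaw[symmetric] by (subst nn_integral_distr) auto
    also have "\<dots> \<le> (\<integral>\<^sup>+\<omega>. \<theta> * (indicator (E n) \<omega> * W (\<zeta> n \<omega>)) \<partial>M)"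
    proof (rule nn_integral_mono)
      fix \<omega> assume \<omega>: "\<omega> \<in> space M"
      \<comment> \<open>On \<open>E n\<close> the current position is outside the disc, where
        \<open>step\<close> applies; elsewhere both sides vanish.\<close>
      have "(\<integral>\<^sup>+y. k (\<zeta> n \<omega> + y) \<partial>cgauss 1) \<le> \<theta> * W (\<zeta> n \<omega>)" if "\<omega> \<in> E n"
        using step[of "\<zeta> n \<omega>"] that unfolding k_def E_def by auto
      then show "(\<integral>\<^sup>+y. e (X \<omega>) * k (z (X \<omega>) + y) \<partial>cgauss 1) \<le> \<theta> * (indicator (E n) \<omega> * W (\<zeta> n \<omega>))"
        unfolding eX[OF \<omega>] zX by (cases "\<omega> \<in> E n") auto
    qed
    also have "\<dots> = \<theta> * (\<integral>\<^sup>+\<omega>. indicator (E n) \<omega> * W (\<zeta> n \<omega>) \<partial>M)"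
      by (rule nn_integral_cmult) measurable
    also have "\<dots> \<le> \<theta> * (\<theta> ^ n * C)" by (rule mult_left_mono[OF Suc.IH]) simp
    finally show ?case by (simp add: mult.assoc)
  qed
  have "emeasure M (E n) = (\<integral>\<^sup>+\<omega>. indicator (E n) \<omega> \<partial>M)" by simp
  also have "\<dots> \<le> (\<integral>\<^sup>+\<omega>. indicator (E n) \<omega> * W (\<zeta> n \<omega>) \<partial>M)"
    by (rule nn_integral_mono) (use W1 in \<open>auto simp: indicator_def\<close>)
  also have "\<dots> \<le> \<theta> ^ n * C" by (rule claim)
  finally show ?thesis unfolding E_def \<zeta>_def \<tau>_def .
qed

section \<open>One-step estimates and the choice of Lyapunov functions\<close>

lemma nn_integral_exp_half_step:
  "(\<integral>\<^sup>+x. ennreal (exp ((cmod ((z + x) / of_real (sqrt 2)))\<^sup>2 / 2)) \<partial>cgauss 1)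
     = ennreal (4 / 3 * exp ((cmod z)\<^sup>2 / 3))"
proof -
  have "(cmod ((z + x) / of_real (sqrt 2)))\<^sup>2 / 2 = 1 / 4 * (cmod (z + x))\<^sup>2" for x
    by (simp add: norm_divide power_divide)
  then have "(\<integral>\<^sup>+x. ennreal (exp ((cmod ((z + x) / of_real (sqrt 2)))\<^sup>2 / 2)) \<partial>cgauss 1)
      = (\<integral>\<^sup>+x. ennreal (exp (1 / 4 * (cmod (z + x))\<^sup>2)) \<partial>cgauss 1)"
    by (simp only:)
  then show ?thesis
    using nn_integral_cgauss_exp[of "1/4" z] by (simp add: mult.commute)
qed

lemma nn_integral_exp_half:
  "(\<integral>\<^sup>+x. ennreal (exp ((cmod x)\<^sup>2 / 2)) \<partial>cgauss 1) = 2"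
  using nn_integral_cgauss_exp[of "1/2" 0] by simp

text \<open>On the interval the density is at least its value at \<open>b + r\<close>, the largest
  possible distance from 0.\<close>

lemma std_normal_interval_ge:
  assumes r: "0 < r" "0 \<le> b" and a: "\<bar>a\<bar> \<le> b"
  shows "ennreal (std_normal_density (b + r) * (2 * r)) \<le> emeasure std_normal {y. \<bar>a + y\<bar> \<le> r}"
proof -
  let ?d = "std_normal_density (b + r)"
  have eq: "{y. \<bar>a + y\<bar> \<le> r} = {- a - r..- a + r}" by auto
  have "ennreal (?d * (2 * r)) = ennreal ?d * emeasure lborel {- a - r..- a + r}"
    using r by (simp add: ennreal_mult)
  also have "\<dots> = (\<integral>\<^sup>+y. ennreal ?d * indicator {- a - r..- a + r} y \<partial>lborel)"
    by (subst nn_integral_cmult_indicator) auto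
  also have "\<dots> \<le> (\<integral>\<^sup>+y. ennreal (std_normal_density y) * indicator {- a - r..- a + r} y \<partial>lborel)"
  proof (rule nn_integral_mono)
    fix y
    have "?d \<le> std_normal_density y" if "y \<in> {- a - r..- a + r}"
    proof -
      have "\<bar>y\<bar> \<le> \<bar>b + r\<bar>" using that a r by auto
      then have "y\<^sup>2 \<le> (b + r)\<^sup>2" by (simp only: abs_le_square_iff)
      then show ?thesis unfolding std_normal_density_def by (intro mult_left_mono) auto
    qed
    then show "ennreal ?d * indicator {- a - r..- a + r} y
        \<le> ennreal (std_normal_density y) * indicator {- a - r..- a + r} y"
      by (auto simp: indicator_def intro!: ennreal_leI)
  qed
  also have "\<dots> = emeasure std_normal {y. \<bar>a + y\<bar> \<le> r}"
    unfolding eq by (subst emeasure_density) auto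
  finally show ?thesis .
qed

text \<open>A square rather than a disc, so that the probability factors into two one-dimensional
  ones; \<open>\<eta>\<close> is uniform over all starting points of modulus at most
  \<open>b\<close>.\<close>

lemma cgauss_square_pos:
  assumes "0 < r" "0 \<le> b" "0 < v"
  shows "\<exists>\<eta>>0. \<forall>z. cmod z \<le> b \<longrightarrow>
    \<eta> \<le> measure (cgauss v) {x. \<bar>Re z + Re x\<bar> \<le> r \<and> \<bar>Im z + Im x\<bar> \<le> r}"
proof -
  let ?s = "sqrt (v / 2)"
  have s: "0 < ?s" using assms by simp
  have "0 < r / ?s" "0 \<le> b / ?s" using s assms by auto
  note interval = std_normal_interval_ge[OF this]
  define \<eta> where "\<eta> = std_normal_density (b / ?s + r / ?s) * (2 * (r / ?s))"
  have \<eta>: "0 < \<eta>" using \<open>0 < r / ?s\<close> unfolding \<eta>_def by (intro mult_pos_pos normal_density_pos) auto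
  have 1: "ennreal \<eta> \<le> (\<integral>\<^sup>+y. indicator {y. \<bar>a + y\<bar> \<le> r} (?s * y) \<partial>std_normal)" if "\<bar>a\<bar> \<le> b" for a
  proof -
    have "\<bar>a / ?s\<bar> \<le> b / ?s" using that s by (simp add: divide_right_mono)
    then have "ennreal \<eta> \<le> emeasure std_normal {y. \<bar>a / ?s + y\<bar> \<le> r / ?s}" 
      unfolding \<eta>_def by (rule interval)
    also have "{y. \<bar>a / ?s + y\<bar> \<le> r / ?s} = {y. \<bar>a + ?s * y\<bar> \<le> r}"
    proof -
      have "\<bar>a / ?s + y\<bar> = \<bar>a + ?s * y\<bar> / ?s" for y
      proof -
        have "a / ?s + y = (a + ?s * y) / ?s" using s by (simp add: field_simps)
        then show ?thesis using s by (simp only: abs_divide abs_of_pos)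
      qed
      then show ?thesis using s by (simp add: divide_le_cancel)
    qed
    also have "emeasure std_normal {y. \<bar>a + ?s * y\<bar> \<le> r} = (\<integral>\<^sup>+y. indicator {y. \<bar>a + ?s * y\<bar> \<le> r} y \<partial>std_normal)"
      by (subst nn_integral_indicator) auto
    also have "\<dots> = (\<integral>\<^sup>+y. indicator {y. \<bar>a + y\<bar> \<le> r} (?s * y) \<partial>std_normal)"
      by (rule nn_integral_cong) (auto simp: indicator_def)
    finally show ?thesis .
  qed
  show ?thesis
  proof (intro exI conjI allI impI)
    show "0 < \<eta>\<^sup>2" using \<eta> by simp
    fix z :: complex assume z: "cmod z \<le> b"
    interpret prob_space "cgauss v" by (rule prob_space_cgauss)
    have "ennreal (\<eta>\<^sup>2) = ennreal \<eta> * ennreal \<eta>"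
      using \<eta> by (simp add: power2_eq_square ennreal_mult)
    also have "\<dots> \<le> (\<integral>\<^sup>+y. indicator {y. \<bar>Re z + y\<bar> \<le> r} (?s * y) \<partial>std_normal)
        * (\<integral>\<^sup>+y. indicator {y. \<bar>Im z + y\<bar> \<le> r} (?s * y) \<partial>std_normal)"
      using abs_Re_le_cmod[of z] abs_Im_le_cmod[of z] z by (intro mult_mono 1) auto
    also have "\<dots> = (\<integral>\<^sup>+x. indicator {y. \<bar>Re z + y\<bar> \<le> r} (Re x) * indicator {y. \<bar>Im z + y\<bar> \<le> r} (Im x) \<partial>cgauss v)"
      by (subst nn_integral_cgauss_prod) auto
    also have "\<dots> = (\<integral>\<^sup>+x. indicator {x. \<bar>Re z + Re x\<bar> \<le> r \<and> \<bar>Im z + Im x\<bar> \<le> r} x \<partial>cgauss v)"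
      by (rule nn_integral_cong) (auto simp: indicator_def)
    also have "\<dots> = emeasure (cgauss v) {x. \<bar>Re z + Re x\<bar> \<le> r \<and> \<bar>Im z + Im x\<bar> \<le> r}"
      by (subst nn_integral_indicator) auto
    finally show "\<eta>\<^sup>2 \<le> measure (cgauss v) {x. \<bar>Re z + Re x\<bar> \<le> r \<and> \<bar>Im z + Im x\<bar> \<le> r}"
      unfolding emeasure_eq_measure by (subst (asm) ennreal_le_iff) auto
  qed
qed

text \<open>One step lowers the exponent |z|^2 / 2 to |z|^2 / 3 and costs a factor 4/3. Outside the
  disc this is a gain of exp (- r^2 / 6). Half of that exponent is spent on the factor 4/3, which is
  possible as r \<ge> 2; the other half is the rate.\<close>

lemma cbm_avoid_decay_large:
  assumes cbm: "complex_brownian_motion M B" and r: "2 \<le> r"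
  shows "measure M {\<omega>\<in>space M. \<forall>i\<le>n. r < cmod (B (2 ^ i) \<omega> / of_real (sqrt (2 ^ i)))}
    \<le> 2 * exp (- r\<^sup>2 / 12) ^ n"
proof -
  interpret prob_space M using cbm by (rule cbm_prob_space)
  have "4 / 3 \<le> exp (1 / 3 :: real)" using exp_ge_add_one_self[of "1/3"] by simp
  also have "\<dots> \<le> exp (r\<^sup>2 / 12)" using power_mono[OF r, of 2] by simp
  finally have 43: "4 / 3 \<le> exp (r\<^sup>2 / 12)" .
  have "emeasure M {\<omega>\<in>space M. \<forall>i\<le>n. r < cmod (B (2 ^ i) \<omega> / of_real (sqrt (2 ^ i)))}
      \<le> ennreal (exp (- r\<^sup>2 / 12)) ^ n * 2"
  proof (rule cbm_lyapunov[OF cbm, of "\<lambda>z. ennreal (exp ((cmod z)\<^sup>2 / 2))"])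
    fix z assume z: "r < cmod z"
    have "(\<integral>\<^sup>+x. ennreal (exp ((cmod ((z + x) / of_real (sqrt 2)))\<^sup>2 / 2))
        * indicator {y. r < cmod y} ((z + x) / of_real (sqrt 2)) \<partial>cgauss 1)
      \<le> (\<integral>\<^sup>+x. ennreal (exp ((cmod ((z + x) / of_real (sqrt 2)))\<^sup>2 / 2)) \<partial>cgauss 1)"
      by (rule nn_integral_mono) (auto simp: indicator_def)
    also have "\<dots> = ennreal (4 / 3 * exp ((cmod z)\<^sup>2 / 3))" by (rule nn_integral_exp_half_step)
    also have "\<dots> \<le> ennreal (exp (- r\<^sup>2 / 12) * exp ((cmod z)\<^sup>2 / 2))"
    proof (rule ennreal_leI)
      have "r\<^sup>2 \<le> (cmod z)\<^sup>2" using z r by (intro power_mono) auto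
      have "4 / 3 * exp ((cmod z)\<^sup>2 / 3) \<le> exp (r\<^sup>2 / 12) * exp ((cmod z)\<^sup>2 / 3)"
        using 43 by (intro mult_right_mono) auto
      also have "\<dots> \<le> exp (- r\<^sup>2 / 12) * exp ((cmod z)\<^sup>2 / 2)"
        using \<open>r\<^sup>2 \<le> _\<close> by (simp flip: exp_add)
      finally show "4 / 3 * exp ((cmod z)\<^sup>2 / 3) \<le> exp (- r\<^sup>2 / 12) * exp ((cmod z)\<^sup>2 / 2)" .
    qed
    finally show "(\<integral>\<^sup>+x. ennreal (exp ((cmod ((z + x) / of_real (sqrt 2)))\<^sup>2 / 2))
        * indicator {y. r < cmod y} ((z + x) / of_real (sqrt 2)) \<partial>cgauss 1)
      \<le> ennreal (exp (- r\<^sup>2 / 12)) * ennreal (exp ((cmod z)\<^sup>2 / 2))"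
      by (simp add: ennreal_mult)
  qed (auto simp: nn_integral_exp_half)
  also have "\<dots> = ennreal (2 * exp (- r\<^sup>2 / 12) ^ n)"
    by (simp add: ennreal_power ennreal_mult mult.commute)
  finally show ?thesis
    unfolding emeasure_eq_measure by (subst (asm) ennreal_le_iff) auto
qed

text \<open>For small \<open>r\<close> the factor 4/3 is not compensated near the disc. A constant
  \<open>A\<close> added to the Lyapunov function repairs this: from |z| \<le> 3 the chain is killed
  with probability at least \<open>\<eta>\<close>, which removes \<open>\<eta> * A\<close> and
  outweighs the growth of the exponential, while for |z| > 3 the exponential part is at least
  halved.\<close>

lemma cbm_avoid_decay_small:
  assumes r: "0 < r"
  shows "\<exists>C \<theta> :: real. 0 < C \<and> 0 < \<theta> \<and> \<theta> < 1 \<and>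
    (\<forall>(M :: 'w measure) B n. complex_brownian_motion M B \<longrightarrow>
      measure M {\<omega>\<in>space M. \<forall>i\<le>n. r < cmod (B (2 ^ i) \<omega> / of_real (sqrt (2 ^ i)))} \<le> C * \<theta> ^ n)"
proof -
  obtain \<eta> where \<eta>: "0 < \<eta>"
    "\<And>z. cmod z \<le> 3 \<Longrightarrow> \<eta> \<le> measure (cgauss 1) {x. \<bar>Re z + Re x\<bar> \<le> r \<and> \<bar>Im z + Im x\<bar> \<le> r}"
    using cgauss_square_pos[OF r, of 3 1] by auto
  interpret G: prob_space "cgauss 1" by (rule prob_space_cgauss)
  \<comment> \<open>\<open>K\<close> bounds 4/3 exp (|z|^2 / 3) for |z| \<le> 3, and
    \<open>A\<close> is chosen so that \<open>K\<close> uses up half of the killed amount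
    \<open>\<eta> * A\<close>. The first entry of \<open>\<theta>\<close> is the rate for |z| \<le>
    3; the second is the largest value of (A + V / 2) / (A + V) over V \<ge> 1, the rate for |z| >
    3.\<close>
  define K where "K = 4 / 3 * exp (3::real)"
  define A where "A = 2 * K / \<eta>"
  define \<theta> where "\<theta> = max (1 - \<eta> / 2) ((A + 1 / 2) / (A + 1))"
  have K: "0 < K" by (simp add: K_def)
  have A: "0 < A" "K = A * \<eta> / 2" using \<eta> K by (auto simp: A_def)
  have "0 < (A + 1 / 2) / (A + 1)" "(A + 1 / 2) / (A + 1) < 1" using A by auto
  then have \<theta>: "0 < \<theta>" "\<theta> < 1" "(A + 1 / 2) / (A + 1) \<le> \<theta>" "1 - \<eta> / 2 \<le> \<theta>"
    using \<eta>(1) unfolding \<theta>_def less_max_iff_disj max_less_iff_conj by auto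
  let ?V = "\<lambda>z. exp ((cmod z)\<^sup>2 / 2)"
  let ?h = "\<lambda>z x. (z + x) / of_real (sqrt 2) :: complex"
  have step: "(\<integral>\<^sup>+x. ennreal (A + ?V (?h z x)) * indicator {y. r < cmod y} (?h z x) \<partial>cgauss 1)
      \<le> ennreal \<theta> * ennreal (A + ?V z)" for z
  proof -
    have V: "(\<integral>\<^sup>+x. ennreal (?V (?h z x)) \<partial>cgauss 1) = ennreal (4 / 3 * exp ((cmod z)\<^sup>2 / 3))"
      by (rule nn_integral_exp_half_step)
    have "(\<integral>\<^sup>+x. ennreal (A + ?V (?h z x)) * indicator {y. r < cmod y} (?h z x) \<partial>cgauss 1)
        \<le> (\<integral>\<^sup>+x. ennreal A * indicator {x. r < cmod (?h z x)} x + ennreal (?V (?h z x)) \<partial>cgauss 1)"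
      using A by (intro nn_integral_mono) (auto simp: indicator_def)
    also have "\<dots> = ennreal A * emeasure (cgauss 1) {x. r < cmod (?h z x)} + ennreal (4 / 3 * exp ((cmod z)\<^sup>2 / 3))"
      by (subst nn_integral_add) (auto simp: V[simplified] nn_integral_cmult_indicator)
    also have "\<dots> = ennreal (A * measure (cgauss 1) {x. r < cmod (?h z x)} + 4 / 3 * exp ((cmod z)\<^sup>2 / 3))"
      unfolding G.emeasure_eq_measure using A by (simp add: ennreal_mult)
    also have "\<dots> \<le> ennreal (\<theta> * (A + ?V z))"
    proof (rule ennreal_leI)
      show "A * measure (cgauss 1) {x. r < cmod (?h z x)} + 4 / 3 * exp ((cmod z)\<^sup>2 / 3) \<le> \<theta> * (A + ?V z)"
      proof (cases "cmod z \<le> 3")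
        case True
        \<comment> \<open>Landing outside the disc means |z + x| > r sqrt 2, so \<open>z + x\<close>
          lies outside the square of half-side \<open>r\<close>.\<close>
        have sub: "{x. r < cmod (?h z x)} \<subseteq> space (cgauss 1) - {x. \<bar>Re z + Re x\<bar> \<le> r \<and> \<bar>Im z + Im x\<bar> \<le> r}"
        proof (intro subsetI DiffI)
          fix x assume "x \<in> {x. r < cmod (?h z x)}"
          then have "r < cmod (z + x) / sqrt 2" by (simp add: norm_divide)
          then have "r * sqrt 2 < cmod (z + x)" by (simp add: less_divide_eq)
          then have "(r * sqrt 2)\<^sup>2 < (cmod (z + x))\<^sup>2" using r by (intro power_strict_mono) auto
          then have *: "2 * r\<^sup>2 < (Re z + Re x)\<^sup>2 + (Im z + Im x)\<^sup>2"
            by (simp add: power_mult_distrib cmod_power2 mult.commute)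
          show "x \<notin> {x. \<bar>Re z + Re x\<bar> \<le> r \<and> \<bar>Im z + Im x\<bar> \<le> r}"
          proof
            assume "x \<in> {x. \<bar>Re z + Re x\<bar> \<le> r \<and> \<bar>Im z + Im x\<bar> \<le> r}"
            then have "(Re z + Re x)\<^sup>2 \<le> r\<^sup>2" "(Im z + Im x)\<^sup>2 \<le> r\<^sup>2"
              using r by (auto simp flip: abs_le_square_iff)
            with * show False by simp
          qed
        qed auto
        have "measure (cgauss 1) {x. r < cmod (?h z x)}
            \<le> measure (cgauss 1) (space (cgauss 1) - {x. \<bar>Re z + Re x\<bar> \<le> r \<and> \<bar>Im z + Im x\<bar> \<le> r})"
          by (rule G.finite_measure_mono[OF sub]) auto
        also have "\<dots> = 1 - measure (cgauss 1) {x. \<bar>Re z + Re x\<bar> \<le> r \<and> \<bar>Im z + Im x\<bar> \<le> r}"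
          by (rule G.prob_compl) auto
        also have "\<dots> \<le> 1 - \<eta>" using \<eta>(2)[OF True] by simp
        finally have "A * measure (cgauss 1) {x. r < cmod (?h z x)} \<le> A * (1 - \<eta>)"
          using A by (intro mult_left_mono) auto
        moreover have "4 / 3 * exp ((cmod z)\<^sup>2 / 3) \<le> K"
          using power_mono[OF True, of 2] by (simp add: K_def)
        moreover have "A * (1 - \<eta>) + K = (1 - \<eta> / 2) * A" using A(2) by (simp add: algebra_simps)
        moreover have "(1 - \<eta> / 2) * A \<le> \<theta> * A" using \<theta> A by (intro mult_right_mono) auto
        moreover have "\<theta> * A \<le> \<theta> * (A + ?V z)" using \<theta> by (intro mult_left_mono) auto
        ultimately show ?thesis by linarith
      next
        case False
        have "9 \<le> (cmod z)\<^sup>2" using power_mono[of 3 "cmod z" 2] False by simp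
        have "8 / 3 \<le> exp (3 / 2 :: real)" using exp_lower_Taylor_quadratic[of "3/2::real"] by (simp add: power2_eq_square)
        also have "\<dots> \<le> exp ((cmod z)\<^sup>2 / 6)" using \<open>9 \<le> _\<close> by simp
        finally have "4 / 3 * exp ((cmod z)\<^sup>2 / 3) \<le> exp ((cmod z)\<^sup>2 / 6) / 2 * exp ((cmod z)\<^sup>2 / 3)"
          by (intro mult_right_mono) auto
        also have "\<dots> = ?V z / 2" by (simp flip: exp_add)
        finally have 1: "4 / 3 * exp ((cmod z)\<^sup>2 / 3) \<le> ?V z / 2" .
        have 2: "A * measure (cgauss 1) {x. r < cmod (?h z x)} \<le> A"
          using A by (simp add: mult_left_le)
        have "1 \<le> ?V z" by simp
        then have "A * 1 \<le> A * ?V z" using A by (intro mult_left_mono) auto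
        then have "(A + ?V z / 2) * (A + 1) \<le> (A + 1 / 2) * (A + ?V z)"
          by (simp add: algebra_simps add_divide_distrib)
        then have "A + ?V z / 2 \<le> (A + 1 / 2) / (A + 1) * (A + ?V z)"
          using A by (simp add: field_simps)
        also have "\<dots> \<le> \<theta> * (A + ?V z)" using \<theta> A by (intro mult_right_mono) (auto intro: add_nonneg_nonneg)
        finally show ?thesis using 1 2 by linarith
      qed
    qed
    finally show ?thesis using \<theta> A by (simp add: ennreal_mult)
  qed
  show ?thesis
  proof (intro exI conjI allI impI)
    show "0 < A + 2" using A by simp
    show "0 < \<theta>" "\<theta> < 1" using \<theta> by auto
    fix M :: "'w measure" and B n assume cbm: "complex_brownian_motion M B"
    interpret prob_space M using cbm by (rule cbm_prob_space)
    have "emeasure M {\<omega>\<in>space M. \<forall>i\<le>n. r < cmod (B (2 ^ i) \<omega> / of_real (sqrt (2 ^ i)))}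
        \<le> ennreal \<theta> ^ n * ennreal (A + 2)"
    proof (rule cbm_lyapunov[OF cbm, of "\<lambda>z. ennreal (A + ?V z)"])
      show "1 \<le> ennreal (A + ?V z)" for z
      proof -
        have "1 \<le> ?V z" by simp
        then have "1 \<le> A + ?V z" using A by linarith
        then show ?thesis unfolding ennreal_1[symmetric] by (rule ennreal_leI)
      qed
      have "(\<integral>\<^sup>+x. ennreal (A + ?V x) \<partial>cgauss 1) = (\<integral>\<^sup>+x. ennreal A + ennreal (?V x) \<partial>cgauss 1)"
        using A by (intro nn_integral_cong) auto
      also have "\<dots> = ennreal A + 2"
        by (subst nn_integral_add) (auto simp: nn_integral_exp_half G.emeasure_space_1[simplified])
      also have "\<dots> = ennreal (A + 2)" using A by simp
      finally show "(\<integral>\<^sup>+x. ennreal (A + ?V x) \<partial>cgauss 1) \<le> ennreal (A + 2)" by simp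
    qed (use step in auto)
    also have "\<dots> = ennreal ((A + 2) * \<theta> ^ n)"
      using \<theta> A by (simp add: ennreal_power ennreal_mult mult.commute)
    finally show "measure M {\<omega>\<in>space M. \<forall>i\<le>n. r < cmod (B (2 ^ i) \<omega> / of_real (sqrt (2 ^ i)))} \<le> (A + 2) * \<theta> ^ n"
      unfolding emeasure_eq_measure using \<theta> A by (subst (asm) ennreal_le_iff) auto
  qed
qed

section \<open>Independent events on geometric time blocks\<close>

text \<open>Floor approximations of \<open>x\<close> on the dyadic grids converge to it. Only levels
  from \<open>l\<close> on are required, because in the Poisson model a given particle is controlled
  on fine grids only.\<close>

lemma dyadic_closed:
  fixes f :: "real \<Rightarrow> 'a::first_countable_topology"
  assumes f: "continuous_on {0..1} f" and F: "closed F"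
    and dy: "\<And>m j. l \<le> m \<Longrightarrow> j \<le> 2 ^ m \<Longrightarrow> f (real j / 2 ^ m) \<in> F" and x: "x \<in> {0..1}"
  shows "f x \<in> F"
proof -
  define y where "y m = real (nat \<lfloor>x * 2 ^ m\<rfloor>) / 2 ^ m" for m
  have nn: "0 \<le> \<lfloor>x * 2 ^ m\<rfloor>" for m using x by simp
  then have y: "y m = of_int \<lfloor>x * 2 ^ m\<rfloor> / 2 ^ m" for m by (simp add: y_def)
  have le: "\<lfloor>x * 2 ^ m\<rfloor> \<le> 2 ^ m" for m
  proof -
    have "x * 2 ^ m \<le> 2 ^ m" using x by simp
    then have "of_int \<lfloor>x * 2 ^ m\<rfloor> \<le> (2 ^ m :: real)" by linarith
    also have "(2 ^ m :: real) = of_int (2 ^ m)" by simp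
    finally show ?thesis by (simp only: of_int_le_iff)
  qed
  have mem: "y m \<in> {0..1}" for m
  proof -
    have "of_int \<lfloor>x * 2 ^ m\<rfloor> \<le> x * 2 ^ m" by simp
    then have "y m \<le> x" unfolding y by (simp add: divide_le_eq)
    moreover have "0 \<le> y m" unfolding y_def by simp
    ultimately show ?thesis using x by auto
  qed
  have "(\<lambda>m. (1 / 2) ^ m) \<longlonglongrightarrow> (0::real)" by (rule LIMSEQ_power_zero) simp
  moreover have "norm (y m - x) \<le> (1 / 2) ^ m" for m
  proof -
    have "x * 2 ^ m - 1 < of_int \<lfloor>x * 2 ^ m\<rfloor>" "of_int \<lfloor>x * 2 ^ m\<rfloor> \<le> x * 2 ^ m" by linarith+
    then have "\<bar>of_int \<lfloor>x * 2 ^ m\<rfloor> - x * 2 ^ m\<bar> \<le> 1" by linarith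
    then have "\<bar>of_int \<lfloor>x * 2 ^ m\<rfloor> - x * 2 ^ m\<bar> / 2 ^ m \<le> 1 / 2 ^ m" by (rule divide_right_mono) simp
    moreover have "y m - x = (of_int \<lfloor>x * 2 ^ m\<rfloor> - x * 2 ^ m) / 2 ^ m" unfolding y by (simp add: field_simps)
    ultimately show ?thesis by (simp add: power_one_over)
  qed
  ultimately have "(\<lambda>m. y m - x) \<longlonglongrightarrow> 0"
    by (intro Lim_null_comparison[of "\<lambda>m. y m - x" "\<lambda>m. (1 / 2) ^ m"] always_eventually) auto
  then have "y \<longlonglongrightarrow> x" by (rule LIM_zero_cancel)
  then have "(\<lambda>m. f (y m)) \<longlonglongrightarrow> f x"
    by (rule continuous_on_tendsto_compose[OF f]) (use x mem in auto)
  then have "(\<lambda>m. f (y (m + l))) \<longlonglongrightarrow> f x"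
    by (rule LIMSEQ_ignore_initial_segment)
  moreover have "f (y (m + l)) \<in> F" for m
  proof -
    have "int (nat \<lfloor>x * 2 ^ (m + l)\<rfloor>) \<le> int (2 ^ (m + l))"
      using le[of "m + l"] nn[of "m + l"] by simp
    then have "nat \<lfloor>x * 2 ^ (m + l)\<rfloor> \<le> 2 ^ (m + l)" by (simp only: of_nat_le_iff)
    then show ?thesis unfolding y_def by (intro dy) auto
  qed
  ultimately show ?thesis
    using closed_sequentially[OF F, of "\<lambda>m. f (y (m + l))" "f x"] by simp
qed

text \<open>Each block [q^i, q^(i+1)] is cut into \<open>N\<close> equal pieces, and the cut points
  of all blocks are listed in a single monotone sequence, as \<open>cbm_past_future\<close>
  requires.\<close>

definition block_time :: "real \<Rightarrow> nat \<Rightarrow> nat \<Rightarrow> real" where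
  "block_time q N k = q ^ (k div N) * (1 + (q - 1) * real (k mod N) / real N)"

lemma block_time_eq:
  assumes "0 < N" "j \<le> N"
  shows "block_time q N (i * N + j) = q ^ i * (1 + (q - 1) * real j / real N)"
proof (cases "j = N")
  case True
  then have "i * N + j = Suc i * N" by simp
  then show ?thesis using assms True by (simp only: block_time_def) simp
next
  case False
  then have "j < N" using assms by simp
  then have "(i * N + j) div N = i" "(i * N + j) mod N = j" by auto
  then show ?thesis by (simp add: block_time_def)
qed

lemma mono_block_time:
  assumes q: "1 < q" and N: "0 < N"
  shows "mono (block_time q N)"
  unfolding mono_iff_le_Suc
proof
  fix k
  define i j where "i = k div N" and "j = k mod N"
  have j: "j < N" using N by (simp add: j_def)
  have k: "k = i * N + j" "Suc k = i * N + Suc j" by (auto simp: i_def j_def)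
  have "q ^ i * (1 + (q - 1) * real j / real N) \<le> q ^ i * (1 + (q - 1) * real (Suc j) / real N)"
    using q N by (intro mult_left_mono add_left_mono divide_right_mono) auto
  then show "block_time q N k \<le> block_time q N (Suc k)"
    using block_time_eq[OF N less_imp_le[OF j], of q i] block_time_eq[OF N Suc_leI[OF j], of q i]
    unfolding k(1)[symmetric] k(2)[symmetric] by simp
qed

text \<open>Divided by sqrt (q^i), every block [q^i, q^(i+1)] looks the same, with total variance
  \<open>q - 1\<close>. Its success probability is at least the chance that the rescaled
  displacement lies in \<open>G\<close>, minus the maximal-inequality bound for an oscillation above
  \<open>h\<close>. Blocks are independent, so the bounds multiply.\<close>

lemma cbm_blocks_grid:
  assumes cbm: "complex_brownian_motion M B" and q: "1 < q" and N: "0 < N" and h: "0 \<le> h"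
    and G [measurable]: "G0 \<in> sets borel" "G \<in> sets borel"
    and \<pi>: "0 \<le> \<pi>" "\<pi> \<le> measure (cgauss (q - 1)) G - 4 * exp (- h\<^sup>2 / (8 * (q - 1)))"
  shows "measure (cgauss 1) G0 * \<pi> ^ n \<le> measure M {\<omega>\<in>space M. B 1 \<omega> \<in> G0 \<and> (\<forall>i<n.
      (\<forall>j\<le>N. cmod (B (q ^ i * (1 + (q - 1) * real j / real N)) \<omega> - B (q ^ i) \<omega>) \<le> sqrt (q ^ i) * h) \<and>
      (B (q ^ Suc i) \<omega> - B (q ^ i) \<omega>) / of_real (sqrt (q ^ i)) \<in> G)}"
proof -
  interpret prob_space M using cbm by (rule cbm_prob_space)
  define \<tau> where "\<tau> = block_time q N"
  have \<tau>: "mono \<tau>" "0 \<le> \<tau> 0"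
    unfolding \<tau>_def using mono_block_time[OF q N] by (auto simp: block_time_def)
  have \<tau>_eq: "\<tau> (i * N + j) = q ^ i * (1 + (q - 1) * real j / real N)" if "j \<le> N" for i j
    unfolding \<tau>_def by (rule block_time_eq[OF N that])
  have \<tau>0: "\<tau> (i * N) = q ^ i" and \<tau>1: "\<tau> (i * N + N) = q ^ Suc i" for i
    using \<tau>_eq[of 0 i] \<tau>_eq[of N i] N by auto
  have pos: "0 \<le> \<tau> i" for i using \<tau> monoD[OF \<tau>(1), of 0 i] by simp
  have B [measurable]: "B (\<tau> i) \<in> borel_measurable M" for i
    using cbm_measurable[OF cbm pos] .
  define E where "E n = {\<omega>\<in>space M. B (\<tau> 0) \<omega> \<in> G0 \<and> (\<forall>i<n.
      (\<forall>j\<le>N. cmod (B (\<tau> (i * N + j)) \<omega> - B (\<tau> (i * N)) \<omega>) \<le> sqrt (q ^ i) * h) \<and>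
      (B (\<tau> (i * N + N)) \<omega> - B (\<tau> (i * N)) \<omega>) / of_real (sqrt (q ^ i)) \<in> G)}" for n
  define D where "D n = {\<omega>\<in>space M.
      (\<forall>j\<le>N. cmod (B (\<tau> (n * N + j)) \<omega> - B (\<tau> (n * N)) \<omega>) \<le> sqrt (q ^ n) * h) \<and>
      (B (\<tau> (n * N + N)) \<omega> - B (\<tau> (n * N)) \<omega>) / of_real (sqrt (q ^ n)) \<in> G}" for n
  have indep: "prob (E (Suc n)) = prob (E n) * prob (D n)" for n
  proof -
    let ?S = "PiM {..n * N} (\<lambda>_. borel :: complex measure)" and ?T = "PiM {..N} (\<lambda>_. borel :: complex measure)"
    define A where "A = {f\<in>space ?S. f 0 \<in> G0 \<and> (\<forall>i\<in>{..<n}.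
      (\<forall>j\<in>{..N}. cmod (f (i * N + j) - f (i * N)) \<le> sqrt (q ^ i) * h) \<and>
      (f (i * N + N) - f (i * N)) / of_real (sqrt (q ^ i)) \<in> G)}"
    define C where "C = {f\<in>space ?T. (\<forall>j\<in>{..N}. cmod (f j) \<le> sqrt (q ^ n) * h) \<and> f N / of_real (sqrt (q ^ n)) \<in> G}"
    let ?X = "\<lambda>\<omega>. \<lambda>i\<in>{..n * N}. B (\<tau> i) \<omega>" and ?Y = "\<lambda>\<omega>. \<lambda>j\<in>{..N}. B (\<tau> (n * N + j)) \<omega> - B (\<tau> (n * N)) \<omega>"
    have idx: "i * N + j \<le> n * N" if "i < n" "j \<le> N" for i j
    proof -
      have "i * N + j \<le> Suc i * N" using that by simp
      also have "\<dots> \<le> n * N" using that by (intro mult_right_mono) auto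
      finally show ?thesis .
    qed
    have idx0: "i * N \<le> n * N" if "i < n" for i using idx[OF that, of 0] by simp
    have A: "A \<in> sets ?S"
      unfolding A_def
    proof -
      have mS: "(\<lambda>f. f i) \<in> borel_measurable ?S" if "i \<le> n * N" for i
        by (rule measurable_component_singleton) (use that in auto)
      have [measurable]: "(\<lambda>f. f 0) \<in> borel_measurable ?S" by (rule mS) simp
      show "{f\<in>space ?S. f 0 \<in> G0 \<and> (\<forall>i\<in>{..<n}.
      (\<forall>j\<in>{..N}. cmod (f (i * N + j) - f (i * N)) \<le> sqrt (q ^ i) * h) \<and>
      (f (i * N + N) - f (i * N)) / of_real (sqrt (q ^ i)) \<in> G)} \<in> sets ?S"
      proof (intro sets.sets_Collect_conj sets.sets_Collect_finite_All)
        show "{f\<in>space ?S. f 0 \<in> G0} \<in> sets ?S" by measurable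
        fix i assume i: "i \<in> {..<n}"
        then have [measurable]: "(\<lambda>f. f (i * N + N)) \<in> borel_measurable ?S" "(\<lambda>f. f (i * N)) \<in> borel_measurable ?S"
          using idx[of i N] idx0[of i] by (auto intro!: mS)
        show "{f\<in>space ?S. (f (i * N + N) - f (i * N)) / of_real (sqrt (q ^ i)) \<in> G} \<in> sets ?S" by measurable
        fix j assume "j \<in> {..N}"
        then have [measurable]: "(\<lambda>f. f (i * N + j)) \<in> borel_measurable ?S"
          using idx[of i j] i by (auto intro!: mS)
        show "{f\<in>space ?S. cmod (f (i * N + j) - f (i * N)) \<le> sqrt (q ^ i) * h} \<in> sets ?S" by measurable
      qed auto
    qed
    have C: "C \<in> sets ?T"
      unfolding C_def
    proof (intro sets.sets_Collect_conj sets.sets_Collect_finite_All)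
      have mT: "(\<lambda>f. f i) \<in> borel_measurable ?T" if "i \<le> N" for i
        by (rule measurable_component_singleton) (use that in auto)
      have [measurable]: "(\<lambda>f. f N) \<in> borel_measurable ?T" by (rule mT) simp
      show "{f\<in>space ?T. f N / of_real (sqrt (q ^ n)) \<in> G} \<in> sets ?T" by measurable
      fix j assume "j \<in> {..N}"
      then have [measurable]: "(\<lambda>f. f j) \<in> borel_measurable ?T" by (intro mT) simp
      show "{f\<in>space ?T. cmod (f j) \<le> sqrt (q ^ n) * h} \<in> sets ?T" by measurable
    qed auto
    have XA: "?X \<omega> \<in> A \<longleftrightarrow> \<omega> \<in> E n" if "\<omega> \<in> space M" for \<omega>
      using that idx idx0 unfolding E_def A_def by (auto simp: space_PiM)
    have YC: "?Y \<omega> \<in> C \<longleftrightarrow> \<omega> \<in> D n" if "\<omega> \<in> space M" for \<omega>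
      using that unfolding D_def C_def by (auto simp: space_PiM)
    have sub: "E n \<subseteq> space M" "D n \<subseteq> space M" by (auto simp: E_def D_def)
    have "prob {\<omega>\<in>space M. ?X \<omega> \<in> A \<and> ?Y \<omega> \<in> C} = prob {\<omega>\<in>space M. ?X \<omega> \<in> A} * prob {\<omega>\<in>space M. ?Y \<omega> \<in> C}"
      by (rule prob_indep_var[OF cbm_past_future[OF cbm \<tau>] A C])
    moreover have "{\<omega>\<in>space M. ?X \<omega> \<in> A} = E n" using XA sub by blast
    moreover have "{\<omega>\<in>space M. ?Y \<omega> \<in> C} = D n" using YC sub by blast
    moreover have "{\<omega>\<in>space M. ?X \<omega> \<in> A \<and> ?Y \<omega> \<in> C} = E (Suc n)"
    proof -
      have "{\<omega>\<in>space M. ?X \<omega> \<in> A \<and> ?Y \<omega> \<in> C} = E n \<inter> D n"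
        using XA YC sub by blast
      also have "\<dots> = E (Suc n)"
        unfolding E_def D_def by (auto simp: less_Suc_eq)
      finally show ?thesis .
    qed
    ultimately show ?thesis by simp
  qed
  have D: "\<pi> \<le> prob (D n)" for n
  proof -
    define \<sigma> where "\<sigma> j = \<tau> (n * N + j)" for j
    have \<sigma>: "mono \<sigma>" "0 \<le> \<sigma> 0" unfolding \<sigma>_def by (auto simp: mono_def pos intro!: monoD[OF \<tau>(1)])
    have qn: "0 < q ^ n" using q by simp
    have \<sigma>N: "\<sigma> N - \<sigma> 0 = q ^ n * (q - 1)" unfolding \<sigma>_def using \<tau>0[of n] \<tau>1[of n] by (simp add: algebra_simps)
    let ?Bad = "{\<omega>\<in>space M. \<exists>j\<le>N. sqrt (q ^ n) * h < cmod (B (\<sigma> j) \<omega> - B (\<sigma> 0) \<omega>)}"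
    let ?Good = "{\<omega>\<in>space M. (B (\<sigma> N) \<omega> - B (\<sigma> 0) \<omega>) / of_real (sqrt (q ^ n)) \<in> G}"
    have [measurable]: "B (\<sigma> j) \<in> borel_measurable M" for j unfolding \<sigma>_def by measurable
    have mm: "?Bad \<in> events" "?Good \<in> events" by measurable
    have "prob ?Bad \<le> 4 * exp (- (sqrt (q ^ n) * h)\<^sup>2 / (8 * (q ^ n * (q - 1))))"
      by (rule cbm_maximal_grid[OF cbm \<sigma>]) (use q h \<sigma>N qn in auto)
    also have "(sqrt (q ^ n) * h)\<^sup>2 = q ^ n * h\<^sup>2" using qn by (simp add: power_mult_distrib)
    also have "- (q ^ n * h\<^sup>2) / (8 * (q ^ n * (q - 1))) = - h\<^sup>2 / (8 * (q - 1))" using q by simp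
    finally have bad: "prob ?Bad \<le> 4 * exp (- h\<^sup>2 / (8 * (q - 1)))" .
    have good: "prob ?Good = measure (cgauss (q - 1)) G"
    proof -
      have law: "distr M borel (\<lambda>\<omega>. B (\<sigma> N) \<omega> - B (\<sigma> 0) \<omega>) = cgauss (\<sigma> N - \<sigma> 0)"
        by (rule cbm_increment[OF cbm \<sigma>(2) monoD[OF \<sigma>(1)]]) simp
      have "distr M borel (\<lambda>\<omega>. (B (\<sigma> N) \<omega> - B (\<sigma> 0) \<omega>) / of_real (sqrt (q ^ n)))
          = distr (distr M borel (\<lambda>\<omega>. B (\<sigma> N) \<omega> - B (\<sigma> 0) \<omega>)) borel (\<lambda>x. of_real (1 / sqrt (q ^ n)) * x)"
        by (subst distr_distr) (auto simp: comp_def intro!: distr_cong)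
      also have "\<dots> = cgauss ((1 / sqrt (q ^ n))\<^sup>2 * (\<sigma> N - \<sigma> 0))"
        unfolding law by (rule cgauss_scale) (use qn q \<sigma>N in auto)
      also have "(1 / sqrt (q ^ n))\<^sup>2 * (\<sigma> N - \<sigma> 0) = q - 1"
        unfolding \<sigma>N using q by (simp add: power_divide)
      finally show ?thesis
        by (subst prob_distr) auto
    qed
    have Dev: "D n \<in> events"
    proof -
      have "D n = {\<omega>\<in>space M. (\<forall>j\<le>N. cmod (B (\<sigma> j) \<omega> - B (\<sigma> 0) \<omega>) \<le> sqrt (q ^ n) * h) \<and>
          (B (\<sigma> N) \<omega> - B (\<sigma> 0) \<omega>) / of_real (sqrt (q ^ n)) \<in> G}"
        unfolding D_def \<sigma>_def by simp
      also have "\<dots> \<in> events" by measurable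
      finally show ?thesis .
    qed
    have "prob ?Good \<le> prob (D n \<union> ?Bad)"
    proof (rule finite_measure_mono)
      show "?Good \<subseteq> D n \<union> ?Bad" unfolding D_def \<sigma>_def by (auto simp: not_le)
      show "D n \<union> ?Bad \<in> events" using mm Dev by blast
    qed
    also have "\<dots> \<le> prob (D n) + prob ?Bad"
      by (rule measure_Un_le[OF Dev mm(1)])
    finally show ?thesis using good bad \<pi>(2) by linarith
  qed
  have "measure (cgauss 1) G0 * \<pi> ^ n \<le> prob (E n)" for n
  proof (induction n)
    case 0
    have "\<tau> 0 = 1" using \<tau>0[of 0] by simp
    have "E 0 = {\<omega>\<in>space M. B 1 \<omega> \<in> G0}" unfolding E_def \<open>\<tau> 0 = 1\<close> by auto
    then show ?case using prob_distr[of "B 1" G0] cbm_law[OF cbm, of 1] B[of 0] \<open>\<tau> 0 = 1\<close> by simp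
  next
    case (Suc n)
    have "measure (cgauss 1) G0 * \<pi> ^ Suc n = measure (cgauss 1) G0 * \<pi> ^ n * \<pi>" by simp
    also have "\<dots> \<le> prob (E n) * prob (D n)"
      by (intro mult_mono Suc.IH D \<pi>) auto
    finally show ?case by (simp add: indep)
  qed
  from this[of n] show ?thesis
    unfolding E_def using \<tau>0[of 0] by (simp add: \<tau>0 \<tau>1 \<tau>_eq cong: conj_cong)
qed

text \<open>The probability bound does not depend on the mesh, so it survives the limit over grids
  with 2^m pieces per block. Path continuity then turns the oscillation bound at dyadic points into
  one for every \<open>s\<close> of the block.\<close>

lemma cbm_blocks:
  assumes cbm: "complex_brownian_motion M B" and q: "1 < q" and h: "0 \<le> h"
    and G [measurable]: "G0 \<in> sets borel" "G \<in> sets borel"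
    and \<pi>: "0 \<le> \<pi>" "\<pi> \<le> measure (cgauss (q - 1)) G - 4 * exp (- h\<^sup>2 / (8 * (q - 1)))"
  obtains E where "E \<in> sets M" "measure (cgauss 1) G0 * \<pi> ^ n \<le> measure M E"
    "\<And>\<omega>. \<omega> \<in> E \<Longrightarrow> B 1 \<omega> \<in> G0"
    "\<And>\<omega> i. \<omega> \<in> E \<Longrightarrow> i < n \<Longrightarrow> (B (q ^ Suc i) \<omega> - B (q ^ i) \<omega>) / of_real (sqrt (q ^ i)) \<in> G"
    "\<And>\<omega> i s. \<omega> \<in> E \<Longrightarrow> i < n \<Longrightarrow> q ^ i \<le> s \<Longrightarrow> s \<le> q ^ Suc i \<Longrightarrow>
      cmod (B s \<omega> - B (q ^ i) \<omega>) \<le> sqrt (q ^ i) * h"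
proof -
  interpret prob_space M using cbm by (rule cbm_prob_space)
  define E where "E m = {\<omega>\<in>space M. B 1 \<omega> \<in> G0 \<and> (\<forall>i<n.
      (\<forall>j\<le>2 ^ m. cmod (B (q ^ i * (1 + (q - 1) * real j / real (2 ^ m))) \<omega> - B (q ^ i) \<omega>) \<le> sqrt (q ^ i) * h) \<and>
      (B (q ^ Suc i) \<omega> - B (q ^ i) \<omega>) / of_real (sqrt (q ^ i)) \<in> G)}" for m :: nat
  have [measurable]: "E m \<in> events" for m
  proof -
    have [measurable]: "B 1 \<in> borel_measurable M" "B (q ^ i) \<in> borel_measurable M"
      "B (q ^ Suc i) \<in> borel_measurable M" "B (q ^ i * (1 + (q - 1) * real j / real (2 ^ m))) \<in> borel_measurable M" for i j
      using q by (auto intro!: cbm_measurable[OF cbm] mult_nonneg_nonneg add_nonneg_nonneg)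
    show ?thesis unfolding E_def by measurable
  qed
  have dec: "decseq E"
    unfolding decseq_Suc_iff
  proof
    fix m
    show "E (Suc m) \<subseteq> E m"
    proof
      fix \<omega> assume \<omega>: "\<omega> \<in> E (Suc m)"
      have "cmod (B (q ^ i * (1 + (q - 1) * real j / real (2 ^ m))) \<omega> - B (q ^ i) \<omega>) \<le> sqrt (q ^ i) * h"
        if "i < n" "j \<le> 2 ^ m" for i j
      proof -
        have "2 * j \<le> 2 ^ Suc m" using that by simp
        then have "cmod (B (q ^ i * (1 + (q - 1) * real (2 * j) / real (2 ^ Suc m))) \<omega> - B (q ^ i) \<omega>) \<le> sqrt (q ^ i) * h"
          using \<omega> that(1) unfolding E_def by blast
        then show ?thesis by simp
      qed
      with \<omega> show "\<omega> \<in> E m" unfolding E_def by blast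
    qed
  qed
  show thesis
  proof
    show "(\<Inter>m. E m) \<in> sets M" by measurable
    show "measure (cgauss 1) G0 * \<pi> ^ n \<le> prob (\<Inter>m. E m)"
    proof (rule prob_INT_decseq_ge[OF _ dec])
      show "measure (cgauss 1) G0 * \<pi> ^ n \<le> prob (E m)" for m
        unfolding E_def by (rule cbm_blocks_grid[OF cbm q _ h G \<pi>]) simp
    qed measurable
    fix \<omega> assume \<omega>: "\<omega> \<in> (\<Inter>m. E m)"
    then have sp: "\<omega> \<in> space M" by (auto simp: E_def)
    show "B 1 \<omega> \<in> G0" using \<omega> by (auto simp: E_def)
    fix i assume i: "i < n"
    show "(B (q ^ Suc i) \<omega> - B (q ^ i) \<omega>) / of_real (sqrt (q ^ i)) \<in> G"
      using \<omega> i by (auto simp: E_def)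
    fix s assume s: "q ^ i \<le> s" "s \<le> q ^ Suc i"
    have qi: "0 < q ^ i" using q by simp
    \<comment> \<open>The affine coordinate of \<open>s\<close> in its block, which puts the grid
      points at dyadic positions of [0, 1].\<close>
    define x where "x = (s / q ^ i - 1) / (q - 1)"
    have "s / q ^ i \<le> q" using s qi by (simp add: field_simps)
    moreover have "1 \<le> s / q ^ i" using s qi by (simp add: field_simps)
    ultimately have x: "x \<in> {0..1}" using q by (auto simp: x_def divide_le_eq)
    have sx: "s = q ^ i * (1 + (q - 1) * x)" using q qi by (simp add: x_def field_simps)
    have "B (q ^ i * (1 + (q - 1) * x)) \<omega> - B (q ^ i) \<omega> \<in> cball 0 (sqrt (q ^ i) * h)"
    proof (rule dyadic_closed[OF _ _ _ x, where l = 0])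
      show "continuous_on {0..1} (\<lambda>x. B (q ^ i * (1 + (q - 1) * x)) \<omega> - B (q ^ i) \<omega>)"
        by (intro continuous_intros continuous_on_compose2[OF cbm_continuous[OF cbm sp], of _ "\<lambda>x. q ^ i * (1 + (q - 1) * x)"])
          (use q in \<open>auto intro!: mult_nonneg_nonneg add_nonneg_nonneg\<close>)
      fix m j :: nat assume "j \<le> 2 ^ m"
      then have "cmod (B (q ^ i * (1 + (q - 1) * real j / real (2 ^ m))) \<omega> - B (q ^ i) \<omega>) \<le> sqrt (q ^ i) * h"
        using \<omega> i by (auto simp: E_def)
      then show "B (q ^ i * (1 + (q - 1) * (real j / 2 ^ m))) \<omega> - B (q ^ i) \<omega> \<in> cball 0 (sqrt (q ^ i) * h)" by simp
    qed simp
    then show "cmod (B s \<omega> - B (q ^ i) \<omega>) \<le> sqrt (q ^ i) * h" by (simp add: sx)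
  qed
qed

section \<open>Confining and expelling an Ornstein-Uhlenbeck process\<close>

lemma power_interval_exists:
  fixes q :: real
  assumes "1 \<le> s" "s \<le> q ^ n" "1 \<le> n"
  shows "\<exists>i<n. q ^ i \<le> s \<and> s \<le> q ^ Suc i"
  using assms
proof (induction n)
  case (Suc n)
  show ?case
  proof (cases "1 \<le> n \<and> s \<le> q ^ n")
    case True
    then show ?thesis using Suc by (auto intro: less_SucI)
  next
    case False
    then have "q ^ n \<le> s" using Suc.prems by (cases n) auto
    then show ?thesis using Suc.prems by blast
  qed
qed simp

lemma exp_neg_half: "exp (- t / 2) = 1 / sqrt (exp t)" for t :: real
proof -
  have "(exp (t / 2))\<^sup>2 = exp t" by (simp flip: exp_double)
  then have "sqrt (exp t) = exp (t / 2)" by (intro real_sqrt_unique) auto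
  moreover have "exp (- t / 2) = inverse (exp (t / 2))"
    unfolding exp_minus[symmetric] by simp
  ultimately show ?thesis by (simp only: inverse_eq_divide)
qed

text \<open>The time change s = exp t maps [0, T] into [1, b], where it remains to control the
  Brownian path divided by sqrt s.\<close>

lemma ou_prob_ge_of_cbm:
  assumes ou: "complex_ou_process M Z" and G: "open G" and T: "exp T \<le> b"
    and cbm: "\<And>(N :: (real \<Rightarrow> complex) measure) B. complex_brownian_motion N B \<Longrightarrow>
      \<exists>E\<in>sets N. a \<le> measure N E \<and> (\<forall>\<omega>\<in>E. \<forall>s. 1 \<le> s \<longrightarrow> s \<le> b \<longrightarrow> B s \<omega> / of_real (sqrt s) \<in> G)"
  shows "a \<le> measure M {\<omega>\<in>space M. \<forall>t\<in>{0..T}. Z t \<omega> \<in> G}"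
proof -
  obtain N :: "(real \<Rightarrow> complex) measure" and B where B: "complex_brownian_motion N B"
    and transfer: "\<And>G T. open G \<Longrightarrow> measure M {\<omega>\<in>space M. \<forall>t\<in>{0..T}. Z t \<omega> \<in> G}
       = measure N {\<omega>\<in>space N. \<forall>t\<in>{0..T}. of_real (exp (- t / 2)) * B (exp t) \<omega> \<in> G}"
    and ev: "\<And>G T. open G \<Longrightarrow>
      {\<omega>\<in>space N. \<forall>t\<in>{0..T}. of_real (exp (- t / 2)) * B (exp t) \<omega> \<in> G} \<in> sets N"
    by (rule ou_transfer[OF ou], rule that) blast+
  interpret N: prob_space N using B by (rule cbm_prob_space)
  obtain E where E: "E \<in> sets N" "a \<le> measure N E"
    "\<And>\<omega> s. \<omega> \<in> E \<Longrightarrow> 1 \<le> s \<Longrightarrow> s \<le> b \<Longrightarrow> B s \<omega> / of_real (sqrt s) \<in> G"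
    using cbm[OF B] by blast
  have c: "of_real (exp (- t / 2)) * B (exp t) \<omega> = B (exp t) \<omega> / of_real (sqrt (exp t))" for t \<omega>
    unfolding exp_neg_half by simp
  from ev[OF G] have "measure N E \<le> measure N {\<omega>\<in>space N. \<forall>t\<in>{0..T}. of_real (exp (- t / 2)) * B (exp t) \<omega> \<in> G}"
  proof (rule N.finite_measure_mono[rotated])
    show "E \<subseteq> {\<omega>\<in>space N. \<forall>t\<in>{0..T}. of_real (exp (- t / 2)) * B (exp t) \<omega> \<in> G}"
    proof (intro subsetI CollectI conjI ballI)
      fix \<omega> t assume \<omega>: "\<omega> \<in> E" and t: "t \<in> {0..T}"
      have "exp t \<le> exp T" using t by simp
      then have "exp t \<le> b" using T by linarith
      then show "of_real (exp (- t / 2)) * B (exp t) \<omega> \<in> G"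
        unfolding c using t by (intro E(3)[OF \<omega>]) auto
    qed (use sets.sets_into_space[OF E(1)] in auto)
  qed
  with E(2) transfer[OF G] show ?thesis by simp
qed

text \<open>The invariant at the times 2^i is |B (2^i)| \<le> sqrt (2^i) r / 2. Within a block the
  path moves by at most sqrt (2^i) r / 8, and r / 2 + r / 8 = (5/4) r / 2 \<le> sqrt 2 r / 2, so the
  growing normalisation restores the invariant. The 512 is 8 times 8^2, from the maximal inequality
  with height r / 8.\<close>

lemma ou_confine:
  assumes ou: "complex_ou_process M Z" and G: "open G" "cball 0 r \<subseteq> G" and r: "0 < r"
    and e: "4 * exp (- r\<^sup>2 / 512) \<le> 1" and n: "1 \<le> n" "exp T \<le> 2 ^ n"
  shows "(1 - 4 * exp (- r\<^sup>2 / 512)) ^ Suc n \<le> measure M {\<omega>\<in>space M. \<forall>t\<in>{0..T}. Z t \<omega> \<in> G}"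
proof (rule ou_prob_ge_of_cbm[OF ou G(1) n(2)])
  fix N :: "(real \<Rightarrow> complex) measure" and B assume cbm: "complex_brownian_motion N B"
  let ?e = "4 * exp (- r\<^sup>2 / 512)"
  interpret N: prob_space N using cbm by (rule cbm_prob_space)
  interpret C1: prob_space "cgauss 1" by (rule prob_space_cgauss)
  have U: "measure (cgauss 1) UNIV = 1" using C1.prob_space by simp
  obtain E where E: "E \<in> sets N" "measure (cgauss 1) (cball 0 (r / 2)) * (1 - ?e) ^ n \<le> measure N E"
    "\<And>\<omega>. \<omega> \<in> E \<Longrightarrow> B 1 \<omega> \<in> cball 0 (r / 2)"
    "\<And>\<omega> i s. \<omega> \<in> E \<Longrightarrow> i < n \<Longrightarrow> 2 ^ i \<le> s \<Longrightarrow> s \<le> 2 ^ Suc i \<Longrightarrow>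
      cmod (B s \<omega> - B (2 ^ i) \<omega>) \<le> sqrt (2 ^ i) * (r / 8)"
    \<comment> \<open>With \<open>UNIV\<close> nothing is demanded of the final displacement of a
      block; the oscillation bound alone counts.\<close>
    by (rule cbm_blocks[OF cbm, of 2 "r / 8" "cball 0 (r / 2)" UNIV "1 - ?e" n])
      (use e r U in \<open>auto simp: power_divide\<close>)
  \<comment> \<open>The factor for the position at time 1; it is the reason for \<open>Suc n\<close>
    in the exponent.\<close>
  have "1 - ?e \<le> measure (cgauss 1) (cball 0 (r / 2))"
  proof -
    have "UNIV - cball 0 (r / 2) \<subseteq> {x. r / 2 \<le> cmod x}" by auto
    then have "measure (cgauss 1) (UNIV - cball 0 (r / 2)) \<le> measure (cgauss 1) {x. r / 2 \<le> cmod x}"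
      by (rule C1.finite_measure_mono) auto
    also have "\<dots> \<le> 2 * exp (- (r / 2)\<^sup>2 / (2 * 1))" by (rule cgauss_tail) (use r in auto)
    also have "\<dots> \<le> 2 * exp (- r\<^sup>2 / 512)" using r by (simp add: power_divide)
    also have "\<dots> \<le> ?e" by simp
    finally have "measure (cgauss 1) (UNIV - cball 0 (r / 2)) \<le> ?e" .
    moreover have "measure (cgauss 1) (UNIV - cball 0 (r / 2)) = 1 - measure (cgauss 1) (cball 0 (r / 2))"
      using C1.prob_compl[of "cball 0 (r / 2)"] by simp
    ultimately show ?thesis by simp
  qed
  then have "(1 - ?e) * (1 - ?e) ^ n \<le> measure (cgauss 1) (cball 0 (r / 2)) * (1 - ?e) ^ n"
    using e by (intro mult_right_mono) auto
  with E(2) have "(1 - ?e) ^ Suc n \<le> measure N E" by simp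
  moreover have "B s \<omega> / of_real (sqrt s) \<in> G" if \<omega>: "\<omega> \<in> E" and s: "1 \<le> s" "s \<le> 2 ^ n" for \<omega> s
  proof -
    have grid: "i \<le> n \<Longrightarrow> cmod (B (2 ^ i) \<omega>) \<le> sqrt (2 ^ i) * (r / 2)" for i
    proof (induction i)
      case 0
      then show ?case using E(3)[OF \<omega>] by simp
    next
      case (Suc i)
      have "(5 / 4)\<^sup>2 \<le> (2::real)" by (simp add: power2_eq_square)
      then have 54: "5 / 4 \<le> sqrt 2" by (rule real_le_rsqrt)
      have "cmod (B (2 ^ Suc i) \<omega>) \<le> cmod (B (2 ^ i) \<omega>) + cmod (B (2 ^ Suc i) \<omega> - B (2 ^ i) \<omega>)"
        by (rule norm_triangle_sub)
      also have "\<dots> \<le> sqrt (2 ^ i) * (r / 2) + sqrt (2 ^ i) * (r / 8)"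
        by (intro add_mono Suc.IH E(4)[OF \<omega>]) (use Suc.prems in auto)
      also have "\<dots> = sqrt (2 ^ i) * (5 / 4) * (r / 2)" by (simp add: field_simps)
      also have "\<dots> \<le> sqrt (2 ^ i) * sqrt 2 * (r / 2)"
        using r 54 by (intro mult_right_mono mult_left_mono) auto
      also have "\<dots> = sqrt (2 ^ Suc i) * (r / 2)" by (simp add: real_sqrt_mult mult.commute)
      finally show ?case .
    qed
    obtain i where i: "i < n" "2 ^ i \<le> s" "s \<le> 2 ^ Suc i"
      using power_interval_exists[OF s n(1)] by blast
    have "cmod (B s \<omega>) \<le> cmod (B (2 ^ i) \<omega>) + cmod (B s \<omega> - B (2 ^ i) \<omega>)"
      by (rule norm_triangle_sub)
    also have "\<dots> \<le> sqrt (2 ^ i) * (r / 2) + sqrt (2 ^ i) * (r / 8)"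
      by (intro add_mono grid E(4)[OF \<omega>]) (use i in auto)
    also have "\<dots> \<le> sqrt (2 ^ i) * r" using r by (simp add: field_simps)
    also have "\<dots> \<le> sqrt s * r" using r i by (intro mult_right_mono) auto
    finally have "cmod (B s \<omega> / of_real (sqrt s)) \<le> r"
      using s by (simp add: norm_divide divide_le_eq mult.commute)
    then show ?thesis using G(2) by auto
  qed
  ultimately show "\<exists>E\<in>sets N. (1 - ?e) ^ Suc n \<le> measure N E \<and>
      (\<forall>\<omega>\<in>E. \<forall>s. 1 \<le> s \<longrightarrow> s \<le> 2 ^ n \<longrightarrow> B s \<omega> / of_real (sqrt s) \<in> G)"
    using E(1) by blast
qed

lemma cgauss_halfplane_pos:
  assumes "0 < v"
  shows "0 < measure (cgauss v) {x. a \<le> Re x}"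
proof -
  interpret prob_space "cgauss v" by (rule prob_space_cgauss)
  let ?z = "of_real (- (\<bar>a\<bar> + 1)) :: complex"
  obtain \<eta> where \<eta>: "0 < \<eta>" "\<And>z. cmod z \<le> \<bar>a\<bar> + 1 \<Longrightarrow>
      \<eta> \<le> measure (cgauss v) {x. \<bar>Re z + Re x\<bar> \<le> 1 \<and> \<bar>Im z + Im x\<bar> \<le> 1}"
    using cgauss_square_pos[of 1 "\<bar>a\<bar> + 1" v] assms by auto
  have "cmod ?z \<le> \<bar>a\<bar> + 1" by (simp only: norm_of_real)
  note \<eta>(1)
  also have "\<eta> \<le> measure (cgauss v) {x. \<bar>Re ?z + Re x\<bar> \<le> 1 \<and> \<bar>Im ?z + Im x\<bar> \<le> 1}"
    by (rule \<eta>(2)) fact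
  also have "\<dots> \<le> measure (cgauss v) {x. a \<le> Re x}"
    by (rule finite_measure_mono) (auto simp: abs_le_iff)
  finally show ?thesis .
qed

lemma cgauss_halfplane_scale:
  assumes "0 < v"
  shows "measure (cgauss v) {x. sqrt v * a \<le> Re x} = measure (cgauss 1) {x. a \<le> Re x}"
proof -
  have m: "(\<lambda>x. of_real (sqrt v) * x) \<in> borel_measurable (cgauss 1)" by measurable
  have "cgauss v = distr (cgauss 1) borel (\<lambda>x. of_real (sqrt v) * x)"
    using cgauss_scale[of "sqrt v" 1] assms by simp
  then show ?thesis
    using assms by (simp only:) (subst measure_distr[OF m]; auto intro!: arg_cong[where f="measure _"])
qed

text \<open>Only the real part is steered. The invariant is Re (B (q^i)) \<ge> 2 \<rho> sqrt (q^i)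
  with q = 1 + 1 / \<rho>^2. A block has variance q^i / \<rho>^2, and an increment of sqrt (q^i) /
  \<rho> covers what the new normalisation takes away, since sqrt q \<le> 1 + 1 / (2 \<rho>^2). By
  scaling, its probability is the same for all \<rho>, so \<open>p\<close> is universal;
  \<open>\<pi>0\<close> depends on \<rho> but not on the time.\<close>

lemma ou_push_out:
  "\<exists>\<rho>0 p :: real. 1 \<le> \<rho>0 \<and> 0 < p \<and> p < 1 \<and> (\<forall>\<rho>\<ge>\<rho>0. \<exists>\<pi>0>0. \<forall>(M :: 'w measure) Z G n T.
      complex_ou_process M Z \<longrightarrow> open G \<longrightarrow> {z. \<rho> \<le> cmod z} \<subseteq> G \<longrightarrow> 1 \<le> n \<longrightarrow> exp T \<le> (1 + 1 / \<rho>\<^sup>2) ^ n \<longrightarrow>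
      \<pi>0 * p ^ n \<le> measure M {\<omega>\<in>space M. \<forall>t\<in>{0..T}. Z t \<omega> \<in> G})"
proof -
  define p1 where "p1 = measure (cgauss 1) {x. 1 \<le> Re x}"
  interpret C1: prob_space "cgauss 1" by (rule prob_space_cgauss)
  have p1: "0 < p1" "p1 \<le> 1" unfolding p1_def by (auto intro: cgauss_halfplane_pos)
  \<comment> \<open>Beyond this threshold the oscillation bound 4 exp (- \<rho>^4 / 32) is at most
    128 / \<rho>, hence at most half of \<open>p1\<close>.\<close>
  define \<rho>0 where "\<rho>0 = 256 / p1"
  have \<rho>0: "1 \<le> \<rho>0" using p1 by (simp add: \<rho>0_def)
  show ?thesis
  proof (rule exI[of _ \<rho>0], rule exI[of _ "p1 / 2"], intro conjI allI impI)
    show "1 \<le> \<rho>0" by (rule \<rho>0)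
    show "0 < p1 / 2" "p1 / 2 < 1" using p1 by auto
    fix \<rho> assume "\<rho>0 \<le> \<rho>"
    then have \<rho>: "1 \<le> \<rho>" "256 / p1 \<le> \<rho>" using \<rho>0 by (auto simp: \<rho>0_def)
    let ?q = "1 + 1 / \<rho>\<^sup>2" and ?G = "{x. 1 / \<rho> \<le> Re x}" and ?H = "{x. 2 * \<rho> \<le> Re x}"
    define \<pi>0 where "\<pi>0 = measure (cgauss 1) ?H"
    have small: "4 * exp (- (\<rho> / 2)\<^sup>2 / (8 * (?q - 1))) \<le> p1 / 2"
    proof -
      have "- (\<rho> / 2)\<^sup>2 / (8 * (?q - 1)) = - (\<rho> ^ 4 / 32)"
        using \<rho> by (simp add: power_divide power2_eq_square power4_eq_xxxx)
      then have "4 * exp (- (\<rho> / 2)\<^sup>2 / (8 * (?q - 1))) = 4 / exp (\<rho> ^ 4 / 32)"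
        by (simp only: exp_minus inverse_eq_divide times_divide_eq_right mult_1_right)
      also have "\<dots> \<le> 4 / (\<rho> / 32)"
      proof (rule divide_left_mono)
        have "\<rho> ^ 1 \<le> \<rho> ^ 4" using \<rho> by (intro power_increasing) auto
        then have "\<rho> / 32 \<le> \<rho> ^ 4 / 32" by simp
        also have "\<dots> \<le> exp (\<rho> ^ 4 / 32)" using exp_ge_add_one_self[of "\<rho> ^ 4 / 32"] by linarith
        finally show "\<rho> / 32 \<le> exp (\<rho> ^ 4 / 32)" .
      qed (use \<rho> in auto)
      also have "\<dots> \<le> p1 / 2" using \<rho> p1 by (simp add: field_simps)
      finally show ?thesis .
    qed
    have meas: "measure (cgauss (?q - 1)) ?G = p1"
      using cgauss_halfplane_scale[of "1 / \<rho>\<^sup>2" 1] \<rho> by (simp add: real_sqrt_divide p1_def)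
    have q: "1 < ?q" using \<rho> by simp
    have q2: "?q \<le> 2" using \<rho> by simp
    show "\<exists>\<pi>0>0. \<forall>(M :: 'w measure) Z G n T.
      complex_ou_process M Z \<longrightarrow> open G \<longrightarrow> {z. \<rho> \<le> cmod z} \<subseteq> G \<longrightarrow> 1 \<le> n \<longrightarrow> exp T \<le> (1 + 1 / \<rho>\<^sup>2) ^ n \<longrightarrow>
      \<pi>0 * (p1 / 2) ^ n \<le> measure M {\<omega>\<in>space M. \<forall>t\<in>{0..T}. Z t \<omega> \<in> G}"
    proof (intro exI[of _ \<pi>0] conjI allI impI)
      show "0 < \<pi>0" unfolding \<pi>0_def by (rule cgauss_halfplane_pos) simp
      fix M :: "'w measure" and Z G n T
      assume ou: "complex_ou_process M Z" and G: "open G" "{z. \<rho> \<le> cmod z} \<subseteq> G"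
        and n: "1 \<le> n" "exp T \<le> ?q ^ n"
      show "\<pi>0 * (p1 / 2) ^ n \<le> measure M {\<omega>\<in>space M. \<forall>t\<in>{0..T}. Z t \<omega> \<in> G}"
      proof (rule ou_prob_ge_of_cbm[OF ou G(1) n(2)])
        fix N :: "(real \<Rightarrow> complex) measure" and B assume cbm: "complex_brownian_motion N B"
        obtain E where E: "E \<in> sets N" "measure (cgauss 1) ?H * (p1 / 2) ^ n \<le> measure N E"
          "\<And>\<omega>. \<omega> \<in> E \<Longrightarrow> B 1 \<omega> \<in> ?H"
          "\<And>\<omega> i. \<omega> \<in> E \<Longrightarrow> i < n \<Longrightarrow> (B (?q ^ Suc i) \<omega> - B (?q ^ i) \<omega>) / of_real (sqrt (?q ^ i)) \<in> ?G"
          "\<And>\<omega> i s. \<omega> \<in> E \<Longrightarrow> i < n \<Longrightarrow> ?q ^ i \<le> s \<Longrightarrow> s \<le> ?q ^ Suc i \<Longrightarrow>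
            cmod (B s \<omega> - B (?q ^ i) \<omega>) \<le> sqrt (?q ^ i) * (\<rho> / 2)"
        proof (rule cbm_blocks[OF cbm q, of "\<rho> / 2" ?H ?G "p1 / 2" n])
          show "p1 / 2 \<le> measure (cgauss (?q - 1)) ?G - 4 * exp (- (\<rho> / 2)\<^sup>2 / (8 * (?q - 1)))"
            unfolding meas using small by linarith
        qed (use \<rho> p1 in auto)
        have "B s \<omega> / of_real (sqrt s) \<in> G" if \<omega>: "\<omega> \<in> E" and s: "1 \<le> s" "s \<le> ?q ^ n" for \<omega> s
        proof -
          have qi': "0 < ?q ^ i" for i
            by (rule zero_less_power) (use q in linarith)
          then have qi: "0 < sqrt (?q ^ i)" for i by (simp only: real_sqrt_gt_0_iff)
          have grid: "i \<le> n \<Longrightarrow> sqrt (?q ^ i) * (2 * \<rho>) \<le> Re (B (?q ^ i) \<omega>)" for i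
          proof (induction i)
            case 0
            then show ?case using E(3)[OF \<omega>] by simp
          next
            case (Suc i)
            have "1 / \<rho> \<le> Re ((B (?q ^ Suc i) \<omega> - B (?q ^ i) \<omega>) / of_real (sqrt (?q ^ i)))"
              using E(4)[OF \<omega>, of i] Suc.prems by simp
            then have "1 / \<rho> \<le> (Re (B (?q ^ Suc i) \<omega>) - Re (B (?q ^ i) \<omega>)) / sqrt (?q ^ i)"
              by (simp only: Re_divide_of_real minus_complex.sel)
            then have "1 / \<rho> * sqrt (?q ^ i) \<le> Re (B (?q ^ Suc i) \<omega>) - Re (B (?q ^ i) \<omega>)"
              using qi[of i] by (simp only: pos_le_divide_eq)
            with Suc have "sqrt (?q ^ i) * (2 * \<rho> + 1 / \<rho>) \<le> Re (B (?q ^ Suc i) \<omega>)"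
              by (simp add: algebra_simps)
            moreover have "sqrt ?q * (2 * \<rho>) \<le> 2 * \<rho> + 1 / \<rho>"
            proof -
              have "?q \<le> (1 + 1 / (2 * \<rho>\<^sup>2))\<^sup>2" by (simp add: power2_sum)
              then have "sqrt ?q \<le> 1 + 1 / (2 * \<rho>\<^sup>2)" by (intro real_le_lsqrt) auto
              then have "sqrt ?q * (2 * \<rho>) \<le> (1 + 1 / (2 * \<rho>\<^sup>2)) * (2 * \<rho>)"
                using \<rho> by (intro mult_right_mono) auto
              also have "\<dots> = 2 * \<rho> + 1 / \<rho>" using \<rho> by (simp add: field_simps power2_eq_square)
              finally show ?thesis .
            qed
            then have "sqrt (?q ^ i) * (sqrt ?q * (2 * \<rho>)) \<le> sqrt (?q ^ i) * (2 * \<rho> + 1 / \<rho>)"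
              using qi[of i] by (intro mult_left_mono) auto
            moreover have "sqrt (?q ^ Suc i) * (2 * \<rho>) = sqrt (?q ^ i) * (sqrt ?q * (2 * \<rho>))"
              by (simp only: power_Suc real_sqrt_mult mult.assoc mult.left_commute)
            ultimately show ?case by linarith
          qed
          obtain i where i: "i < n" "?q ^ i \<le> s" "s \<le> ?q ^ Suc i"
            using power_interval_exists[OF s n(1)] by blast
          have "\<bar>Re (B s \<omega> - B (?q ^ i) \<omega>)\<bar> \<le> sqrt (?q ^ i) * (\<rho> / 2)"
            using abs_Re_le_cmod E(5)[OF \<omega> i] by (rule order_trans)
          then have "sqrt (?q ^ i) * (2 * \<rho>) - sqrt (?q ^ i) * (\<rho> / 2) \<le> Re (B s \<omega>)"
            using grid[OF less_imp_le[OF i(1)]] unfolding minus_complex.sel by linarith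
          moreover have "sqrt (?q ^ i) * (2 * \<rho>) - sqrt (?q ^ i) * (\<rho> / 2) = sqrt (?q ^ i) * (3 / 2) * \<rho>"
            by (simp add: algebra_simps)
          \<comment> \<open>The real part keeps 2 \<rho> - \<rho> / 2 = 3 \<rho> / 2 times sqrt
            (q^i) inside the block, and q \<le> 2 \<le> (3/2)^2 limits the growth of sqrt s to the
            same factor 3/2.\<close>
          moreover have "sqrt s \<le> sqrt (?q ^ i) * (3 / 2)"
          proof -
            have "s \<le> ?q ^ i * ?q" using i by (simp add: mult.commute)
            also have "\<dots> \<le> ?q ^ i * 2" by (rule mult_left_mono[OF q2 less_imp_le[OF qi']])
            also have "\<dots> \<le> ?q ^ i * (3 / 2)\<^sup>2"
              by (rule mult_left_mono[OF _ less_imp_le[OF qi']]) (simp add: power2_eq_square)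
            finally have "sqrt s \<le> sqrt (?q ^ i * (3 / 2)\<^sup>2)" by simp
            then show ?thesis by (simp only: real_sqrt_mult real_sqrt_abs)
          qed
          then have "sqrt s * \<rho> \<le> sqrt (?q ^ i) * (3 / 2) * \<rho>" using \<rho> by (intro mult_right_mono) auto
          ultimately have "sqrt s * \<rho> \<le> cmod (B s \<omega>)"
            using complex_Re_le_cmod[of "B s \<omega>"] by linarith
          then have "\<rho> \<le> cmod (B s \<omega> / of_real (sqrt s))"
            using s by (simp add: norm_divide le_divide_eq mult.commute)
          then show ?thesis using G(2) by auto
        qed
        then show "\<exists>E\<in>sets N. \<pi>0 * (p1 / 2) ^ n \<le> measure N E \<and>
            (\<forall>\<omega>\<in>E. \<forall>s. 1 \<le> s \<longrightarrow> s \<le> ?q ^ n \<longrightarrow> B s \<omega> / of_real (sqrt s) \<in> G)"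
          using E(1,2) unfolding \<pi>0_def by blast
      qed
    qed
  qed
qed

section \<open>Hole rates of the lattice models\<close>

text \<open>One rate for all r \<ge> r0. For r \<ge> 2 it suffices that \<kappa> \<le> 1/12; for r0
  \<le> r < 2 the event is contained in the one for \<open>r0\<close>, and \<kappa> r^2 \<le> 4
  \<kappa> \<le> - ln \<theta>.\<close>

lemma cbm_avoid_decay:
  assumes r0: "0 < r0"
  shows "\<exists>C \<kappa> :: real. 1 \<le> C \<and> 0 < \<kappa> \<and>
    (\<forall>r (M :: 'w measure) B n. r0 \<le> r \<longrightarrow> complex_brownian_motion M B \<longrightarrow>
      measure M {\<omega>\<in>space M. \<forall>i\<le>n. r < cmod (B (2 ^ i) \<omega> / of_real (sqrt (2 ^ i)))} \<le> C * exp (- \<kappa> * r\<^sup>2) ^ n)"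
proof -
  obtain C \<theta> :: real where C: "0 < C" "0 < \<theta>" "\<theta> < 1"
    and small: "\<forall>(M :: 'w measure) B n. complex_brownian_motion M B \<longrightarrow>
      measure M {\<omega>\<in>space M. \<forall>i\<le>n. r0 < cmod (B (2 ^ i) \<omega> / of_real (sqrt (2 ^ i)))} \<le> C * \<theta> ^ n"
    using cbm_avoid_decay_small[OF r0] by (elim exE conjE) (rule that)
  define \<kappa> where "\<kappa> = min (1 / 12) (- ln \<theta> / 4)"
  have \<kappa>: "0 < \<kappa>" "\<kappa> \<le> 1 / 12" "\<kappa> \<le> - ln \<theta> / 4" using C by (auto simp: \<kappa>_def)
  show ?thesis
  proof (rule exI[of _ "max C 2"], rule exI[of _ \<kappa>], intro conjI allI impI)
    show "1 \<le> max C 2" "0 < \<kappa>" using \<kappa> by auto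
    fix r n and M :: "'w measure" and B
    assume r: "r0 \<le> r" and cbm: "complex_brownian_motion M B"
    interpret prob_space M using cbm by (rule cbm_prob_space)
    have [measurable]: "B (2 ^ i) \<in> borel_measurable M" for i by (rule cbm_measurable[OF cbm]) simp
    let ?E = "\<lambda>r. {\<omega>\<in>space M. \<forall>i\<le>n. r < cmod (B (2 ^ i) \<omega> / of_real (sqrt (2 ^ i)))}"
    show "prob (?E r) \<le> max C 2 * exp (- \<kappa> * r\<^sup>2) ^ n"
    proof (cases "2 \<le> r")
      case True
      have "prob (?E r) \<le> 2 * exp (- r\<^sup>2 / 12) ^ n" by (rule cbm_avoid_decay_large[OF cbm True])
      also have "\<dots> \<le> max C 2 * exp (- \<kappa> * r\<^sup>2) ^ n"
      proof (intro mult_mono power_mono)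
        show "exp (- r\<^sup>2 / 12) \<le> exp (- \<kappa> * r\<^sup>2)"
          using mult_right_mono[OF \<kappa>(2), of "r\<^sup>2"] by simp
      qed auto
      finally show ?thesis .
    next
      case False
      have "prob (?E r) \<le> prob (?E r0)"
        using r by (intro finite_measure_mono) (auto intro: le_less_trans)
      also have "\<dots> \<le> C * \<theta> ^ n" using small cbm by simp
      also have "\<dots> \<le> max C 2 * exp (- \<kappa> * r\<^sup>2) ^ n"
      proof (intro mult_mono power_mono)
        have "r\<^sup>2 \<le> 2\<^sup>2" using False r r0 by (intro power_mono) auto
        then have "\<kappa> * r\<^sup>2 \<le> \<kappa> * 4" using \<kappa> by (intro mult_left_mono) auto
        also have "\<dots> \<le> - ln \<theta>" using \<kappa> by simp
        finally have "exp (ln \<theta>) \<le> exp (- \<kappa> * r\<^sup>2)" by simp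
        then show "\<theta> \<le> exp (- \<kappa> * r\<^sup>2)" using C by simp
      qed (use C in auto)
      finally show ?thesis .
    qed
  qed
qed

lemma ou_avoid_prob_le:
  assumes ou: "complex_ou_process M Z" and G: "open G" "\<And>z. z \<in> G \<Longrightarrow> r < cmod z" and T: "real n * ln 2 \<le> T"
    and decay: "\<And>(N :: (real \<Rightarrow> complex) measure) B. complex_brownian_motion N B \<Longrightarrow>
      measure N {\<omega>\<in>space N. \<forall>i\<le>n. r < cmod (B (2 ^ i) \<omega> / of_real (sqrt (2 ^ i)))} \<le> b"
  shows "measure M {\<omega>\<in>space M. \<forall>t\<in>{0..T}. Z t \<omega> \<in> G} \<le> b"
proof -
  obtain N :: "(real \<Rightarrow> complex) measure" and B where B: "complex_brownian_motion N B"
    and transfer: "\<And>G T. open G \<Longrightarrow> measure M {\<omega>\<in>space M. \<forall>t\<in>{0..T}. Z t \<omega> \<in> G}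
       = measure N {\<omega>\<in>space N. \<forall>t\<in>{0..T}. of_real (exp (- t / 2)) * B (exp t) \<omega> \<in> G}"
    by (rule ou_transfer[OF ou], rule that) blast+
  interpret N: prob_space N using B by (rule cbm_prob_space)
  have [measurable]: "B (2 ^ i) \<in> borel_measurable N" for i by (rule cbm_measurable[OF B]) simp
  have "measure N {\<omega>\<in>space N. \<forall>t\<in>{0..T}. of_real (exp (- t / 2)) * B (exp t) \<omega> \<in> G}
      \<le> measure N {\<omega>\<in>space N. \<forall>i\<le>n. r < cmod (B (2 ^ i) \<omega> / of_real (sqrt (2 ^ i)))}"
  proof (rule N.finite_measure_mono)
    show "{\<omega>\<in>space N. \<forall>t\<in>{0..T}. of_real (exp (- t / 2)) * B (exp t) \<omega> \<in> G}
      \<subseteq> {\<omega>\<in>space N. \<forall>i\<le>n. r < cmod (B (2 ^ i) \<omega> / of_real (sqrt (2 ^ i)))}"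
    proof (intro subsetI CollectI conjI allI impI)
      fix \<omega> i assume \<omega>: "\<omega> \<in> {\<omega>\<in>space N. \<forall>t\<in>{0..T}. of_real (exp (- t / 2)) * B (exp t) \<omega> \<in> G}" and i: "i \<le> n"
      have "real i * ln 2 \<le> real n * ln 2" using i by (intro mult_right_mono) auto
      also note T
      finally have "real i * ln 2 \<in> {0..T}" by simp
      then have "r < cmod (of_real (exp (- (real i * ln 2) / 2)) * B (exp (real i * ln 2)) \<omega>)"
        using \<omega> G(2) by blast
      moreover have "exp (real i * ln 2) = (2::real) ^ i" by (simp add: exp_of_nat_mult)
      ultimately show "r < cmod (B (2 ^ i) \<omega> / of_real (sqrt (2 ^ i)))"
        unfolding exp_neg_half by simp
    qed auto
  qed measurable
  also have "\<dots> \<le> b" by (rule decay[OF B])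
  finally show ?thesis using transfer[OF G(1)] by simp
qed

section \<open>From probability bounds to exponential rates\<close>

lemma log_prob_le: "0 \<le> p \<Longrightarrow> p \<le> exp x \<Longrightarrow> log_prob p \<le> ereal x"
  unfolding log_prob_def using ln_mono[of p "exp x"] by auto

lemma log_prob_ge: "exp x \<le> p \<Longrightarrow> ereal x \<le> log_prob p"
proof -
  assume *: "exp x \<le> p"
  then have "0 < p" using exp_gt_zero[of x] by linarith
  then show ?thesis using * unfolding log_prob_def by (simp add: ln_ge_iff)
qed

lemma tendsto_ereal_add_inverse: "((\<lambda>T. ereal (a + b / T)) \<longlongrightarrow> ereal a) at_top"
proof -
  have "((\<lambda>T. a + b / T) \<longlongrightarrow> a + 0) (at_top :: real filter)"
    by (intro tendsto_intros tendsto_divide_0[OF tendsto_const] filterlim_at_top_imp_at_infinity filterlim_ident)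
  then show ?thesis by (intro tendsto_intros) simp
qed

text \<open>The constant \<open>b\<close> may be large and depend on \<open>R\<close>; it disappears
  after division by T.\<close>

lemma Limsup_hole_rate_le:
  assumes "\<And>T. 1 \<le> T \<Longrightarrow> measure M (hole_event M P T R) \<le> exp (a * T + b)"
  shows "Limsup at_top (hole_rate M P R) \<le> ereal a"
proof -
  have "hole_rate M P R T \<le> ereal (a + b / T)" if "1 \<le> T" for T
  proof -
    have "hole_rate M P R T \<le> ereal (1 / T) * ereal (a * T + b)"
      unfolding hole_rate_def using assms[OF that] that
      by (intro ereal_mult_left_mono log_prob_le) auto
    also have "\<dots> = ereal (a + b / T)" using that by (simp add: field_simps)
    finally show ?thesis .
  qed
  then have "eventually (\<lambda>T. hole_rate M P R T \<le> ereal (a + b / T)) at_top"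
    by (auto simp: eventually_at_top_linorder)
  then have "Limsup at_top (hole_rate M P R) \<le> Limsup at_top (\<lambda>T. ereal (a + b / T))"
    by (rule Limsup_mono)
  also have "\<dots> = ereal a"
    by (rule lim_imp_Limsup[OF _ tendsto_ereal_add_inverse]) simp
  finally show ?thesis .
qed

lemma Liminf_hole_rate_ge:
  assumes "\<And>T. 1 \<le> T \<Longrightarrow> exp (a * T + b) \<le> measure M (hole_event M P T R)"
  shows "ereal a \<le> Liminf at_top (hole_rate M P R)"
proof -
  have "ereal (a + b / T) \<le> hole_rate M P R T" if "1 \<le> T" for T
  proof -
    have "ereal (a + b / T) = ereal (1 / T) * ereal (a * T + b)" using that by (simp add: field_simps)
    also have "\<dots> \<le> hole_rate M P R T"
      unfolding hole_rate_def using assms[OF that] that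
      by (intro ereal_mult_left_mono log_prob_ge) auto
    finally show ?thesis .
  qed
  then have "eventually (\<lambda>T. ereal (a + b / T) \<le> hole_rate M P R T) at_top"
    by (auto simp: eventually_at_top_linorder)
  then have "Liminf at_top (\<lambda>T. ereal (a + b / T)) \<le> Liminf at_top (hole_rate M P R)"
    by (rule Liminf_mono)
  moreover have "Liminf at_top (\<lambda>T. ereal (a + b / T)) = ereal a"
    by (rule lim_imp_Liminf[OF _ tendsto_ereal_add_inverse]) simp
  ultimately show ?thesis by simp
qed

lemma cmod_site_sq: "(cmod (site s p))\<^sup>2 = s\<^sup>2 * ((real_of_int (fst p))\<^sup>2 + (real_of_int (snd p))\<^sup>2)"
proof -
  have "of_int (fst p) + \<i> * of_int (snd p) = Complex (of_int (fst p)) (of_int (snd p))"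
    by (simp add: complex_eq_iff)
  then show ?thesis
    by (simp add: site_def norm_mult power_mult_distrib cmod_power2)
qed

lemma cluster_lattice_upper:
  assumes c: "0 < c" and s: "s\<^sup>2 \<le> 12" and U: "finite U" "U \<noteq> {}" "\<And>u. u \<in> U \<Longrightarrow> cmod u = 1"
  shows "\<exists>c1>0. \<forall>(M :: 'w measure) \<zeta> R. iid_ou_family M \<zeta> \<longrightarrow> 16 \<le> R \<longrightarrow>
    Limsup at_top (hole_rate M (cluster_lattice s U c \<zeta>) R) \<le> ereal (- c1 * R ^ 4)"
proof -
  \<comment> \<open>Since R \<ge> 16, the radius R / (2 c) is at least 8 / c, so one pair
    \<open>C\<close>, \<open>\<kappa>\<close> serves every R.\<close>
  have r0: "0 < 8 / c" using c by simp
  obtain C \<kappa> :: real where C: "1 \<le> C" "0 < \<kappa>"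
    and decay: "\<forall>r (N :: (real \<Rightarrow> complex) measure) B n. 8 / c \<le> r \<longrightarrow> complex_brownian_motion N B \<longrightarrow>
      measure N {\<omega>\<in>space N. \<forall>i\<le>n. r < cmod (B (2 ^ i) \<omega> / of_real (sqrt (2 ^ i)))} \<le> C * exp (- \<kappa> * r\<^sup>2) ^ n"
    using cbm_avoid_decay[OF r0] by (elim exE conjE) (rule that)
  \<comment> \<open>The exponent m^2 \<kappa> r^2 with m \<ge> R / 10 and r = R / (2 c) yields 100 *
    4 = 400.\<close>
  define c1 where "c1 = \<kappa> / (400 * c\<^sup>2)"
  show ?thesis
  proof (intro exI[of _ c1] conjI allI impI)
    show "0 < c1" using C c by (simp add: c1_def)
    fix M :: "'w measure" and \<zeta> R assume iid: "iid_ou_family M \<zeta>" and R: "16 \<le> (R::real)"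
    have ou: "complex_ou_process M (\<zeta> p)" for p using iid unfolding iid_ou_family_def by blast
    define r where "r = R / (2 * c)"
    have r: "8 / c \<le> r" "0 < r" using R c by (auto simp: r_def field_simps)
    \<comment> \<open>As s^2 \<le> 12, coordinates up to R / 10 give a squared distance of at most
      24 R^2 / 100, below (R / 2)^2.\<close>
    define m where "m = nat \<lceil>R / 10\<rceil>"
    have m: "R / 10 \<le> real m" unfolding m_def by linarith
    define F where "F = {0..<int m} \<times> {0..<int m}"
    have F: "finite F" "card F = m\<^sup>2" unfolding F_def by (auto simp: card_cartesian_product power2_eq_square)
    have near: "cmod (site s p) \<le> R / 2" if "p \<in> F" for p
    proof -
      have b: "(real_of_int k)\<^sup>2 \<le> (R / 10)\<^sup>2" if "0 \<le> k" "k < int m" for k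
      proof (rule power_mono)
        have "k < \<lceil>R / 10\<rceil>" using that R unfolding m_def by linarith
        then show "real_of_int k \<le> R / 10" by linarith
      qed (use that in simp)
      have "(cmod (site s p))\<^sup>2 \<le> 12 * ((R / 10)\<^sup>2 + (R / 10)\<^sup>2)"
        unfolding cmod_site_sq using that s by (intro mult_mono add_mono b) (auto simp: F_def)
      also have "\<dots> \<le> (R / 2)\<^sup>2" by (simp add: power_divide)
      finally show ?thesis by (rule power2_le_imp_le) (use R in simp)
    qed
    have avoid: "r < cmod z" if "p \<in> F" "z \<in> avoid s U c R p" for p z
    proof -
      \<comment> \<open>A single point of each cluster suffices for the upper bound.\<close>
      obtain u where u: "u \<in> U" using U by blast
      have "R < cmod (site s p + of_real c * u * z)" using that u by (auto simp: avoid_def)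
      also have "\<dots> \<le> cmod (site s p) + c * cmod z"
        using norm_triangle_ineq[of "site s p" "of_real c * u * z"] U(3)[OF u] c by (simp add: norm_mult)
      finally have "R / 2 < c * cmod z" using near[OF that(1)] by linarith
      then show ?thesis using c by (simp add: r_def field_simps)
    qed
    have "Limsup at_top (hole_rate M (cluster_lattice s U c \<zeta>) R) \<le> ereal (- real (m\<^sup>2) * (\<kappa> * r\<^sup>2))"
    proof (rule Limsup_hole_rate_le)
      fix T :: real assume T: "1 \<le> T"
      \<comment> \<open>The number of doublings of \<open>exp t\<close> on [0, T]. Rounding and ln 2
        < 1 leave n \<ge> T - 1, and the lost unit goes into the constant term.\<close>
      define n where "n = nat \<lfloor>T / ln 2\<rfloor>"
      have ln2: "0 < ln (2::real)" "ln (2::real) \<le> 1" using ln_2_less_1 by auto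
      have "0 \<le> T / ln 2" using T ln2 by simp
      then have n: "real n \<le> T / ln 2" "T / ln 2 - 1 \<le> real n" unfolding n_def by linarith+
      have nT: "real n * ln 2 \<le> T" using n ln2 by (simp add: pos_le_divide_eq)
      have "T \<le> T / ln 2" using T ln2 by (simp add: pos_le_divide_eq mult_left_le)
      then have n1: "T - 1 \<le> real n" using n by linarith
      have each: "measure M {\<omega>\<in>space M. \<forall>t\<in>{0..T}. \<zeta> p t \<omega> \<in> avoid s U c R p} \<le> C * exp (- \<kappa> * r\<^sup>2) ^ n"
        if "p \<in> F" for p
        by (rule ou_avoid_prob_le[OF ou open_avoid[OF U(1)] avoid[OF that] nT decay[rule_format, OF r(1)]])
      have "measure M (hole_event M (cluster_lattice s U c \<zeta>) T R)
          \<le> (\<Prod>p\<in>F. measure M {\<omega>\<in>space M. \<forall>t\<in>{0..T}. \<zeta> p t \<omega> \<in> avoid s U c R p})"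
        by (rule cluster_lattice_hole_le[OF iid U(1) F(1)])
      also have "\<dots> \<le> (\<Prod>p\<in>F. C * exp (- \<kappa> * r\<^sup>2) ^ n)"
        by (intro prod_mono conjI each) auto
      also have "\<dots> = (exp (ln C) * exp (real n * (- \<kappa> * r\<^sup>2))) ^ m\<^sup>2"
        using C F by (simp add: exp_of_nat_mult[symmetric])
      also have "\<dots> = exp (real (m\<^sup>2) * (ln C + real n * (- \<kappa> * r\<^sup>2)))"
        by (simp only: exp_add exp_of_nat_mult)
      also have "\<dots> \<le> exp (- real (m\<^sup>2) * (\<kappa> * r\<^sup>2) * T + real (m\<^sup>2) * (ln C + \<kappa> * r\<^sup>2))"
      proof -
        have "(T - 1) * (\<kappa> * r\<^sup>2) \<le> real n * (\<kappa> * r\<^sup>2)"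
          using n1 C by (intro mult_right_mono) auto
        then have "ln C + real n * (- \<kappa> * r\<^sup>2) \<le> - (\<kappa> * r\<^sup>2) * T + (ln C + \<kappa> * r\<^sup>2)"
          by (simp add: algebra_simps)
        then have "real (m\<^sup>2) * (ln C + real n * (- \<kappa> * r\<^sup>2)) \<le> real (m\<^sup>2) * (- (\<kappa> * r\<^sup>2) * T + (ln C + \<kappa> * r\<^sup>2))"
          by (rule mult_left_mono) simp
        also have "\<dots> = - real (m\<^sup>2) * (\<kappa> * r\<^sup>2) * T + real (m\<^sup>2) * (ln C + \<kappa> * r\<^sup>2)"
          by (simp add: algebra_simps)
        finally show ?thesis by (simp only: exp_le_cancel_iff)
      qed
      finally show "measure M (hole_event M (cluster_lattice s U c \<zeta>) T R)
        \<le> exp (- real (m\<^sup>2) * (\<kappa> * r\<^sup>2) * T + real (m\<^sup>2) * (ln C + \<kappa> * r\<^sup>2))" .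
    qed
    also have "\<dots> \<le> ereal (- c1 * R ^ 4)"
    proof -
      have "(R / 10)\<^sup>2 \<le> (real m)\<^sup>2" using m R by (intro power_mono) auto
      then have "(R / 10)\<^sup>2 * (\<kappa> * r\<^sup>2) \<le> (real m)\<^sup>2 * (\<kappa> * r\<^sup>2)" using C by (intro mult_right_mono) auto
      moreover have "(R / 10)\<^sup>2 * (\<kappa> * r\<^sup>2) = c1 * R ^ 4"
        by (simp add: c1_def r_def power_divide power_mult_distrib power2_eq_square power4_eq_xxxx)
      ultimately show ?thesis by simp
    qed
    finally show "Limsup at_top (hole_rate M (cluster_lattice s U c \<zeta>) R) \<le> ereal (- c1 * R ^ 4)" .
  qed
qed

section \<open>Elementary estimates for the lower bound, and the lower bound itself\<close>

lemma sum_int_inverse_square_le: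
  assumes "finite I"
  shows "(\<Sum>k\<in>I. 1 / (1 + (real_of_int k)\<^sup>2)) \<le> 6"
proof -
  have bound: "(\<Sum>k\<in>{- int m..int m}. 1 / (1 + (real_of_int k)\<^sup>2)) \<le> 6 - 4 / (real m + 1)" for m
  proof (induction m)
    case (Suc m)
    let ?a = "real m + 1"
    have "{- int (Suc m)..int (Suc m)} = insert (- int (Suc m)) (insert (int (Suc m)) {- int m..int m})" by auto
    then have "(\<Sum>k\<in>{- int (Suc m)..int (Suc m)}. 1 / (1 + (real_of_int k)\<^sup>2))
        = 2 / (1 + ?a\<^sup>2) + (\<Sum>k\<in>{- int m..int m}. 1 / (1 + (real_of_int k)\<^sup>2))"
      by (simp add: power2_eq_square algebra_simps)
    also have "\<dots> \<le> 2 / (1 + ?a\<^sup>2) + (6 - 4 / ?a)" using Suc by simp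
    also have "2 / (1 + ?a\<^sup>2) \<le> 4 / ?a - 4 / (?a + 1)"
    proof -
      have "2 / (1 + ?a\<^sup>2) = (2 * 2) / (2 * (1 + ?a\<^sup>2))"
        by (rule mult_divide_mult_cancel_left[symmetric]) simp
      also have "\<dots> \<le> (2 * 2) / (?a * (?a + 1))"
      proof (rule divide_left_mono)
        have "0 \<le> (?a - 1)\<^sup>2 + ?a" by simp
        then show "?a * (?a + 1) \<le> 2 * (1 + ?a\<^sup>2)" by (simp add: power2_eq_square algebra_simps)
        have "0 < ?a" "0 < ?a + 1" "0 < 1 + ?a\<^sup>2" by (simp_all add: add_pos_nonneg)
        then show "0 < 2 * (1 + ?a\<^sup>2) * (?a * (?a + 1))" by (intro mult_pos_pos) auto
      qed simp
      also have "\<dots> = 4 / ?a - 4 / (?a + 1)" by (simp add: field_simps)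
      finally show ?thesis .
    qed
    finally show ?case by (simp add: add.commute)
  qed simp
  obtain m where "I \<subseteq> {- int m..int m}"
  proof -
    have b: "nat \<bar>k\<bar> \<le> Max ((\<lambda>k. nat \<bar>k\<bar>) ` I)" if "k \<in> I" for k
      using assms that by (intro Max_ge) auto
    show thesis
    proof (rule that[of "Max ((\<lambda>k. nat \<bar>k\<bar>) ` I)"])
      show "I \<subseteq> {- int (Max ((\<lambda>k. nat \<bar>k\<bar>) ` I))..int (Max ((\<lambda>k. nat \<bar>k\<bar>) ` I))}"
      proof
        fix k assume "k \<in> I"
        from b[OF this] show "k \<in> {- int (Max ((\<lambda>k. nat \<bar>k\<bar>) ` I))..int (Max ((\<lambda>k. nat \<bar>k\<bar>) ` I))}"
          by (simp add: nat_le_iff abs_le_iff)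
      qed
    qed
  qed
  then have "(\<Sum>k\<in>I. 1 / (1 + (real_of_int k)\<^sup>2)) \<le> (\<Sum>k\<in>{- int m..int m}. 1 / (1 + (real_of_int k)\<^sup>2))"
    by (intro sum_mono2) (auto intro!: divide_nonneg_nonneg add_nonneg_nonneg)
  also have "\<dots> \<le> 6" using bound[of m] by (rule order_trans) simp
  finally show ?thesis .
qed

text \<open>It counts blocks of ratio 1 + x: since exp (x / 2) \<le> 1 + x for 0 < x \<le> 1, about
  2 T / x of them reach from 1 to exp T.\<close>

lemma exp_le_power_ceiling:
  fixes x T :: real
  assumes x: "0 < x" "x \<le> 1" and T: "0 < T"
  shows "1 \<le> nat \<lceil>2 * T / x\<rceil>" "exp T \<le> (1 + x) ^ nat \<lceil>2 * T / x\<rceil>"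
proof -
  have pos: "0 < 2 * T / x" using x T by simp
  then show "1 \<le> nat \<lceil>2 * T / x\<rceil>" by linarith
  have "2 * T / x \<le> real (nat \<lceil>2 * T / x\<rceil>)" using pos by linarith
  then have "T \<le> real (nat \<lceil>2 * T / x\<rceil>) * (x / 2)" using x by (simp add: field_simps)
  then have "exp T \<le> exp (real (nat \<lceil>2 * T / x\<rceil>) * (x / 2))" by simp
  also have "\<dots> = exp (x / 2) ^ nat \<lceil>2 * T / x\<rceil>" by (rule exp_of_nat_mult)
  also have "\<dots> \<le> (1 + x) ^ nat \<lceil>2 * T / x\<rceil>"
  proof (rule power_mono)
    have "exp (x / 2) \<le> 1 + x / 2 + (x / 2)\<^sup>2" by (rule exp_bound) (use x in auto)
    moreover have "x / 2 * (x / 2) \<le> x / 2 * 1" using x by (intro mult_left_mono) auto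
    ultimately show "exp (x / 2) \<le> 1 + x" unfolding power2_eq_square by linarith
  qed simp
  finally show "exp T \<le> (1 + x) ^ nat \<lceil>2 * T / x\<rceil>" .
qed

lemma exp_neg_le_inverse_square: "0 < x \<Longrightarrow> exp (- x) \<le> 2 / x\<^sup>2" for x :: real
proof -
  assume x: "0 < x"
  have "1 + x + x\<^sup>2 / 2 \<le> exp x" using exp_lower_Taylor_quadratic[of x] x by simp
  then have "x\<^sup>2 / 2 \<le> exp x" using x by linarith
  then have "1 / exp x \<le> 1 / (x\<^sup>2 / 2)" using x by (intro divide_left_mono) auto
  then show ?thesis by (simp add: exp_minus inverse_eq_divide)
qed

lemma exp_neg_double_le: "0 \<le> e \<Longrightarrow> e \<le> 1 / 2 \<Longrightarrow> exp (- 2 * e) \<le> 1 - e" for e :: real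
proof -
  assume e: "0 \<le> e" "e \<le> 1 / 2"
  have "1 + 2 * e \<le> exp (2 * e)" by (rule exp_ge_add_one_self)
  moreover have "1 \<le> (1 - e) * (1 + 2 * e)"
  proof -
    have "e * (2 * e) \<le> e * 1" using e by (intro mult_left_mono) auto
    then show ?thesis by (simp add: algebra_simps)
  qed
  moreover have "(1 - e) * (1 + 2 * e) \<le> (1 - e) * exp (2 * e)"
    using e calculation(1) by (intro mult_left_mono) auto
  ultimately have "1 \<le> (1 - e) * exp (2 * e)" by linarith
  then have "1 * exp (- 2 * e) \<le> (1 - e) * exp (2 * e) * exp (- 2 * e)"
    by (rule mult_right_mono) simp
  then show ?thesis by (simp add: mult.assoc flip: exp_add)
qed

text \<open>There are O(R^2) sites within K R, each at a rate of order \<rho>^2 and thus of order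
  R^2. For the other sites the failure bound \<open>e\<close> is dominated by the inverse fourth
  power of the distance and then by a product weight that is summable over the lattice, so together
  they cost a rate that does not depend on R.\<close>

lemma cluster_lattice_lower:
  assumes c: "0 < c" and s: "1 \<le> s" and U: "finite U" "\<And>u. u \<in> U \<Longrightarrow> cmod u = 1"
  shows "\<exists>c2>0. \<forall>(M :: 'w measure) \<zeta> R. iid_ou_family M \<zeta> \<longrightarrow> 16 \<le> R \<longrightarrow>
    ereal (- c2 * R ^ 4) \<le> Liminf at_top (hole_rate M (cluster_lattice s U c \<zeta>) R)"
proof -
  obtain \<rho>0 p :: real where \<rho>0: "1 \<le> \<rho>0" and p: "0 < p" "p < 1"
    and push: "\<forall>\<rho>\<ge>\<rho>0. \<exists>\<pi>0>0. \<forall>(M :: 'w measure) Z G n T.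
      complex_ou_process M Z \<longrightarrow> open G \<longrightarrow> {z. \<rho> \<le> cmod z} \<subseteq> G \<longrightarrow> 1 \<le> n \<longrightarrow> exp T \<le> (1 + 1 / \<rho>\<^sup>2) ^ n \<longrightarrow>
      \<pi>0 * p ^ n \<le> measure M {\<omega>\<in>space M. \<forall>t\<in>{0..T}. Z t \<omega> \<in> G}"
    using ou_push_out by (elim exE conjE) (rule that)
  define L where "L = - ln p"
  have L: "0 < L" using p by (simp add: L_def)
  \<comment> \<open>K \<ge> 2 keeps a distant site out of the hole, as at most a quarter of its
    distance d > K R is lost. The second entry ensures \<rho> \<ge> \<rho>0 and the third a
    confinement radius of at least 60, both by R \<ge> 16.\<close>
  define K where "K = max 2 (max (\<rho>0 * c / 16) (15 * c))"
  have K: "2 \<le> K" "\<rho>0 * c / 16 \<le> K" "15 * c \<le> K" by (auto simp: K_def)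
  \<comment> \<open>With r = d / (4 c), the bound exp (- x) \<le> 2 / x^2 gives 4 exp (- r^2 / 512)
    \<le> 8 * 512^2 * 256 c^4 / d^4. The last 4 comes from d^4 \<ge> (1 + S)^2 / 4, where S is the
    sum of the squared integer coordinates.\<close>
  define C where "C = 8 * 512\<^sup>2 * 256 * 4 * c ^ 4"
  have C: "0 < C" using c by (simp add: C_def)
  \<comment> \<open>The weight of one coordinate; the products over two coordinates have a total of
    at most 6 * 6 = 36.\<close>
  define w where "w k = 1 / (1 + (real_of_int k)\<^sup>2)" for k
  have w: "0 \<le> w k" for k by (auto simp: w_def)
  \<comment> \<open>27 = 9 * 3 combines the number of near sites with the number of steps per unit
    of time; 288 = 8 * 36 comes from the far sites.\<close>
  define c2 where "c2 = 27 * K\<^sup>2 * (K + 2)\<^sup>2 * L / c\<^sup>2 + 288 * C"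
  show ?thesis
  proof (intro exI[of _ c2] conjI allI impI)
    show "0 < c2" unfolding c2_def using K L C c by (intro add_nonneg_pos) auto
    fix M :: "'w measure" and \<zeta> R assume iid: "iid_ou_family M \<zeta>" and R: "16 \<le> (R::real)"
    interpret prob_space M using iid by (simp add: iid_ou_family_def)
    have ou: "complex_ou_process M (\<zeta> p)" for p using iid unfolding iid_ou_family_def by blast
    \<comment> \<open>Beyond this radius a point of a near site has modulus at least (K + 2) R - K R
      = 2 R.\<close>
    define \<rho> where "\<rho> = (K + 2) * R / c"
    have "\<rho>0 \<le> \<rho>"
    proof -
      have "\<rho>0 * c \<le> K * 16" using K by simp
      also have "\<dots> \<le> (K + 2) * R" using K R by (intro mult_mono) auto
      finally show ?thesis using c by (simp add: \<rho>_def field_simps)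
    qed
    then have \<rho>: "1 \<le> \<rho>" "\<rho>0 \<le> \<rho>" using \<rho>0 by auto
    obtain \<pi>1 where \<pi>1: "0 < \<pi>1" "\<forall>(M :: 'w measure) Z G n T.
      complex_ou_process M Z \<longrightarrow> open G \<longrightarrow> {z. \<rho> \<le> cmod z} \<subseteq> G \<longrightarrow> 1 \<le> n \<longrightarrow> exp T \<le> (1 + 1 / \<rho>\<^sup>2) ^ n \<longrightarrow>
      \<pi>1 * p ^ n \<le> measure M {\<omega>\<in>space M. \<forall>t\<in>{0..T}. Z t \<omega> \<in> G}"
      using push[rule_format, OF \<rho>(2)] by (elim exE conjE) (rule that)
    \<comment> \<open>Capped at 1, so that the factor of a near site is at most 1 and
      \<open>F \<inter> Near\<close> may be enlarged to \<open>Near\<close> in the exponent.\<close>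
    define \<pi>0 where "\<pi>0 = min 1 \<pi>1"
    have \<pi>0: "0 < \<pi>0" "\<pi>0 \<le> 1" "\<pi>0 \<le> \<pi>1" using \<pi>1 by (auto simp: \<pi>0_def)
    define Near where "Near = {p. cmod (site s p) \<le> K * R}"
    define b where "b = \<lfloor>K * R\<rfloor>"
    have b: "0 \<le> b" "real_of_int b \<le> K * R" using K R by (auto simp: b_def)
    have coord: "\<bar>real_of_int (fst p)\<bar> \<le> cmod (site s p)" "\<bar>real_of_int (snd p)\<bar> \<le> cmod (site s p)" for p
    proof -
      have "1 * ((real_of_int (fst p))\<^sup>2 + (real_of_int (snd p))\<^sup>2) \<le> (cmod (site s p))\<^sup>2"
        unfolding cmod_site_sq using s by (intro mult_right_mono) auto
      then have "\<bar>real_of_int (fst p)\<bar>\<^sup>2 \<le> (cmod (site s p))\<^sup>2" "\<bar>real_of_int (snd p)\<bar>\<^sup>2 \<le> (cmod (site s p))\<^sup>2"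
        by (auto intro: order_trans[rotated])
      then show "\<bar>real_of_int (fst p)\<bar> \<le> cmod (site s p)" "\<bar>real_of_int (snd p)\<bar> \<le> cmod (site s p)"
        by (auto intro: power2_le_imp_le)
    qed
    have "Near \<subseteq> {- b..b} \<times> {- b..b}"
    proof
      fix p assume "p \<in> Near"
      then have "\<bar>real_of_int (fst p)\<bar> \<le> K * R" "\<bar>real_of_int (snd p)\<bar> \<le> K * R"
        using coord[of p] by (auto simp: Near_def)
      then have "\<bar>fst p\<bar> \<le> b" "\<bar>snd p\<bar> \<le> b" unfolding b_def by linarith+
      then show "p \<in> {- b..b} \<times> {- b..b}" by (cases p) auto
    qed
    moreover have "finite ({- b..b} \<times> {- b..b})" by simp
    ultimately have Near: "finite Near" "card Near \<le> card ({- b..b} \<times> {- b..b})"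
      by (rule finite_subset, intro card_mono)
    have cardNear: "real (card Near) \<le> 9 * K\<^sup>2 * R\<^sup>2"
    proof -
      have "1 \<le> K * R" using mult_mono[of 2 K 16 R] K R by simp
      have "real (card Near) \<le> real (card ({- b..b} \<times> {- b..b}))" using Near(2) by (simp only: of_nat_le_iff)
      also have "\<dots> = (2 * real_of_int b + 1)\<^sup>2" using b(1) by (simp add: card_cartesian_product power2_eq_square)
      also have "\<dots> \<le> (3 * (K * R))\<^sup>2" using b \<open>1 \<le> K * R\<close> by (intro power_mono) auto
      also have "\<dots> = 9 * K\<^sup>2 * R\<^sup>2" by (simp add: power_mult_distrib)
      finally show ?thesis .
    qed
    have "ereal (- (real (card Near) * (3 * \<rho>\<^sup>2 * L) + 288 * C))
        \<le> Liminf at_top (hole_rate M (cluster_lattice s U c \<zeta>) R)"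
    proof (rule Liminf_hole_rate_ge)
      fix T :: real assume T: "1 \<le> T"
      let ?P = "\<lambda>p. measure M {\<omega>\<in>space M. \<forall>t\<in>{0..T}. \<zeta> p t \<omega> \<in> avoid s U c R p}"
      have near: "exp (ln \<pi>0 - 3 * \<rho>\<^sup>2 * L * T) \<le> ?P q" if q: "q \<in> Near" for q
      proof -
        define n where "n = nat \<lceil>2 * T / (1 / \<rho>\<^sup>2)\<rceil>"
        have "0 < 1 / \<rho>\<^sup>2" "1 / \<rho>\<^sup>2 \<le> 1" "0 < T" using \<rho> T by auto
        note n = exp_le_power_ceiling[OF this, folded n_def]
        have "{z. \<rho> \<le> cmod z} \<subseteq> avoid s U c R q"
        proof
          fix z assume "z \<in> {z. \<rho> \<le> cmod z}"
          then have "(K + 2) * R \<le> c * cmod z" using c by (simp add: \<rho>_def field_simps)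
          then have *: "K * R + 2 * R \<le> c * cmod z" by (simp add: algebra_simps)
          show "z \<in> avoid s U c R q"
            unfolding avoid_def
          proof (intro CollectI ballI)
            fix u assume "u \<in> U"
            have "c * cmod z \<le> cmod (site s q) + cmod (site s q + of_real c * u * z)"
              using norm_triangle_ineq4[of "site s q + of_real c * u * z" "site s q"] U(2)[OF \<open>u \<in> U\<close>] c
              by (simp add: norm_mult)
            then show "R < cmod (site s q + of_real c * u * z)"
              using * q R unfolding Near_def by simp
          qed
        qed
        from \<pi>1(2)[rule_format, OF ou open_avoid[OF U(1)] this n]
        have "\<pi>1 * p ^ n \<le> ?P q" .
        moreover have "\<pi>0 * p ^ n \<le> \<pi>1 * p ^ n" using \<pi>0 p by (intro mult_right_mono) auto
        moreover have "exp (ln \<pi>0 - 3 * \<rho>\<^sup>2 * L * T) \<le> \<pi>0 * p ^ n"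
        proof -
          \<comment> \<open>Rounding up costs one step, which this absorbs.\<close>
          have "1 \<le> \<rho>\<^sup>2 * T" using mult_mono[of 1 "\<rho>\<^sup>2" 1 T] \<rho> T by simp
          moreover have "0 \<le> 2 * T / (1 / \<rho>\<^sup>2)" using T by simp
          then have "real n \<le> 2 * T / (1 / \<rho>\<^sup>2) + 1" unfolding n_def by linarith
          ultimately have "real n \<le> 3 * \<rho>\<^sup>2 * T" by (simp add: mult.commute)
          then have "real n * L \<le> 3 * \<rho>\<^sup>2 * T * L" using L by (intro mult_right_mono) auto
          then have "exp (ln \<pi>0 - 3 * \<rho>\<^sup>2 * L * T) \<le> exp (ln \<pi>0 + real n * ln p)"
            by (simp add: L_def algebra_simps)
          also have "\<dots> = \<pi>0 * p ^ n" using \<pi>0 p by (simp add: exp_add exp_of_nat_mult)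
          finally show ?thesis .
        qed
        ultimately show ?thesis by linarith
      qed
      have far: "exp (- (8 * T * (C * (w (fst q) * w (snd q))))) \<le> ?P q" if q: "q \<notin> Near" for q
      proof -
        define r where "r = cmod (site s q) / (4 * c)"
        have big: "K * R < cmod (site s q)" using q by (simp add: Near_def not_le)
        have "15 * c * 16 \<le> K * R" using K R c by (intro mult_mono) auto
        then have r: "60 \<le> r" using big c by (simp add: r_def field_simps)
        define e where "e = 4 * exp (- r\<^sup>2 / 512)"
        have r2: "3600 \<le> r\<^sup>2" using power_mono[OF r, of 2] by simp
        have e12: "e \<le> 1 / 2"
        proof -
          have "8 \<le> exp (r\<^sup>2 / 512)" using exp_ge_add_one_self[of "r\<^sup>2 / 512"] r2 by linarith
          then have "4 / exp (r\<^sup>2 / 512) \<le> 4 / 8" by (intro divide_left_mono) auto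
          then show ?thesis by (simp add: e_def exp_minus inverse_eq_divide)
        qed
        have e0: "0 \<le> e" by (simp add: e_def)
        have "e \<le> C * (w (fst q) * w (snd q))"
        proof -
          define S where "S = (real_of_int (fst q))\<^sup>2 + (real_of_int (snd q))\<^sup>2"
          have "0 < K * R" using K R by simp
          then have "site s q \<noteq> 0" using big by auto
          then have "S \<noteq> 0" using cmod_site_sq[of s q] by (auto simp: S_def)
          then have "fst q \<noteq> 0 \<or> snd q \<noteq> 0" by (auto simp: S_def)
          then have "1 \<le> (fst q)\<^sup>2 + (snd q)\<^sup>2" by (smt (verit) zero_le_power2 zero_less_power2)
          then have "real_of_int 1 \<le> real_of_int ((fst q)\<^sup>2 + (snd q)\<^sup>2)" by (simp only: of_int_le_iff)
          then have S1: "1 \<le> S" by (simp add: S_def)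
          have "S * 1 \<le> S * s\<^sup>2" using S1 s by (intro mult_left_mono) auto
          then have "S \<le> (cmod (site s q))\<^sup>2" unfolding cmod_site_sq S_def by (simp add: mult.commute)
          moreover have "(1 + S) / 2 \<le> S" using S1 by simp
          ultimately have "(1 + S) / 2 \<le> (cmod (site s q))\<^sup>2" by (rule order_trans[rotated])
          then have "((1 + S) / 2)\<^sup>2 \<le> ((cmod (site s q))\<^sup>2)\<^sup>2" using S1 by (intro power_mono) auto
          then have site4: "(1 + S)\<^sup>2 / 4 \<le> cmod (site s q) ^ 4" by (simp add: power_divide)
          have ww: "(1 + (real_of_int (fst q))\<^sup>2) * (1 + (real_of_int (snd q))\<^sup>2) \<le> (1 + S)\<^sup>2"
            unfolding power2_eq_square[of "1 + S"] by (intro mult_mono) (auto simp: S_def)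
          have "e \<le> 4 * (2 / (r\<^sup>2 / 512)\<^sup>2)"
          proof -
            have "0 < r\<^sup>2 / 512" using r2 by linarith
            from mult_left_mono[OF exp_neg_le_inverse_square[OF this], of 4]
            show ?thesis unfolding e_def minus_divide_left by simp
          qed
          also have "\<dots> = 8 * 512\<^sup>2 / r ^ 4" by (simp add: power_divide)
          also have "\<dots> = 8 * 512\<^sup>2 * 256 * c ^ 4 / cmod (site s q) ^ 4"
            by (simp add: r_def power_divide power_mult_distrib)
          also have "\<dots> \<le> 8 * 512\<^sup>2 * 256 * c ^ 4 / ((1 + (real_of_int (fst q))\<^sup>2) * (1 + (real_of_int (snd q))\<^sup>2) / 4)"
          proof (rule divide_left_mono)
            show "(1 + (real_of_int (fst q))\<^sup>2) * (1 + (real_of_int (snd q))\<^sup>2) / 4 \<le> cmod (site s q) ^ 4"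
              using site4 ww by linarith
            show "0 < cmod (site s q) ^ 4 * ((1 + (real_of_int (fst q))\<^sup>2) * (1 + (real_of_int (snd q))\<^sup>2) / 4)"
              using \<open>site s q \<noteq> 0\<close> by (intro mult_pos_pos divide_pos_pos add_pos_nonneg) auto
          qed simp
          also have "\<dots> = C * (w (fst q) * w (snd q))" by (simp add: C_def w_def)
          finally show ?thesis .
        qed
        then have "8 * T * e \<le> 8 * T * (C * (w (fst q) * w (snd q)))" using T by (intro mult_left_mono) auto
        then have "exp (- (8 * T * (C * (w (fst q) * w (snd q))))) \<le> exp (- (8 * T * e))" by simp
        also have "\<dots> \<le> (1 - e) ^ Suc (nat \<lceil>2 * T / 1\<rceil>)"
        proof -
          \<comment> \<open>T \<ge> 1 absorbs both the rounding and the extra factor for the initial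
            time.\<close>
          have "real (Suc (nat \<lceil>2 * T / 1\<rceil>)) \<le> 4 * T" using T by simp linarith
          then have "real (Suc (nat \<lceil>2 * T / 1\<rceil>)) * (2 * e) \<le> 4 * T * (2 * e)" using e0 by (intro mult_right_mono) auto
          then have "exp (- (8 * T * e)) \<le> exp (real (Suc (nat \<lceil>2 * T / 1\<rceil>)) * (- 2 * e))" by simp
          also have "\<dots> = exp (- 2 * e) ^ Suc (nat \<lceil>2 * T / 1\<rceil>)" by (rule exp_of_nat_mult)
          also have "\<dots> \<le> (1 - e) ^ Suc (nat \<lceil>2 * T / 1\<rceil>)"
            by (rule power_mono[OF exp_neg_double_le[OF e0 e12]]) simp
          finally show ?thesis .
        qed
        also have "\<dots> \<le> ?P q"
          unfolding e_def
        proof (rule ou_confine[OF ou open_avoid[OF U(1)]])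
          show "cball 0 r \<subseteq> avoid s U c R q"
          proof
            fix z :: complex assume "z \<in> cball 0 r"
            then have z: "c * cmod z \<le> cmod (site s q) / 4" using c by (simp add: r_def field_simps)
            show "z \<in> avoid s U c R q"
              unfolding avoid_def
            proof (intro CollectI ballI)
              fix u assume "u \<in> U"
              have "cmod (site s q) - c * cmod z \<le> cmod (site s q + of_real c * u * z)"
                using norm_diff_ineq[of "site s q" "of_real c * u * z"] U(2)[OF \<open>u \<in> U\<close>] c
                by (simp add: norm_mult)
              moreover have "2 * R \<le> K * R" using K R by (intro mult_right_mono) auto
              ultimately show "R < cmod (site s q + of_real c * u * z)"
                using z big R by linarith
            qed
          qed
          show "0 < r" using r by simp
          show "4 * exp (- r\<^sup>2 / 512) \<le> 1" using e12 by (simp add: e_def)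
          show "1 \<le> nat \<lceil>2 * T / 1\<rceil>" "exp T \<le> 2 ^ nat \<lceil>2 * T / 1\<rceil>"
            using exp_le_power_ceiling[of 1 T] T by auto
        qed
        finally show ?thesis .
      qed
      show "exp (- (real (card Near) * (3 * \<rho>\<^sup>2 * L) + 288 * C) * T + real (card Near) * ln \<pi>0)
          \<le> measure M (hole_event M (cluster_lattice s U c \<zeta>) T R)"
      proof (rule cluster_lattice_hole_ge[OF iid U(1)])
        fix F :: "(int \<times> int) set" assume F: "finite F"
        let ?a = "exp (ln \<pi>0 - 3 * \<rho>\<^sup>2 * L * T)"
        have "ln \<pi>0 - 3 * \<rho>\<^sup>2 * L * T \<le> 0"
        proof -
          have "ln \<pi>0 \<le> 0" using \<pi>0 by simp
          moreover have "0 \<le> 3 * \<rho>\<^sup>2 * L * T" using L T by simp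
          ultimately show ?thesis by linarith
        qed
        then have a1: "?a \<le> 1" by simp
        have split: "F = (F \<inter> Near) \<union> (F - Near)" by auto
        have "exp (real (card Near) * (ln \<pi>0 - 3 * \<rho>\<^sup>2 * L * T)) = ?a ^ card Near"
          by (rule exp_of_nat_mult)
        also have "\<dots> \<le> ?a ^ card (F \<inter> Near)"
          by (rule power_decreasing) (use a1 Near in \<open>auto intro: card_mono\<close>)
        also have "\<dots> = (\<Prod>q\<in>F \<inter> Near. ?a)" by simp
        also have "\<dots> \<le> (\<Prod>q\<in>F \<inter> Near. ?P q)"
          by (rule prod_mono) (use near in auto)
        finally have 1: "exp (real (card Near) * (ln \<pi>0 - 3 * \<rho>\<^sup>2 * L * T)) \<le> (\<Prod>q\<in>F \<inter> Near. ?P q)" .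
        have wsum: "(\<Sum>q\<in>F - Near. w (fst q) * w (snd q)) \<le> 36"
        proof -
          \<comment> \<open>Enlarging to a rectangle of indices lets the sum of products
            factor.\<close>
          have "F - Near \<subseteq> fst ` F \<times> snd ` F" by force
          then have "(\<Sum>q\<in>F - Near. w (fst q) * w (snd q)) \<le> (\<Sum>q\<in>fst ` F \<times> snd ` F. w (fst q) * w (snd q))"
            by (intro sum_mono2) (use F w in auto)
          also have "\<dots> = (\<Sum>k\<in>fst ` F. w k) * (\<Sum>l\<in>snd ` F. w l)"
            by (simp add: sum_product sum.cartesian_product case_prod_beta')
          also have "\<dots> \<le> 6 * 6"
            unfolding w_def using F
            by (intro mult_mono sum_int_inverse_square_le sum_nonneg) auto
          finally show ?thesis by simp
        qed
        have "exp (- (288 * C * T)) \<le> exp (\<Sum>q\<in>F - Near. - (8 * T * (C * (w (fst q) * w (snd q)))))"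
        proof -
          have "(\<Sum>q\<in>F - Near. 8 * T * (C * (w (fst q) * w (snd q)))) = 8 * T * C * (\<Sum>q\<in>F - Near. w (fst q) * w (snd q))"
            by (simp add: sum_distrib_left mult.assoc)
          also have "\<dots> \<le> 8 * T * C * 36" using T C by (intro mult_left_mono wsum) auto
          finally have "(\<Sum>q\<in>F - Near. 8 * T * (C * (w (fst q) * w (snd q)))) \<le> 288 * C * T"
            by (simp only: mult.commute mult.left_commute)
          then show ?thesis by (simp only: sum_negf exp_le_cancel_iff neg_le_iff_le)
        qed
        also have "\<dots> = (\<Prod>q\<in>F - Near. exp (- (8 * T * (C * (w (fst q) * w (snd q))))))"
          using F by (simp add: exp_sum)
        also have "\<dots> \<le> (\<Prod>q\<in>F - Near. ?P q)"
          by (rule prod_mono) (use far in auto)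
        finally have 2: "exp (- (288 * C * T)) \<le> (\<Prod>q\<in>F - Near. ?P q)" .
        have "exp (- (real (card Near) * (3 * \<rho>\<^sup>2 * L) + 288 * C) * T + real (card Near) * ln \<pi>0)
            = exp (real (card Near) * (ln \<pi>0 - 3 * \<rho>\<^sup>2 * L * T)) * exp (- (288 * C * T))"
          by (simp add: algebra_simps flip: exp_add)
        also have "\<dots> \<le> (\<Prod>q\<in>F \<inter> Near. ?P q) * (\<Prod>q\<in>F - Near. ?P q)"
          by (rule mult_mono[OF 1 2]) (auto intro: prod_nonneg)
        also have "\<dots> = (\<Prod>q\<in>(F \<inter> Near) \<union> (F - Near). ?P q)"
          by (rule prod.union_disjoint[symmetric]) (use F in auto)
        also have "\<dots> = (\<Prod>q\<in>F. ?P q)" using split by simp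
        finally show "exp (- (real (card Near) * (3 * \<rho>\<^sup>2 * L) + 288 * C) * T + real (card Near) * ln \<pi>0)
            \<le> (\<Prod>q\<in>F. ?P q)" .
      qed
    qed
    moreover have "- c2 * R ^ 4 \<le> - (real (card Near) * (3 * \<rho>\<^sup>2 * L) + 288 * C)"
    proof -
      have "real (card Near) * (3 * \<rho>\<^sup>2 * L) \<le> 9 * K\<^sup>2 * R\<^sup>2 * (3 * \<rho>\<^sup>2 * L)"
        using cardNear L by (intro mult_right_mono) auto
      also have "\<dots> = 27 * K\<^sup>2 * (K + 2)\<^sup>2 * L / c\<^sup>2 * R ^ 4"
        by (simp add: \<rho>_def power_divide power_mult_distrib power2_eq_square power4_eq_xxxx)
      finally have "real (card Near) * (3 * \<rho>\<^sup>2 * L) \<le> 27 * K\<^sup>2 * (K + 2)\<^sup>2 * L / c\<^sup>2 * R ^ 4" .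
      moreover have "288 * C * 1 \<le> 288 * C * R ^ 4" using C R by (intro mult_left_mono one_le_power) auto
      ultimately show ?thesis unfolding c2_def by (simp add: algebra_simps)
    qed
    ultimately show "ereal (- c2 * R ^ 4) \<le> Liminf at_top (hole_rate M (cluster_lattice s U c \<zeta>) R)"
      by (meson ereal_less_eq(3) order_trans)
  qed
qed

lemma cluster_lattice_rate:
  assumes c: "0 < c" and s: "1 \<le> s" "s\<^sup>2 \<le> 12" and U: "finite U" "U \<noteq> {}" "\<And>u. u \<in> U \<Longrightarrow> cmod u = 1"
  shows "\<exists>c1 > 0. \<exists>c2 > 0. \<forall>(M :: 'w measure) \<zeta>. iid_ou_family M \<zeta> \<longrightarrow> (\<forall>R \<ge> 16.
    Limsup at_top (hole_rate M (cluster_lattice s U c \<zeta>) R) \<le> ereal (- c1 * R ^ 4) \<and>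
    Liminf at_top (hole_rate M (cluster_lattice s U c \<zeta>) R) \<ge> ereal (- c2 * R ^ 4))"
proof -
  obtain c1 c2 where "0 < c1" "0 < c2"
    and "\<forall>(M :: 'w measure) \<zeta> R. iid_ou_family M \<zeta> \<longrightarrow> 16 \<le> R \<longrightarrow>
      Limsup at_top (hole_rate M (cluster_lattice s U c \<zeta>) R) \<le> ereal (- c1 * R ^ 4)"
    and "\<forall>(M :: 'w measure) \<zeta> R. iid_ou_family M \<zeta> \<longrightarrow> 16 \<le> R \<longrightarrow>
      ereal (- c2 * R ^ 4) \<le> Liminf at_top (hole_rate M (cluster_lattice s U c \<zeta>) R)"
  proof -
    have "\<exists>c1>0. \<forall>(M :: 'w measure) \<zeta> R. iid_ou_family M \<zeta> \<longrightarrow> 16 \<le> R \<longrightarrow>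
      Limsup at_top (hole_rate M (cluster_lattice s U c \<zeta>) R) \<le> ereal (- c1 * R ^ 4)"
      by (rule cluster_lattice_upper[OF c s(2) U(1,2)]) (rule U(3))
    moreover have "\<exists>c2>0. \<forall>(M :: 'w measure) \<zeta> R. iid_ou_family M \<zeta> \<longrightarrow> 16 \<le> R \<longrightarrow>
      ereal (- c2 * R ^ 4) \<le> Liminf at_top (hole_rate M (cluster_lattice s U c \<zeta>) R)"
      by (rule cluster_lattice_lower[OF c s(1) U(1)]) (rule U(3))
    ultimately show ?thesis by (elim exE conjE) (rule that)
  qed
  then show ?thesis by (intro exI[of _ c1] exI[of _ c2] conjI) simp_all
qed

section \<open>Recurrence and the expected number of hit cells\<close>

text \<open>Split at the first visit i \<le> H. The later displacements are independent of it, and a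
  net displacement below 1 over the next j steps leaves the path in the disc of radius \<rho> + 1.
  Summing over i and j, the hitting probability times the expected number of returns within H steps
  is at most the expected number of visits to the larger disc up to step 2 H.\<close>

lemma cbm_first_visit:
  assumes cbm: "complex_brownian_motion M B" and \<delta>: "0 < \<delta>" and \<rho>: "0 \<le> \<rho>"
  shows "measure M {\<omega>\<in>space M. \<exists>i\<le>H. cmod (z + B (\<delta> * real i) \<omega>) < \<rho>}
      * (\<Sum>j=1..H. measure (cgauss (\<delta> * real j)) {x. cmod x < 1})
    \<le> (\<Sum>k=1..2 * H. measure (cgauss (\<delta> * real k)) {x. cmod (z + x) < \<rho> + 1})"
proof -
  interpret prob_space M using cbm by (rule cbm_prob_space)
  define \<tau> where "\<tau> i = \<delta> * real i" for i
  have \<tau>: "mono \<tau>" "0 \<le> \<tau> 0" unfolding \<tau>_def using \<delta> by (auto simp: mono_def)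
  have pos: "0 \<le> \<tau> i" for i using \<delta> by (simp add: \<tau>_def)
  have B [measurable]: "B (\<tau> i) \<in> borel_measurable M" for i
    using cbm_measurable[OF cbm pos] .
  define E where "E i = {\<omega>\<in>space M. cmod (z + B (\<tau> i) \<omega>) < \<rho> \<and> (\<forall>k<i. \<rho> \<le> cmod (z + B (\<tau> k) \<omega>))}" for i
  define V where "V k = {\<omega>\<in>space M. cmod (z + B (\<tau> k) \<omega>) < \<rho> + 1}" for k
  define p where "p j = measure (cgauss (\<delta> * real j)) {x. cmod x < 1}" for j
  have [measurable]: "E i \<in> events" "V i \<in> events" for i unfolding E_def V_def by measurable
  have disj: "disjoint_family_on E {..H}" "disjoint_family_on (\<lambda>i. E i \<inter> V k) {..H}" for k
    unfolding disjoint_family_on_def E_def by (auto simp: linorder_neq_iff)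
  have Vk: "prob (V k) = measure (cgauss (\<delta> * real k)) {x. cmod (z + x) < \<rho> + 1}" for k
    using prob_distr[OF B[of k], of "{x. cmod (z + x) < \<rho> + 1}"] cbm_law[OF cbm pos, of k]
    unfolding V_def by (simp add: \<tau>_def)
  have step: "prob (E i) * p j \<le> prob (E i \<inter> V (i + j))" for i j
  proof -
    let ?S = "PiM {..i} (\<lambda>_. borel :: complex measure)" and ?T = "PiM {..j} (\<lambda>_. borel :: complex measure)"
    define A where "A = {f\<in>space ?S. cmod (z + f i) < \<rho> \<and> (\<forall>k\<in>{..<i}. \<rho> \<le> cmod (z + f k))}"
    define C where "C = {f\<in>space ?T. cmod (f j) < 1}"
    define D where "D = {\<omega>\<in>space M. cmod (B (\<tau> (i + j)) \<omega> - B (\<tau> i) \<omega>) < 1}"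
    have [measurable]: "D \<in> events" unfolding D_def by measurable
    let ?X = "\<lambda>\<omega>. \<lambda>k\<in>{..i}. B (\<tau> k) \<omega>" and ?Y = "\<lambda>\<omega>. \<lambda>k\<in>{..j}. B (\<tau> (i + k)) \<omega> - B (\<tau> i) \<omega>"
    have A: "A \<in> sets ?S"
      unfolding A_def
    proof (intro sets.sets_Collect_conj sets.sets_Collect_finite_All)
      have mS: "(\<lambda>f. f k) \<in> borel_measurable ?S" if "k \<le> i" for k
        by (rule measurable_component_singleton) (use that in auto)
      have [measurable]: "(\<lambda>f. f i) \<in> borel_measurable ?S" by (rule mS) simp
      show "{f\<in>space ?S. cmod (z + f i) < \<rho>} \<in> sets ?S" by measurable
      fix k assume "k \<in> {..<i}"
      then have [measurable]: "(\<lambda>f. f k) \<in> borel_measurable ?S" by (intro mS) simp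
      show "{f\<in>space ?S. \<rho> \<le> cmod (z + f k)} \<in> sets ?S" by measurable
    qed auto
    have [measurable]: "(\<lambda>f. f j) \<in> borel_measurable ?T"
      by (rule measurable_component_singleton) auto
    have C: "C \<in> sets ?T" unfolding C_def by measurable
    have sub: "E i \<subseteq> space M" "D \<subseteq> space M" by (auto simp: E_def D_def)
    have XA: "?X \<omega> \<in> A \<longleftrightarrow> \<omega> \<in> E i" if "\<omega> \<in> space M" for \<omega>
      using that unfolding E_def A_def by (auto simp: space_PiM)
    have YC: "?Y \<omega> \<in> C \<longleftrightarrow> \<omega> \<in> D" if "\<omega> \<in> space M" for \<omega>
      using that unfolding D_def C_def by (auto simp: space_PiM)
    have "prob {\<omega>\<in>space M. ?X \<omega> \<in> A \<and> ?Y \<omega> \<in> C} = prob {\<omega>\<in>space M. ?X \<omega> \<in> A} * prob {\<omega>\<in>space M. ?Y \<omega> \<in> C}"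
      by (rule prob_indep_var[OF cbm_past_future[OF cbm \<tau>] A C])
    moreover have "{\<omega>\<in>space M. ?X \<omega> \<in> A} = E i" using XA sub by blast
    moreover have "{\<omega>\<in>space M. ?Y \<omega> \<in> C} = D" using YC sub by blast
    moreover have "{\<omega>\<in>space M. ?X \<omega> \<in> A \<and> ?Y \<omega> \<in> C} = E i \<inter> D" using XA YC sub by blast
    ultimately have "prob (E i) * prob D = prob (E i \<inter> D)" by simp
    moreover have "prob D = p j"
    proof -
      have "distr M borel (\<lambda>\<omega>. B (\<tau> (i + j)) \<omega> - B (\<tau> i) \<omega>) = cgauss (\<delta> * real j)"
        using cbm_increment[OF cbm pos monoD[OF \<tau>(1), of i "i + j"]] by (simp add: \<tau>_def algebra_simps)
      then show ?thesis
        using prob_distr[of "\<lambda>\<omega>. B (\<tau> (i + j)) \<omega> - B (\<tau> i) \<omega>" "{x. cmod x < 1}"]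
        unfolding D_def p_def by simp
    qed
    moreover have "prob (E i \<inter> D) \<le> prob (E i \<inter> V (i + j))"
    proof (rule finite_measure_mono)
      show "E i \<inter> D \<subseteq> E i \<inter> V (i + j)"
      proof
        fix \<omega> assume \<omega>: "\<omega> \<in> E i \<inter> D"
        have "cmod (z + B (\<tau> (i + j)) \<omega>) \<le> cmod (z + B (\<tau> i) \<omega>) + cmod (B (\<tau> (i + j)) \<omega> - B (\<tau> i) \<omega>)"
          using norm_triangle_ineq[of "z + B (\<tau> i) \<omega>" "B (\<tau> (i + j)) \<omega> - B (\<tau> i) \<omega>"] by (simp add: algebra_simps)
        also have "\<dots> < \<rho> + 1" using \<omega> by (auto simp: E_def D_def intro: add_strict_mono)
        finally show "\<omega> \<in> E i \<inter> V (i + j)" using \<omega> by (auto simp: V_def E_def)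
      qed
    qed measurable
    ultimately show ?thesis by simp
  qed
  have un: "{\<omega>\<in>space M. \<exists>i\<le>H. cmod (z + B (\<tau> i) \<omega>) < \<rho>} \<subseteq> (\<Union>i\<le>H. E i)"
  proof safe
    fix \<omega> j assume \<omega>: "\<omega> \<in> space M" and j: "j \<le> H" "cmod (z + B (\<tau> j) \<omega>) < \<rho>"
    define k where "k = (LEAST k. cmod (z + B (\<tau> k) \<omega>) < \<rho>)"
    have "cmod (z + B (\<tau> k) \<omega>) < \<rho>" unfolding k_def by (rule LeastI[of _ j]) (rule j)
    moreover have "k \<le> j" unfolding k_def by (rule Least_le) (rule j)
    moreover have "\<forall>i<k. \<rho> \<le> cmod (z + B (\<tau> i) \<omega>)"
      unfolding k_def using not_less_Least linorder_not_less by blast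
    ultimately show "\<omega> \<in> (\<Union>i\<le>H. E i)"
      using \<omega> j unfolding E_def by (intro UN_I[of k]) auto
  qed
  have "prob {\<omega>\<in>space M. \<exists>i\<le>H. cmod (z + B (\<tau> i) \<omega>) < \<rho>} \<le> prob (\<Union>i\<le>H. E i)"
    by (rule finite_measure_mono[OF un]) measurable
  also have "\<dots> = (\<Sum>i\<le>H. prob (E i))"
    by (rule finite_measure_finite_Union) (auto simp: disj)
  finally have "prob {\<omega>\<in>space M. \<exists>i\<le>H. cmod (z + B (\<tau> i) \<omega>) < \<rho>} * (\<Sum>j=1..H. p j)
      \<le> (\<Sum>i\<le>H. prob (E i)) * (\<Sum>j=1..H. p j)"
    by (rule mult_right_mono) (auto simp: p_def intro: sum_nonneg)
  also have "\<dots> = (\<Sum>i\<le>H. \<Sum>j=1..H. prob (E i) * p j)" by (rule sum_product)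
  \<comment> \<open>The new index is k = i + j, at most 2 H. The first-visit events are disjoint, so
    summing over i afterwards gives no more than the probability of \<open>V k\<close>.\<close>
  also have "\<dots> \<le> (\<Sum>i\<le>H. \<Sum>k=1..2 * H. prob (E i \<inter> V k))"
  proof (rule sum_mono)
    fix i assume i: "i \<in> {..H}"
    have "(\<Sum>j=1..H. prob (E i) * p j) \<le> (\<Sum>j=1..H. prob (E i \<inter> V (i + j)))"
      by (rule sum_mono) (rule step)
    also have "\<dots> = (\<Sum>k\<in>(+) i ` {1..H}. prob (E i \<inter> V k))"
      by (subst sum.reindex) auto
    also have "\<dots> \<le> (\<Sum>k=1..2 * H. prob (E i \<inter> V k))"
      by (rule sum_mono2) (use i in auto)
    finally show "(\<Sum>j=1..H. prob (E i) * p j) \<le> (\<Sum>k=1..2 * H. prob (E i \<inter> V k))" .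
  qed
  also have "\<dots> = (\<Sum>k=1..2 * H. \<Sum>i\<le>H. prob (E i \<inter> V k))" by (rule sum.swap)
  also have "\<dots> = (\<Sum>k=1..2 * H. prob (\<Union>i\<le>H. E i \<inter> V k))"
    by (intro sum.cong refl finite_measure_finite_Union[symmetric]) (auto simp: disj)
  also have "\<dots> \<le> (\<Sum>k=1..2 * H. prob (V k))"
    by (intro sum_mono finite_measure_mono) auto
  finally show ?thesis unfolding Vk p_def \<tau>_def .
qed

text \<open>The density of \<open>cgauss v\<close> near 0 is of order 1 / v, a decay whose sum
  diverges logarithmically; this is recurrence in the plane. The unit disc contains the square of
  half-side 1/2, and v \<ge> 1 keeps its standardised half-side at most 1, so the density there is
  at least its value at 1.\<close>

lemma cgauss_unit_ball_ge:
  obtains a :: real where "0 < a" "\<And>v. 1 \<le> v \<Longrightarrow> a / v \<le> measure (cgauss v) {x. cmod x < 1}"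
proof
  let ?d = "std_normal_density 1"
  have d: "0 < ?d" by (simp add: normal_density_pos)
  show "0 < 2 * ?d\<^sup>2" using d by simp
  fix v :: real assume v: "1 \<le> v"
  interpret prob_space "cgauss v" by (rule prob_space_cgauss)
  define s where "s = sqrt (v / 2)"
  have s: "0 < s" "s\<^sup>2 = v / 2" using v by (auto simp: s_def)
  define r where "r = 1 / (2 * s)"
  have "(1 / 2)\<^sup>2 \<le> v / 2" using v by (simp add: power2_eq_square)
  then have "1 / 2 \<le> s" unfolding s_def by (rule real_le_rsqrt)
  then have r: "0 < r" "r \<le> 1" using s by (auto simp: r_def)
  have "ennreal (?d * (2 * r)) \<le> ennreal (std_normal_density (0 + r) * (2 * r))"
  proof (intro ennreal_leI mult_right_mono)
    have "r\<^sup>2 \<le> 1\<^sup>2" using r by (intro power_mono) auto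
    then show "?d \<le> std_normal_density (0 + r)" unfolding std_normal_density_def by (intro mult_left_mono) auto
  qed (use r in auto)
  also have "\<dots> \<le> emeasure std_normal {y. \<bar>0 + y\<bar> \<le> r}"
    by (rule std_normal_interval_ge) (use r in auto)
  also have "\<dots> = (\<integral>\<^sup>+y. indicator {y. \<bar>y\<bar> \<le> r} y \<partial>std_normal)"
    by (subst nn_integral_indicator) auto
  also have "\<dots> = (\<integral>\<^sup>+y. indicator {y. \<bar>y\<bar> \<le> 1 / 2} (s * y) \<partial>std_normal)"
    by (rule nn_integral_cong) (use s in \<open>auto simp: indicator_def r_def abs_mult field_simps\<close>)
  finally have 1: "ennreal (?d * (2 * r)) \<le> (\<integral>\<^sup>+y. indicator {y. \<bar>y\<bar> \<le> 1 / 2} (s * y) \<partial>std_normal)" .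
  have "(?d * (2 * r)) * (?d * (2 * r)) = ?d\<^sup>2 / s\<^sup>2"
    using s by (simp add: r_def power2_eq_square)
  also have "\<dots> = 2 * ?d\<^sup>2 / v" unfolding s by simp
  finally have "ennreal (2 * ?d\<^sup>2 / v) = ennreal (?d * (2 * r)) * ennreal (?d * (2 * r))"
    using r d by (subst ennreal_mult[symmetric]) auto
  also have "\<dots> \<le> (\<integral>\<^sup>+y. indicator {y. \<bar>y\<bar> \<le> 1 / 2} (s * y) \<partial>std_normal)
      * (\<integral>\<^sup>+y. indicator {y. \<bar>y\<bar> \<le> 1 / 2} (s * y) \<partial>std_normal)"
    by (intro mult_mono 1) auto
  also have "\<dots> = (\<integral>\<^sup>+x. indicator {y. \<bar>y\<bar> \<le> 1 / 2} (Re x) * indicator {y. \<bar>y\<bar> \<le> 1 / 2} (Im x) \<partial>cgauss v)"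
    unfolding s_def by (subst nn_integral_cgauss_prod) auto
  also have "\<dots> \<le> (\<integral>\<^sup>+x. indicator {x. cmod x < 1} x \<partial>cgauss v)"
  proof (rule nn_integral_mono)
    fix x :: complex
    have "cmod x < 1" if "\<bar>Re x\<bar> \<le> 1 / 2" "\<bar>Im x\<bar> \<le> 1 / 2"
    proof -
      have "\<bar>Re x\<bar>\<^sup>2 \<le> (1 / 2)\<^sup>2" "\<bar>Im x\<bar>\<^sup>2 \<le> (1 / 2)\<^sup>2"
        using that by (intro power_mono; simp)+
      then have "(Re x)\<^sup>2 \<le> 1 / 4" "(Im x)\<^sup>2 \<le> 1 / 4" by (simp_all add: power2_eq_square)
      then have "(cmod x)\<^sup>2 < 1\<^sup>2" unfolding cmod_power2 by simp
      then show ?thesis by (rule power_less_imp_less_base) simp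
    qed
    then show "indicator {y. \<bar>y\<bar> \<le> 1 / 2} (Re x) * indicator {y. \<bar>y\<bar> \<le> 1 / 2} (Im x)
        \<le> (indicator {x. cmod x < 1} x :: ennreal)"
      by (auto simp: indicator_def)
  qed
  also have "\<dots> = ennreal (measure (cgauss v) {x. cmod x < 1})"
    by (simp add: emeasure_eq_measure)
  finally show "2 * ?d\<^sup>2 / v \<le> measure (cgauss v) {x. cmod x < 1}"
    by (subst (asm) ennreal_le_iff) auto
qed

text \<open>Telescoping with ln (1 + 1 / j) \<le> 1 / j. The sum starts at \<open>N\<close> because
  the Gaussian lower bound needs a variance j / N of at least 1.\<close>

lemma ln_le_sum_inverse:
  assumes "0 < N" "0 < n"
  shows "ln (real n) \<le> (\<Sum>j=N..n * N. 1 / real j)"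
proof -
  have "ln (real (Suc m)) - ln (real N) \<le> (\<Sum>j=N..m. 1 / real j)" if "N \<le> m" for m
    using that
  proof (induction m rule: dec_induct)
    case base
    have "ln (real (Suc N) / real N) \<le> real (Suc N) / real N - 1" using assms by (intro ln_le_minus_one) auto
    also have "\<dots> = 1 / real N" using assms by (simp add: field_simps)
    finally show ?case using assms by (simp add: ln_div)
  next
    case (step m)
    have "0 < m" using step assms by simp
    have "ln (real (Suc (Suc m)) / real (Suc m)) \<le> real (Suc (Suc m)) / real (Suc m) - 1"
      by (intro ln_le_minus_one) auto
    also have "\<dots> = 1 / real (Suc m)" by (simp add: field_simps)
    finally have "ln (real (Suc (Suc m))) - ln (real (Suc m)) \<le> 1 / real (Suc m)"
      by (subst (asm) ln_div) auto
    moreover have "(\<Sum>j=N..Suc m. 1 / real j) = (\<Sum>j=N..m. 1 / real j) + 1 / real (Suc m)"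
      using step by simp
    ultimately show ?case using step.IH by linarith
  qed
  from this[of "n * N"] have "ln (real (Suc (n * N))) - ln (real N) \<le> (\<Sum>j=N..n * N. 1 / real j)"
    using assms by simp
  moreover have "ln (real (n * N)) \<le> ln (real (Suc (n * N)))" by (rule ln_mono) (use assms in auto)
  moreover have "ln (real (n * N)) = ln (real n) + ln (real N)" using assms by (simp add: ln_mult)
  ultimately show ?thesis by linarith
qed

section \<open>Counting the unit cells whose particles may hit the disc\<close>

definition lattice_point :: "int \<times> int \<Rightarrow> complex" where
  "lattice_point p = Complex (of_int (fst p)) (of_int (snd p))"

lemma card_int_abs_less:
  assumes \<sigma>: "0 \<le> \<sigma>"
  shows "finite {k::int. \<bar>real_of_int k + a\<bar> < \<sigma>}" "real (card {k::int. \<bar>real_of_int k + a\<bar> < \<sigma>}) \<le> 2 * \<sigma> + 1"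
proof -
  have sub: "{k::int. \<bar>real_of_int k + a\<bar> < \<sigma>} \<subseteq> {\<lceil>- a - \<sigma>\<rceil>..\<lfloor>- a + \<sigma>\<rfloor>}"
  proof
    fix k assume "k \<in> {k::int. \<bar>real_of_int k + a\<bar> < \<sigma>}"
    then have "- a - \<sigma> \<le> real_of_int k" "real_of_int k \<le> - a + \<sigma>" by auto
    then show "k \<in> {\<lceil>- a - \<sigma>\<rceil>..\<lfloor>- a + \<sigma>\<rfloor>}" by (simp add: ceiling_le_iff le_floor_iff)
  qed
  then show "finite {k::int. \<bar>real_of_int k + a\<bar> < \<sigma>}" by (rule finite_subset) simp
  have "card {k::int. \<bar>real_of_int k + a\<bar> < \<sigma>} \<le> card {\<lceil>- a - \<sigma>\<rceil>..\<lfloor>- a + \<sigma>\<rfloor>}"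
    by (rule card_mono[OF _ sub]) simp
  also have "\<dots> = nat (\<lfloor>- a + \<sigma>\<rfloor> - \<lceil>- a - \<sigma>\<rceil> + 1)" by simp
  finally have "real (card {k::int. \<bar>real_of_int k + a\<bar> < \<sigma>}) \<le> real (nat (\<lfloor>- a + \<sigma>\<rfloor> - \<lceil>- a - \<sigma>\<rceil> + 1))"
    by (simp only: of_nat_le_iff)
  also have "\<dots> \<le> 2 * \<sigma> + 1" using \<sigma> by linarith
  finally show "real (card {k::int. \<bar>real_of_int k + a\<bar> < \<sigma>}) \<le> 2 * \<sigma> + 1" .
qed

text \<open>Sum and integral are exchanged: for each fixed x at most (2 \<sigma> + 1)^2 lattice
  points satisfy the condition, whatever the variance. Hence every time step contributes a bounded
  amount to the total occupation.\<close>

lemma sum_cgauss_lattice_le: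
  assumes Z: "finite Z" and \<sigma>: "0 \<le> \<sigma>"
  shows "(\<Sum>p\<in>Z. measure (cgauss v) {x. cmod (lattice_point p + x) < \<sigma>}) \<le> (2 * \<sigma> + 1)\<^sup>2"
proof -
  interpret prob_space "cgauss v" by (rule prob_space_cgauss)
  have count: "(\<Sum>p\<in>Z. indicator {x. cmod (lattice_point p + x) < \<sigma>} x) \<le> (2 * \<sigma> + 1)\<^sup>2" for x
  proof -
    let ?K = "\<lambda>a. {k::int. \<bar>real_of_int k + a\<bar> < \<sigma>}"
    have "(\<Sum>p\<in>Z. indicator {x. cmod (lattice_point p + x) < \<sigma>} x :: real)
        = real (card {p\<in>Z. cmod (lattice_point p + x) < \<sigma>})"
      using Z by (simp add: indicator_def sum.If_cases Int_def)
    also have "card {p\<in>Z. cmod (lattice_point p + x) < \<sigma>} \<le> card (?K (Re x) \<times> ?K (Im x))"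
    proof (rule card_mono)
      show "finite (?K (Re x) \<times> ?K (Im x))" using card_int_abs_less(1)[OF \<sigma>] by simp
      show "{p\<in>Z. cmod (lattice_point p + x) < \<sigma>} \<subseteq> ?K (Re x) \<times> ?K (Im x)"
      proof
        fix p assume "p \<in> {p\<in>Z. cmod (lattice_point p + x) < \<sigma>}"
        then have "cmod (lattice_point p + x) < \<sigma>" by simp
        then have "\<bar>Re (lattice_point p + x)\<bar> < \<sigma>" "\<bar>Im (lattice_point p + x)\<bar> < \<sigma>"
          using abs_Re_le_cmod[of "lattice_point p + x"] abs_Im_le_cmod[of "lattice_point p + x"] by linarith+
        then show "p \<in> ?K (Re x) \<times> ?K (Im x)" by (cases p) (simp add: lattice_point_def)
      qed
    qed
    then have "real (card {p\<in>Z. cmod (lattice_point p + x) < \<sigma>}) \<le> real (card (?K (Re x)) * card (?K (Im x)))"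
      unfolding card_cartesian_product by (simp only: of_nat_le_iff)
    also have "\<dots> \<le> (2 * \<sigma> + 1) * (2 * \<sigma> + 1)"
      unfolding of_nat_mult using card_int_abs_less(2)[OF \<sigma>] \<sigma> by (intro mult_mono) auto
    finally show ?thesis by (simp add: power2_eq_square)
  qed
  have m: "{x. cmod (lattice_point p + x) < \<sigma>} \<in> sets (cgauss v)" for p by measurable
  have int: "integrable (cgauss v) (indicator {x. cmod (lattice_point p + x) < \<sigma>} :: complex \<Rightarrow> real)" for p
    by (rule integrable_real_indicator[OF m]) (simp add: emeasure_eq_measure)
  have "(\<Sum>p\<in>Z. measure (cgauss v) {x. cmod (lattice_point p + x) < \<sigma>})
      = (\<Sum>p\<in>Z. \<integral>x. indicator {x. cmod (lattice_point p + x) < \<sigma>} x \<partial>cgauss v)"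
    by simp
  also have "\<dots> = (\<integral>x. (\<Sum>p\<in>Z. indicator {x. cmod (lattice_point p + x) < \<sigma>} x) \<partial>cgauss v)"
    by (rule Bochner_Integration.integral_sum[symmetric]) (rule int)
  also have "\<dots> \<le> (\<integral>x. (2 * \<sigma> + 1)\<^sup>2 \<partial>cgauss v)"
    by (rule integral_mono) (use int count in \<open>auto intro!: Bochner_Integration.integrable_sum simp del: split_paired_All\<close>)
  also have "\<dots> = (2 * \<sigma> + 1)\<^sup>2" using prob_space by simp
  finally show ?thesis .
qed

text \<open>The bound \<open>q\<close> on the hitting probability depends on the Brownian motion only through its
  one-dimensional marginals, so one \<open>q\<close> serves all particles at once.\<close>

lemma grid_hitting_bound:
  assumes \<rho>: "0 \<le> \<rho>"
  shows "\<exists>C :: real. 0 < C \<and> (\<forall>n N. 2 \<le> n \<longrightarrow> 0 < N \<longrightarrow> (\<exists>q. (\<forall>p. 0 \<le> q p \<and> q p \<le> 1) \<and>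
      (\<forall>(M :: 'w measure) B p. complex_brownian_motion M B \<longrightarrow>
        measure M {\<omega>\<in>space M. \<exists>i\<le>n * N. cmod (lattice_point p + B (real i / real N) \<omega>) < \<rho>} \<le> q p) \<and>
      (\<forall>Z. finite Z \<longrightarrow> sum q Z \<le> C * real n / ln (real n))))"
proof -
  obtain a :: real where a: "0 < a" "\<And>v. 1 \<le> v \<Longrightarrow> a / v \<le> measure (cgauss v) {x. cmod x < 1}"
    by (rule cgauss_unit_ball_ge, rule that) blast+
  define C where "C = 2 * (2 * (\<rho> + 1) + 1)\<^sup>2 / a"
  show ?thesis
  proof (rule exI[of _ C], intro conjI allI impI)
    show "0 < C" using a \<rho> by (simp add: C_def)
    fix n N :: nat assume n: "2 \<le> n" and N: "0 < N"
    define H where "H = n * N"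
    define G where "G = (\<Sum>j=1..H. measure (cgauss (1 / real N * real j)) {x. cmod x < 1})"
    define S where "S p = (\<Sum>k=1..2 * H. measure (cgauss (1 / real N * real k)) {x. cmod (lattice_point p + x) < \<rho> + 1})" for p
    \<comment> \<open>The occupation bound divided by the expected number of returns, capped at 1 so
      that \<open>1 - q p\<close> is a probability.\<close>
    define q where "q p = min 1 (S p / G)" for p
    have lnn: "0 < ln (real n)" using n by simp
    \<comment> \<open>The terms with j < N are dropped. The mesh enters as the factor
      \<open>N\<close>, which cancels against the 2 n N terms of the total occupation.\<close>
    have G: "a * real N * ln (real n) \<le> G"
    proof -
      have "a * real N * ln (real n) \<le> a * real N * (\<Sum>j=N..H. 1 / real j)"
        using ln_le_sum_inverse[OF N, of n] n a by (intro mult_left_mono) (auto simp: H_def)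
      also have "\<dots> = (\<Sum>j=N..H. a / (1 / real N * real j))" by (simp add: sum_distrib_left mult.commute)
      also have "\<dots> \<le> (\<Sum>j=N..H. measure (cgauss (1 / real N * real j)) {x. cmod x < 1})"
      proof (rule sum_mono)
        fix j assume "j \<in> {N..H}"
        then show "a / (1 / real N * real j) \<le> measure (cgauss (1 / real N * real j)) {x. cmod x < 1}"
          using N by (intro a(2)) (simp add: field_simps)
      qed
      also have "\<dots> \<le> G" unfolding G_def by (rule sum_mono2) (use N in auto)
      finally show ?thesis .
    qed
    have Gpos: "0 < G" using G a N lnn by (meson less_le_trans mult_pos_pos of_nat_0_less_iff)
    have S0: "0 \<le> S p" for p unfolding S_def by (intro sum_nonneg) auto
    show "\<exists>q. (\<forall>p. 0 \<le> q p \<and> q p \<le> 1) \<and>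
      (\<forall>(M :: 'w measure) B p. complex_brownian_motion M B \<longrightarrow>
        measure M {\<omega>\<in>space M. \<exists>i\<le>n * N. cmod (lattice_point p + B (real i / real N) \<omega>) < \<rho>} \<le> q p) \<and>
      (\<forall>Z. finite Z \<longrightarrow> sum q Z \<le> C * real n / ln (real n))"
    proof (intro exI[of _ q] conjI allI impI)
      fix p show "0 \<le> q p" "q p \<le> 1" using S0[of p] Gpos by (auto simp: q_def)
    next
      fix M :: "'w measure" and B p assume cbm: "complex_brownian_motion M B"
      interpret prob_space M using cbm by (rule cbm_prob_space)
      have "prob {\<omega>\<in>space M. \<exists>i\<le>H. cmod (lattice_point p + B (1 / real N * real i) \<omega>) < \<rho>} * G \<le> S p"
        unfolding G_def S_def by (rule cbm_first_visit[OF cbm]) (use N \<rho> in auto)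
      then have "prob {\<omega>\<in>space M. \<exists>i\<le>n * N. cmod (lattice_point p + B (real i / real N) \<omega>) < \<rho>} \<le> S p / G"
        using Gpos by (simp add: H_def pos_le_divide_eq)
      then show "prob {\<omega>\<in>space M. \<exists>i\<le>n * N. cmod (lattice_point p + B (real i / real N) \<omega>) < \<rho>} \<le> q p"
        unfolding q_def by simp
    next
      fix Z :: "(int \<times> int) set" assume Z: "finite Z"
      have "sum q Z \<le> (\<Sum>p\<in>Z. S p / G)" by (rule sum_mono) (simp add: q_def)
      also have "\<dots> = (\<Sum>p\<in>Z. S p) / G" by (rule sum_divide_distrib[symmetric])
      also have "(\<Sum>p\<in>Z. S p) = (\<Sum>k=1..2 * H. \<Sum>p\<in>Z. measure (cgauss (1 / real N * real k)) {x. cmod (lattice_point p + x) < \<rho> + 1})"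
        unfolding S_def by (rule sum.swap)
      also have "\<dots> \<le> (\<Sum>k=1..2 * H. (2 * (\<rho> + 1) + 1)\<^sup>2)"
        by (intro sum_mono sum_cgauss_lattice_le Z) (use \<rho> in simp)
      also have "\<dots> = 2 * real n * real N * (2 * (\<rho> + 1) + 1)\<^sup>2" by (simp add: H_def)
      finally have "sum q Z \<le> 2 * real n * real N * (2 * (\<rho> + 1) + 1)\<^sup>2 / G"
        using Gpos by (simp add: divide_right_mono)
      also have "\<dots> \<le> 2 * real n * real N * (2 * (\<rho> + 1) + 1)\<^sup>2 / (a * real N * ln (real n))"
        using G Gpos a N lnn by (intro divide_left_mono mult_pos_pos) auto
      also have "\<dots> = C * real n / ln (real n)" using N by (simp add: C_def)
      finally show "sum q Z \<le> C * real n / ln (real n)" .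
    qed
  qed
qed

section \<open>Thinning the Poisson process\<close>

text \<open>Floors make the unit squares half-open, so that they partition the plane.\<close>

definition cell :: "int \<times> int \<Rightarrow> complex set" where
  "cell p = {x. \<lfloor>Re x\<rfloor> = fst p \<and> \<lfloor>Im x\<rfloor> = snd p}"

lemma sets_cell [measurable]: "cell p \<in> sets borel"
proof -
  have "cell p = {x. of_int (fst p) \<le> Re x \<and> Re x < of_int (fst p) + 1 \<and> of_int (snd p) \<le> Im x \<and> Im x < of_int (snd p) + 1}"
    unfolding cell_def by (auto simp: floor_eq_iff)
  also have "\<dots> \<in> sets borel" by measurable
  finally show ?thesis .
qed

lemma emeasure_cell_le: "emeasure lborel (cell p) \<le> 1"
proof -
  let ?a = "Complex (of_int (fst p)) (of_int (snd p))" and ?b = "Complex (of_int (fst p) + 1) (of_int (snd p) + 1)"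
  have "cell p \<subseteq> cbox ?a ?b"
    unfolding cell_def by (auto simp: in_cbox_complex_iff floor_eq_iff)
  then have "emeasure lborel (cell p) \<le> emeasure lborel (cbox ?a ?b)"
    by (rule emeasure_mono) simp
  also have "\<dots> = 1" by (simp add: emeasure_lborel_cbox_eq Basis_complex_def)
  finally show ?thesis .
qed

text \<open>The generating function of a Poisson variable of mean m takes the value exp (- q m) at 1
  - q, and here m \<le> 1.\<close>

lemma poisson_gen_fun:
  assumes pp: "poisson_points M \<mu> X" and A: "A \<in> sets borel" "emeasure \<mu> A \<le> 1" and q: "0 \<le> q" "q \<le> 1"
  shows "ennreal (exp (- q)) \<le> (\<integral>\<^sup>+\<omega>. ennreal ((1 - q) ^ card {j. X j \<omega> \<in> A}) \<partial>M)"
proof -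
  interpret prob_space M using pp by (simp add: poisson_points_def)
  define N where "N \<omega> = card {j. X j \<omega> \<in> A}" for \<omega>
  define m where "m = measure \<mu> A"
  have fin: "emeasure \<mu> A < \<infinity>" using A(2) by (auto intro: le_less_trans)
  have m: "0 \<le> m" "m \<le> 1"
  proof -
    have "emeasure \<mu> A = ennreal m" unfolding m_def using fin by (intro emeasure_eq_ennreal_measure) auto
    then show "m \<le> 1" using A(2) by simp
  qed (simp add: m_def)
  have prob: "prob {\<omega>\<in>space M. N \<omega> = n} = m ^ n / fact n * exp (- m)" for n
    using pp A(1) fin unfolding poisson_points_def N_def m_def by blast
  \<comment> \<open>Measurability of the count is read off the independence clause, applied to
    \<open>A\<close> followed by empty sets.\<close>
  define D where "D i = (if i = 0 then A else {})" for i :: nat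
  have "indep_vars (\<lambda>_. count_space UNIV) (\<lambda>i \<omega>. card {j. X j \<omega> \<in> D i}) UNIV"
  proof -
    have "range D \<subseteq> sets borel \<and> disjoint_family D \<and> (\<forall>i. emeasure \<mu> (D i) < \<infinity>)"
      using A(1) fin by (auto simp: D_def disjoint_family_on_def)
    then show ?thesis using pp unfolding poisson_points_def by blast
  qed
  then have "(\<lambda>\<omega>. card {j. X j \<omega> \<in> D 0}) \<in> measurable M (count_space UNIV)"
    unfolding indep_vars_def by blast
  then have [measurable]: "N \<in> measurable M (count_space UNIV)"
    unfolding N_def D_def by simp
  have ev: "{\<omega>\<in>space M. N \<omega> = n} \<in> events" for n by measurable
  have sums: "(\<lambda>n. (1 - q) ^ n * (m ^ n / fact n * exp (- m))) sums (exp ((1 - q) * m) * exp (- m))"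
  proof -
    have "(\<lambda>n. ((1 - q) * m) ^ n /\<^sub>R fact n) sums exp ((1 - q) * m)" by (rule exp_converges)
    from sums_mult2[OF this, of "exp (- m)"] show ?thesis
      by (simp add: power_mult_distrib divide_inverse mult_ac)
  qed
  have "ennreal (exp (- q)) \<le> ennreal (exp ((1 - q) * m) * exp (- m))"
  proof (rule ennreal_leI)
    have "q * m \<le> q * 1" using m q by (intro mult_left_mono) auto
    then show "exp (- q) \<le> exp ((1 - q) * m) * exp (- m)" by (simp add: algebra_simps flip: exp_add)
  qed
  also have "\<dots> = (\<Sum>n. ennreal ((1 - q) ^ n * (m ^ n / fact n * exp (- m))))"
    using q m by (intro suminf_ennreal_eq[OF _ sums, symmetric]) auto
  also have "\<dots> = (\<Sum>n. \<integral>\<^sup>+\<omega>. ennreal ((1 - q) ^ n) * indicator {\<omega>\<in>space M. N \<omega> = n} \<omega> \<partial>M)"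
  proof (rule suminf_cong)
    fix n
    have "(\<integral>\<^sup>+\<omega>. ennreal ((1 - q) ^ n) * indicator {\<omega>\<in>space M. N \<omega> = n} \<omega> \<partial>M)
        = ennreal ((1 - q) ^ n) * ennreal (prob {\<omega>\<in>space M. N \<omega> = n})"
      using ev by (simp add: nn_integral_cmult_indicator emeasure_eq_measure)
    also have "\<dots> = ennreal ((1 - q) ^ n * (m ^ n / fact n * exp (- m)))"
      unfolding prob by (rule ennreal_mult[symmetric]) (use q m in auto)
    finally show "ennreal ((1 - q) ^ n * (m ^ n / fact n * exp (- m)))
        = (\<integral>\<^sup>+\<omega>. ennreal ((1 - q) ^ n) * indicator {\<omega>\<in>space M. N \<omega> = n} \<omega> \<partial>M)" ..
  qed
  also have "\<dots> = (\<integral>\<^sup>+\<omega>. (\<Sum>n. ennreal ((1 - q) ^ n) * indicator {\<omega>\<in>space M. N \<omega> = n} \<omega>) \<partial>M)"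
    by (rule nn_integral_suminf[symmetric]) (use ev in measurable)
  also have "\<dots> = (\<integral>\<^sup>+\<omega>. ennreal ((1 - q) ^ N \<omega>) \<partial>M)"
  proof (rule nn_integral_cong)
    fix \<omega> assume \<omega>: "\<omega> \<in> space M"
    have "(\<Sum>n. ennreal ((1 - q) ^ n) * indicator {\<omega>\<in>space M. N \<omega> = n} \<omega>)
        = (\<Sum>n\<in>{N \<omega>}. ennreal ((1 - q) ^ n) * indicator {\<omega>\<in>space M. N \<omega> = n} \<omega>)"
      by (rule suminf_finite) auto
    then show "(\<Sum>n. ennreal ((1 - q) ^ n) * indicator {\<omega>\<in>space M. N \<omega> = n} \<omega>) = ennreal ((1 - q) ^ N \<omega>)"
      using \<omega> by simp
  qed
  finally show ?thesis unfolding N_def .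
qed

lemma prod_mono_ennreal:
  fixes f g :: "'a \<Rightarrow> ennreal"
  shows "(\<And>i. i \<in> A \<Longrightarrow> f i \<le> g i) \<Longrightarrow> prod f A \<le> prod g A"
  by (induction A rule: infinite_finite_induct) (auto intro!: mult_mono)

text \<open>Conditioning on the cells occupied by the first \<open>m\<close> points replaces conditioning on the whole
  initial configuration. Index \<open>m\<close> stands for all cells outside the finite set under consideration.\<close>

lemma poisson_avoid_grid:
  fixes enc :: "nat \<Rightarrow> int \<times> int"
  assumes pm: "poisson_model M X B" and enc: "bij enc"
    and q: "\<And>i. 0 \<le> q i" "\<And>i. q i \<le> 1"
    and D: "\<And>i. D i \<in> sets path_space"
    and hit: "\<And>i j. 1 - q i \<le> measure M {\<omega>\<in>space M. path_of (B j) \<omega> \<in> D i}"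
  shows "exp (- (\<Sum>i<m. q i)) \<le> measure M {\<omega>\<in>space M. \<forall>j<m. \<forall>i<m. X j \<omega> \<in> cell (enc i) \<longrightarrow> path_of (B j) \<omega> \<in> D i}"
proof -
  define \<mu> where "\<mu> = scale_measure (ennreal (1 / pi)) (lborel :: complex measure)"
  have pp: "poisson_points M \<mu> X" and cbm: "\<And>j. complex_brownian_motion M (B j)"
    and indB: "independent_processes M B" and indXB: "prob_space.indep_set M
       (sets (vimage_algebra (space M) (\<lambda>\<omega> j. X j \<omega>) (\<Pi>\<^sub>M j\<in>UNIV. borel)))
       (sets (vimage_algebra (space M) (\<lambda>\<omega> j. path_of (B j) \<omega>) (\<Pi>\<^sub>M j\<in>UNIV. path_space)))"
    using pm unfolding poisson_model_def \<mu>_def by blast+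
  interpret prob_space M using cbm_prob_space[OF cbm[of 0]] .
  have X [measurable]: "X j \<in> borel_measurable M" for j using pp by (simp add: poisson_points_def)
  have \<mu>cell: "emeasure \<mu> (cell p) \<le> 1" for p
  proof -
    have "emeasure \<mu> (cell p) = ennreal (1 / pi) * emeasure lborel (cell p)" by (simp add: \<mu>_def)
    also have "\<dots> \<le> 1 * 1"
      using pi_ge_two by (intro mult_mono emeasure_cell_le) (auto simp: ennreal_le_1)
    finally show ?thesis by simp
  qed
  have \<mu>fin: "emeasure \<mu> (cell p) < \<infinity>" for p
    by (rule le_less_trans[OF \<mu>cell]) simp
  define idx where "idx x = (\<lfloor>Re x\<rfloor>, \<lfloor>Im x\<rfloor>)" for x
  \<comment> \<open>The number of the occupied cell, cut off at \<open>m\<close>, so that the first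
    \<open>m\<close> points have only finitely many joint codes.\<close>
  define code where "code x = min m (inv enc (idx x))" for x
  have in_cell: "x \<in> cell (enc i) \<longleftrightarrow> inv enc (idx x) = i" for x i
  proof -
    have "x \<in> cell (enc i) \<longleftrightarrow> idx x = enc i" by (auto simp: cell_def idx_def prod_eq_iff)
    also have "\<dots> \<longleftrightarrow> inv enc (idx x) = i"
      using enc by (metis bij_inv_eq_iff)
    finally show ?thesis .
  qed
  have code_lt: "x \<in> cell (enc i) \<longleftrightarrow> code x = i" if "i < m" for x i
    using that unfolding in_cell code_def by auto
  have sets_code: "{x. code x = i} \<in> sets borel" for i
  proof (cases "i < m")
    case True
    then have "{x. code x = i} = cell (enc i)" using code_lt by blast
    then show ?thesis by simp
  next
    case False
    show ?thesis
    proof (cases "i = m")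
      case True
      have "{x. code x = i} = - (\<Union>i<m. cell (enc i))"
        unfolding True code_def in_cell[symmetric] by (auto simp: in_cell)
      also have "\<dots> \<in> sets borel" by (intro sets.compl_sets[of _ borel, simplified, unfolded Compl_eq_Diff_UNIV[symmetric]] sets.finite_UN) auto
      finally show ?thesis .
    next
      case False
      then have "{x. code x = i} = {}" using \<open>\<not> i < m\<close> by (auto simp: code_def)
      then show ?thesis by simp
    qed
  qed
  \<comment> \<open>A point with code \<open>m\<close> is left unconstrained.\<close>
  define q' where "q' i = (if i < m then q i else 0)" for i
  define D' where "D' i = (if i < m then D i else space path_space)" for i
  have q': "0 \<le> q' i" "q' i \<le> 1" for i using q by (auto simp: q'_def)
  have D': "D' i \<in> sets path_space" for i using D by (auto simp: D'_def)
  define L where "L = {\<omega>\<in>space M. \<forall>j<m. path_of (B j) \<omega> \<in> D' (code (X j \<omega>))}"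
  have L_eq: "L = {\<omega>\<in>space M. \<forall>j<m. \<forall>i<m. X j \<omega> \<in> cell (enc i) \<longrightarrow> path_of (B j) \<omega> \<in> D i}"
    unfolding L_def D'_def by (auto simp: code_lt)
  define P where "P = {..<m} \<rightarrow>\<^sub>E {..m}"
  have finP: "finite P" unfolding P_def by (intro finite_PiE) auto
  define XE where "XE f = {\<omega>\<in>space M. \<forall>j\<in>{..<m}. code (X j \<omega>) = f j}" for f
  define BE where "BE f = {\<omega>\<in>space M. \<forall>j\<in>{..<m}. path_of (B j) \<omega> \<in> D' (f j)}" for f
  define c where "c f = (\<Prod>j<m. 1 - q' (f j))" for f
  have c0: "0 \<le> c f" for f unfolding c_def using q' by (intro prod_nonneg) auto
  have ind: "indep_vars (\<lambda>_. path_space) (\<lambda>j. path_of (B j)) UNIV"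
    using indB by (simp add: independent_processes_def)
  have XE_mem: "XE f \<in> sets (vimage_algebra (space M) (\<lambda>\<omega> j. X j \<omega>) (\<Pi>\<^sub>M j\<in>UNIV. borel))" for f
  proof -
    have "{x\<in>space (\<Pi>\<^sub>M j\<in>UNIV. borel). \<forall>j\<in>{..<m}. code (x j) = f j} \<in> sets (\<Pi>\<^sub>M j\<in>UNIV. borel)"
    proof (rule sets.sets_Collect_finite_All)
      fix j assume "j \<in> {..<m}"
      have [measurable]: "(\<lambda>x. x j) \<in> borel_measurable (\<Pi>\<^sub>M j\<in>UNIV. (borel :: complex measure))" by measurable
      have [measurable]: "{x. code x = f j} \<in> sets borel" by (rule sets_code)
      have "(\<lambda>x. x j) -` {x. code x = f j} \<inter> space (\<Pi>\<^sub>M j\<in>UNIV. (borel :: complex measure)) \<in> sets (\<Pi>\<^sub>M j\<in>UNIV. borel)"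
        by measurable
      then show "{x\<in>space (\<Pi>\<^sub>M j\<in>UNIV. borel). code (x j) = f j} \<in> sets (\<Pi>\<^sub>M j\<in>UNIV. borel)"
        by (simp add: vimage_def Int_def conj_commute)
    qed simp
    from in_vimage_algebra[OF this, of "\<lambda>\<omega> j. X j \<omega>" "space M"] show ?thesis
      by (rule back_subst[of "\<lambda>x. x \<in> _"]) (auto simp: XE_def space_PiM)
  qed
  have BE_mem: "BE f \<in> sets (vimage_algebra (space M) (\<lambda>\<omega> j. path_of (B j) \<omega>) (\<Pi>\<^sub>M j\<in>UNIV. path_space))" for f
  proof -
    have "{x\<in>space (\<Pi>\<^sub>M j\<in>UNIV. path_space). \<forall>j\<in>{..<m}. x j \<in> D' (f j)} \<in> sets (\<Pi>\<^sub>M j\<in>UNIV. (path_space :: (real \<Rightarrow> complex) measure))"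
    proof (rule sets.sets_Collect_finite_All)
      fix j assume "j \<in> {..<m}"
      have [measurable]: "D' (f j) \<in> sets path_space" by (rule D')
      show "{x\<in>space (\<Pi>\<^sub>M j\<in>UNIV. path_space). x j \<in> D' (f j)} \<in> sets (\<Pi>\<^sub>M j\<in>UNIV. path_space)"
        by measurable
    qed simp
    from in_vimage_algebra[OF this, of "\<lambda>\<omega> j. path_of (B j) \<omega>" "space M"] show ?thesis
      by (rule back_subst[of "\<lambda>x. x \<in> _"]) (auto simp: BE_def space_PiM)
  qed
  have sub: "sets (vimage_algebra (space M) (\<lambda>\<omega> j. X j \<omega>) (\<Pi>\<^sub>M j\<in>UNIV. borel)) \<subseteq> events"
    "sets (vimage_algebra (space M) (\<lambda>\<omega> j. path_of (B j) \<omega>) (\<Pi>\<^sub>M j\<in>UNIV. path_space)) \<subseteq> events"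
    using indXB unfolding indep_sets2_eq by blast+
  have XE_ev: "XE f \<in> events" and BE_ev: "BE f \<in> events" for f
    using XE_mem BE_mem sub by blast+
  have BE_prob: "c f \<le> prob (BE f)" for f
  proof -
    have "prob (BE f) = (\<Prod>j\<in>{..<m}. prob {\<omega>\<in>space M. path_of (B j) \<omega> \<in> D' (f j)})"
      unfolding BE_def by (rule prob_indep_vars_ball[OF ind]) (auto simp: D')
    moreover have "1 - q' i \<le> prob {\<omega>\<in>space M. path_of (B j) \<omega> \<in> D' i}" for i j
      using hit[of i j] by (auto simp: q'_def D'_def prob_space)
    ultimately show ?thesis
      unfolding c_def using q' by (auto intro!: prod_mono)
  qed
  have L_union: "L = (\<Union>f\<in>P. XE f \<inter> BE f)"
  proof
    show "L \<subseteq> (\<Union>f\<in>P. XE f \<inter> BE f)"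
    proof
      fix \<omega> assume "\<omega> \<in> L"
      then show "\<omega> \<in> (\<Union>f\<in>P. XE f \<inter> BE f)"
        by (intro UN_I[of "\<lambda>j\<in>{..<m}. code (X j \<omega>)"]) (auto simp: P_def L_def XE_def BE_def code_def)
    qed
  qed (auto simp: L_def XE_def BE_def)
  have disj: "disjoint_family_on (\<lambda>f. XE f \<inter> BE f) P"
    unfolding disjoint_family_on_def
  proof (intro ballI impI)
    fix f g assume fg: "f \<in> P" "g \<in> P" "f \<noteq> g"
    then obtain j where "j < m" "f j \<noteq> g j" unfolding P_def by (metis PiE_ext lessThan_iff)
    then show "XE f \<inter> BE f \<inter> (XE g \<inter> BE g) = {}" unfolding XE_def by auto
  qed
  define N where "N i \<omega> = card {j. X j \<omega> \<in> cell (enc i)}" for i \<omega>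
  have indN: "indep_vars (\<lambda>_. count_space UNIV) N UNIV"
  proof -
    have "range (\<lambda>i. cell (enc i)) \<subseteq> sets borel \<and> disjoint_family (\<lambda>i. cell (enc i)) \<and>
        (\<forall>i. emeasure \<mu> (cell (enc i)) < \<infinity>)"
      using \<mu>fin[of "enc _"] by (auto simp: disjoint_family_on_def in_cell)
    then show ?thesis using pp unfolding poisson_points_def N_def by blast
  qed
  have "indep_vars (\<lambda>_. borel) (\<lambda>i \<omega>. (\<lambda>n. ennreal ((1 - q i) ^ n)) (N i \<omega>)) UNIV"
    by (rule indep_vars_compose2[OF indN]) simp
  then have indf: "indep_vars (\<lambda>_. borel) (\<lambda>i \<omega>. ennreal ((1 - q i) ^ N i \<omega>)) {..<m}"
    by (rule indep_vars_subset) simp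
  \<comment> \<open>\<open>card\<close> of an infinite set is 0, which would spoil the comparison of
    counts below; almost surely every cell holds finitely many points.\<close>
  have finite_N: "AE \<omega> in M. \<forall>i. finite {j. X j \<omega> \<in> cell (enc i)}"
    unfolding AE_all_countable
  proof
    fix i
    have "emeasure \<mu> (cell (enc i)) < \<infinity>" by (rule \<mu>fin)
    then show "AE \<omega> in M. finite {j. X j \<omega> \<in> cell (enc i)}"
      using pp sets_cell unfolding poisson_points_def by blast
  qed
  have "ennreal (exp (- (\<Sum>i<m. q i))) = (\<Prod>i<m. ennreal (exp (- q i)))"
    by (simp add: prod_ennreal exp_sum flip: sum_negf)
  also have "\<dots> \<le> (\<Prod>i<m. \<integral>\<^sup>+\<omega>. ennreal ((1 - q i) ^ N i \<omega>) \<partial>M)"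
    unfolding N_def by (intro prod_mono_ennreal poisson_gen_fun[OF pp] \<mu>cell q sets_cell)
  also have "\<dots> = (\<integral>\<^sup>+\<omega>. (\<Prod>i<m. ennreal ((1 - q i) ^ N i \<omega>)) \<partial>M)"
    by (rule indep_vars_nn_integral[symmetric, OF _ indf]) auto
  also have "\<dots> \<le> (\<integral>\<^sup>+\<omega>. (\<Sum>f\<in>P. ennreal (c f) * indicator (XE f) \<omega>) \<partial>M)"
  proof (rule nn_integral_mono_AE)
    show "AE \<omega> in M. (\<Prod>i<m. ennreal ((1 - q i) ^ N i \<omega>)) \<le> (\<Sum>f\<in>P. ennreal (c f) * indicator (XE f) \<omega>)"
      using finite_N AE_space
    proof eventually_elim
      case (elim \<omega>)
      define f where "f = (\<lambda>j\<in>{..<m}. code (X j \<omega>))"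
      have f: "f \<in> P" "\<omega> \<in> XE f" using elim(2) by (auto simp: f_def P_def XE_def code_def)
      \<comment> \<open>\<open>N i\<close> counts all points of the cell. Restricting to the first
        \<open>m\<close> points lowers the exponent and thus raises the product, as the bases are at
        most 1.\<close>
      have "(\<Prod>i<m. (1 - q i) ^ N i \<omega>) \<le> (\<Prod>i<m. (1 - q i) ^ card {j\<in>{..<m}. code (X j \<omega>) = i})"
      proof (intro prod_mono conjI power_decreasing)
        fix i assume i: "i \<in> {..<m}"
        have "{j\<in>{..<m}. code (X j \<omega>) = i} \<subseteq> {j. X j \<omega> \<in> cell (enc i)}"
          using i by (auto simp: code_lt)
        then show "card {j\<in>{..<m}. code (X j \<omega>) = i} \<le> N i \<omega>"
          unfolding N_def using elim(1) by (intro card_mono) auto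
      qed (use q in auto)
      also have "\<dots> = (\<Prod>i<m. \<Prod>j<m. if code (X j \<omega>) = i then 1 - q i else 1)"
      proof (rule prod.cong[OF refl])
        fix i
        have "(\<Prod>j<m. if code (X j \<omega>) = i then 1 - q i else 1)
            = (\<Prod>j\<in>{j\<in>{..<m}. code (X j \<omega>) = i}. 1 - q i)"
          by (rule prod.inter_filter[symmetric]) simp
        then show "(1 - q i) ^ card {j\<in>{..<m}. code (X j \<omega>) = i}
            = (\<Prod>j<m. if code (X j \<omega>) = i then 1 - q i else 1)" by simp
      qed
      \<comment> \<open>From cells to points: each point contributes the factor of the one cell it
        lies in, or 1 if its code is \<open>m\<close>.\<close>
      also have "\<dots> = (\<Prod>j<m. \<Prod>i<m. if code (X j \<omega>) = i then 1 - q i else 1)"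
        by (rule prod.swap)
      also have "\<dots> = c f"
        unfolding c_def by (rule prod.cong[OF refl]) (simp add: f_def q'_def)
      finally have "ennreal (\<Prod>i<m. (1 - q i) ^ N i \<omega>) \<le> ennreal (c f)" by (rule ennreal_leI)
      moreover have "(\<Prod>i<m. ennreal ((1 - q i) ^ N i \<omega>)) = ennreal (\<Prod>i<m. (1 - q i) ^ N i \<omega>)"
        by (rule prod_ennreal) (use q in auto)
      moreover have "ennreal (c f) = ennreal (c f) * indicator (XE f) \<omega>" using f by simp
      moreover have "ennreal (c f) * indicator (XE f) \<omega> \<le> (\<Sum>f\<in>P. ennreal (c f) * indicator (XE f) \<omega>)"
        by (rule member_le_sum[OF f(1)]) (auto simp: finP)
      ultimately show ?case by (simp only:)
    qed
  qed
  also have "\<dots> = (\<Sum>f\<in>P. ennreal (c f) * ennreal (prob (XE f)))"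
    using XE_ev by (subst nn_integral_sum) (auto simp: nn_integral_cmult_indicator emeasure_eq_measure)
  also have "\<dots> = ennreal (\<Sum>f\<in>P. prob (XE f) * c f)"
    using c0 by (simp add: sum_ennreal mult.commute flip: ennreal_mult)
  finally have "exp (- (\<Sum>i<m. q i)) \<le> (\<Sum>f\<in>P. prob (XE f) * c f)"
    by (subst (asm) ennreal_le_iff) (auto intro!: sum_nonneg mult_nonneg_nonneg c0)
  also have "\<dots> \<le> (\<Sum>f\<in>P. prob (XE f) * prob (BE f))"
    by (intro sum_mono mult_left_mono BE_prob) auto
  \<comment> \<open>Independence of starting points and displacements, used separately for each of
    the finitely many codes \<open>f\<close>.\<close>
  also have "\<dots> = (\<Sum>f\<in>P. prob (XE f \<inter> BE f))"
    by (intro sum.cong refl indep_setD[OF indXB XE_mem BE_mem, symmetric])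
  also have "\<dots> = prob L"
    unfolding L_union using XE_ev BE_ev finP disj
    by (intro finite_measure_finite_Union[symmetric]) auto
  finally show ?thesis unfolding L_eq .
qed

text \<open>Particle paths are continuous and countable in number, so the hole event is a countable
  intersection of path events for an open set. Measurability is what allows lower bounds by
  inclusion.\<close>

lemma poisson_hole_sets:
  assumes pm: "poisson_model M X B"
  shows "hole_event M (poisson_positions X B) T R \<in> sets M"
proof -
  have X: "\<And>j. X j \<in> borel_measurable M" and cbm: "\<And>j. complex_brownian_motion M (B j)"
    using pm unfolding poisson_model_def poisson_points_def by blast+
  have "open {z :: complex. R < cmod z}" by (intro open_Collect_less continuous_intros)
  from path_event_open[OF this, of T] obtain A where A: "A \<in> sets path_space"
    "\<And>f. continuous_on {0..} f \<Longrightarrow> restrict f {0..} \<in> A \<longleftrightarrow> (\<forall>t\<in>{0..T}. f t \<in> {z :: complex. R < cmod z})" by blast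
  define Y where "Y j t \<omega> = X j \<omega> + B j t \<omega>" for j t \<omega>
  have mY: "path_of (Y j) \<in> measurable M path_space" for j
  proof (rule measurable_path_of)
    fix t :: real assume "0 \<le> t"
    then have [measurable]: "B j t \<in> borel_measurable M" "X j \<in> borel_measurable M"
      using cbm_measurable[OF cbm] X by auto
    show "Y j t \<in> borel_measurable M" unfolding Y_def by measurable
  qed
  have cY: "continuous_on {0..} (\<lambda>t. Y j t \<omega>)" if "\<omega> \<in> space M" for j \<omega>
    unfolding Y_def by (intro continuous_intros cbm_continuous[OF cbm that])
  have "hole_event M (poisson_positions X B) T R = {\<omega>\<in>space M. \<forall>j. path_of (Y j) \<omega> \<in> A}"
  proof -
    have "poisson_positions X B t \<omega> \<inter> cball 0 R = {} \<longleftrightarrow> (\<forall>j. R < cmod (Y j t \<omega>))" for t \<omega>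
      by (auto simp: poisson_positions_def Y_def disjoint_iff not_le)
    moreover have "path_of (Y j) \<omega> \<in> A \<longleftrightarrow> (\<forall>t\<in>{0..T}. R < cmod (Y j t \<omega>))"
      if "\<omega> \<in> space M" for j \<omega>
      using A(2)[OF cY[OF that]] by (simp add: path_of_def)
    ultimately show ?thesis unfolding hole_event_def by auto
  qed
  also have "\<dots> \<in> sets M"
  proof (rule sets.sets_Collect_countable_All)
    show "{\<omega>\<in>space M. path_of (Y j) \<omega> \<in> A} \<in> sets M" for j
      using measurable_sets[OF mY A(1), of j] by (simp add: vimage_def Int_def conj_commute)
  qed
  finally show ?thesis .
qed

text \<open>Room is left twice: R + 3 for the corner of the cell, R + 1 for the particle, which
  starts within 2 of that corner, and more than R in the end. Thus closed conditions at grid times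
  pass to all times and still imply the strict one.\<close>

lemma poisson_hole_ge:
  fixes R :: real
  assumes R: "0 < R"
  shows "\<exists>C>0. \<forall>(M :: 'w measure) X B n. poisson_model M X B \<longrightarrow> 2 \<le> n \<longrightarrow>
      exp (- (C * real n / ln (real n))) \<le> measure M (hole_event M (poisson_positions X B) (real n) R)"
proof -
  have "0 \<le> R + 3" using R by simp
  obtain C :: real where C: "0 < C"
    and bound: "\<forall>n N. 2 \<le> n \<longrightarrow> 0 < N \<longrightarrow> (\<exists>q. (\<forall>p. 0 \<le> q p \<and> q p \<le> 1) \<and>
      (\<forall>(M :: 'w measure) B p. complex_brownian_motion M B \<longrightarrow>
        measure M {\<omega>\<in>space M. \<exists>i\<le>n * N. cmod (lattice_point p + B (real i / real N) \<omega>) < R + 3} \<le> q p) \<and>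
      (\<forall>Z. finite Z \<longrightarrow> sum q Z \<le> C * real n / ln (real n)))"
    using grid_hitting_bound[OF \<open>0 \<le> R + 3\<close>] by (elim exE conjE) (rule that)
  show ?thesis
  proof (rule exI[of _ C], intro conjI allI impI)
    show "0 < C" by (rule C)
    fix M :: "'w measure" and X B and n :: nat assume pm: "poisson_model M X B" and n: "2 \<le> n"
    have cbm: "\<And>j. complex_brownian_motion M (B j)"
      using pm unfolding poisson_model_def by blast
    interpret prob_space M using cbm_prob_space[OF cbm[of 0]] .
    have X [measurable]: "X j \<in> borel_measurable M" for j
      using pm unfolding poisson_model_def poisson_points_def by blast
    define enc :: "nat \<Rightarrow> int \<times> int" where "enc = from_nat_into UNIV"
    have enc: "bij enc"
      unfolding enc_def using bij_betw_from_nat_into[of "UNIV :: (int \<times> int) set"]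
      by (simp add: infinite_UNIV_char_0 finite_prod)
    \<comment> \<open>Stage \<open>m\<close> looks at the first \<open>m\<close> particles, the
      first \<open>m\<close> cells and times of mesh 2^(-m). The stages decrease, and together they
      see every particle at every dyadic time up to \<open>n\<close>.\<close>
    define K where "K m = {\<omega>\<in>space M. \<forall>j<m. \<forall>i<m. X j \<omega> \<in> cell (enc i) \<longrightarrow>
        (\<forall>k\<le>n * 2 ^ m. R + 1 \<le> cmod (X j \<omega> + B j (real k / 2 ^ m) \<omega>))}" for m :: nat
    have Kev: "K m \<in> events" for m
    proof -
      have [measurable]: "B j (real k / 2 ^ m) \<in> borel_measurable M" for j k
        by (rule cbm_measurable[OF cbm]) simp
      show ?thesis unfolding K_def by measurable
    qed
    have dec: "decseq K"
      unfolding decseq_Suc_iff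
    proof
      fix m
      show "K (Suc m) \<subseteq> K m"
      proof
        fix \<omega> assume \<omega>: "\<omega> \<in> K (Suc m)"
        have "R + 1 \<le> cmod (X j \<omega> + B j (real k / 2 ^ m) \<omega>)"
          if "j < m" "i < m" "X j \<omega> \<in> cell (enc i)" "k \<le> n * 2 ^ m" for i j k
        proof -
          have "2 * k \<le> n * 2 ^ Suc m" "j < Suc m" "i < Suc m" using that by auto
          then have "R + 1 \<le> cmod (X j \<omega> + B j (real (2 * k) / 2 ^ Suc m) \<omega>)"
            using \<omega> that(3) unfolding K_def by blast
          then show ?thesis by simp
        qed
        with \<omega> show "\<omega> \<in> K m" unfolding K_def by blast
      qed
    qed
    have Kprob: "exp (- (C * real n / ln (real n))) \<le> prob (K m)" for m
    proof -
      have N: "0 < (2::nat) ^ m" by simp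
      obtain q where q: "\<forall>p. 0 \<le> q p \<and> q p \<le> 1"
        and hit: "\<forall>(M :: 'w measure) B p. complex_brownian_motion M B \<longrightarrow>
          measure M {\<omega>\<in>space M. \<exists>i\<le>n * 2 ^ m. cmod (lattice_point p + B (real i / real (2 ^ m)) \<omega>) < R + 3} \<le> q p"
        and sum: "\<forall>Z. finite Z \<longrightarrow> sum q Z \<le> C * real n / ln (real n)"
        using bound[rule_format, OF n N] by (elim exE conjE) (rule that)
      define D where "D i = {f\<in>space path_space. \<forall>k\<in>{..n * 2 ^ m}. R + 3 \<le> cmod (lattice_point (enc i) + f (real k / 2 ^ m))}" for i
      have D: "D i \<in> sets path_space" for i
        unfolding D_def
      proof (rule sets.sets_Collect_finite_All)
        fix k :: nat
        have [measurable]: "(\<lambda>f. f (real k / 2 ^ m)) \<in> borel_measurable (path_space :: (real \<Rightarrow> complex) measure)"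
          by (rule measurable_path_eval) simp
        show "{f\<in>space path_space. R + 3 \<le> cmod (lattice_point (enc i) + f (real k / 2 ^ m))} \<in> sets path_space"
          by measurable
      qed simp
      have mem_D: "path_of W \<omega> \<in> D i \<longleftrightarrow> (\<forall>k\<le>n * 2 ^ m. R + 3 \<le> cmod (lattice_point (enc i) + W (real k / 2 ^ m) \<omega>))" for W \<omega> i
        by (auto simp: D_def)
      have hitD: "1 - q (enc i) \<le> prob {\<omega>\<in>space M. path_of (B j) \<omega> \<in> D i}" for i j
      proof -
        have [measurable]: "B j (real k / 2 ^ m) \<in> borel_measurable M" for k
          by (rule cbm_measurable[OF cbm]) simp
        let ?H = "{\<omega>\<in>space M. \<exists>k\<le>n * 2 ^ m. cmod (lattice_point (enc i) + B j (real k / 2 ^ m) \<omega>) < R + 3}"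
        have "?H \<in> events" by measurable
        moreover have "{\<omega>\<in>space M. path_of (B j) \<omega> \<in> D i} = space M - ?H"
          unfolding mem_D by (auto simp: not_le not_less)
        moreover have "prob ?H \<le> q (enc i)" using hit[rule_format, OF cbm, of "enc i" j] by simp
        ultimately show ?thesis by (simp add: prob_compl)
      qed
      have "(\<Sum>i<m. q (enc i)) = sum q (enc ` {..<m})"
        using enc by (subst sum.reindex) (auto simp: bij_def intro: inj_on_subset)
      also have "\<dots> \<le> C * real n / ln (real n)" by (rule sum[rule_format]) simp
      finally have "exp (- (C * real n / ln (real n))) \<le> exp (- (\<Sum>i<m. q (enc i)))" by simp
      also have "\<dots> \<le> prob {\<omega>\<in>space M. \<forall>j<m. \<forall>i<m. X j \<omega> \<in> cell (enc i) \<longrightarrow> path_of (B j) \<omega> \<in> D i}"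
        by (rule poisson_avoid_grid[OF pm enc _ _ D hitD]) (use q in blast)+
      also have "\<dots> \<le> prob (K m)"
      proof (rule finite_measure_mono[OF _ Kev], rule subsetI)
        fix \<omega> assume \<omega>: "\<omega> \<in> {\<omega>\<in>space M. \<forall>j<m. \<forall>i<m. X j \<omega> \<in> cell (enc i) \<longrightarrow> path_of (B j) \<omega> \<in> D i}"
        have "R + 1 \<le> cmod (X j \<omega> + B j (real k / 2 ^ m) \<omega>)"
          if j: "j < m" "i < m" "X j \<omega> \<in> cell (enc i)" "k \<le> n * 2 ^ m" for i j k
        proof -
          let ?b = "B j (real k / 2 ^ m) \<omega>" and ?z = "lattice_point (enc i)"
          have "path_of (B j) \<omega> \<in> D i" using \<omega> j by blast
          then have "R + 3 \<le> cmod (?z + ?b)" unfolding mem_D using j by blast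
          moreover have "cmod (?z + ?b) \<le> cmod (X j \<omega> + ?b) + cmod (X j \<omega> - ?z)"
            using norm_triangle_ineq4[of "X j \<omega> + ?b" "X j \<omega> - ?z"] by (simp add: algebra_simps)
          moreover have "cmod (X j \<omega> - ?z) \<le> 2"
          proof -
            have "\<bar>Re (X j \<omega> - ?z)\<bar> \<le> 1" "\<bar>Im (X j \<omega> - ?z)\<bar> \<le> 1"
              using j(3) unfolding cell_def lattice_point_def by (simp; linarith)+
            then show ?thesis using cmod_le[of "X j \<omega> - ?z"] by linarith
          qed
          ultimately show ?thesis by linarith
        qed
        with \<omega> show "\<omega> \<in> K m" unfolding K_def by blast
      qed
      finally show ?thesis .
    qed
    have "exp (- (C * real n / ln (real n))) \<le> prob (\<Inter>m. K m)"
      by (rule prob_INT_decseq_ge[OF Kev dec Kprob])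
    also have "\<dots> \<le> prob (hole_event M (poisson_positions X B) (real n) R)"
    proof (rule finite_measure_mono[OF _ poisson_hole_sets[OF pm]], rule subsetI)
      fix \<omega> assume \<omega>: "\<omega> \<in> (\<Inter>m. K m)"
      then have sp: "\<omega> \<in> space M" by (auto simp: K_def)
      have "R < cmod (X j \<omega> + B j t \<omega>)" if t: "t \<in> {0..real n}" for j t
      proof -
        define i where "i = inv enc (\<lfloor>Re (X j \<omega>)\<rfloor>, \<lfloor>Im (X j \<omega>)\<rfloor>)"
        have "enc i = (\<lfloor>Re (X j \<omega>)\<rfloor>, \<lfloor>Im (X j \<omega>)\<rfloor>)"
          unfolding i_def using enc by (simp add: bij_is_surj surj_f_inv_f)
        then have cell: "X j \<omega> \<in> cell (enc i)" by (simp add: cell_def)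
        \<comment> \<open>The unit interval containing \<open>t\<close>; at the final time the floor
          would point beyond the time range, so the last interval is taken.\<close>
        define k where "k = (if t = real n then n - 1 else nat \<lfloor>t\<rfloor>)"
        have k: "k < n" "t - real k \<in> {0..1}"
          using t n unfolding k_def by (auto simp: of_nat_diff) linarith+
        \<comment> \<open>Particle \<open>j\<close>, started in cell \<open>i\<close>, is
          constrained only from stage \<open>Suc (max i j)\<close> on, hence the choice of
          \<open>l\<close>.\<close>
        have "X j \<omega> + B j (real k + (t - real k)) \<omega> \<in> {z. R + 1 \<le> cmod z}"
        proof (rule dyadic_closed[OF _ _ _ k(2), where l = "Suc (max i j)"])
          show "continuous_on {0..1} (\<lambda>x. X j \<omega> + B j (real k + x) \<omega>)"
            by (intro continuous_intros continuous_on_compose2[OF cbm_continuous[OF cbm sp], of _ "\<lambda>x. real k + x"]) auto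
          show "closed {z :: complex. R + 1 \<le> cmod z}" by (intro closed_Collect_le continuous_intros)
          fix m l :: nat assume m: "Suc (max i j) \<le> m" and l: "l \<le> 2 ^ m"
          have "k * 2 ^ m + l \<le> Suc k * 2 ^ m" using l by simp
          also have "\<dots> \<le> n * 2 ^ m" using k by (intro mult_right_mono) auto
          finally have idx: "k * 2 ^ m + l \<le> n * 2 ^ m" .
          have "\<omega> \<in> K m" "j < m" "i < m" using \<omega> m by auto
          with idx cell have "R + 1 \<le> cmod (X j \<omega> + B j (real (k * 2 ^ m + l) / 2 ^ m) \<omega>)"
            unfolding K_def by blast
          moreover have "real (k * 2 ^ m + l) / 2 ^ m = real k + real l / 2 ^ m" by (simp add: add_divide_distrib)
          ultimately show "X j \<omega> + B j (real k + real l / 2 ^ m) \<omega> \<in> {z. R + 1 \<le> cmod z}" by simp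
        qed
        then show ?thesis by simp
      qed
      then show "\<omega> \<in> hole_event M (poisson_positions X B) (real n) R"
        using sp by (auto simp: hole_event_def poisson_positions_def not_le disjoint_iff)
    qed
    finally show "exp (- (C * real n / ln (real n))) \<le> prob (hole_event M (poisson_positions X B) (real n) R)" .
  qed
qed

text \<open>The rate lies between - 2 C / ln T and 0: rounding T up to an integer gives at most 2 T
  and a smaller hole event.\<close>

lemma poisson_hole_rate:
  fixes M :: "'w measure"
  assumes pm: "poisson_model M X B" and R: "0 < R"
  shows "(hole_rate M (poisson_positions X B) R \<longlongrightarrow> 0) at_top"
proof -
  obtain C :: real where C: "0 < C" and "\<forall>(M :: 'w measure) X B n. poisson_model M X B \<longrightarrow> 2 \<le> n \<longrightarrow>
      exp (- (C * real n / ln (real n))) \<le> measure M (hole_event M (poisson_positions X B) (real n) R)"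
    using poisson_hole_ge[OF R] by (elim exE conjE) (rule that)
  then have ge: "exp (- (C * real n / ln (real n))) \<le> measure M (hole_event M (poisson_positions X B) (real n) R)"
    if "2 \<le> n" for n using pm that by simp
  have cbm: "complex_brownian_motion M (B 0)" using pm unfolding poisson_model_def by blast
  interpret prob_space M using cbm_prob_space[OF cbm] .
  have lower: "ereal (- (2 * C / ln T)) \<le> hole_rate M (poisson_positions X B) R T" if T: "2 \<le> T" for T
  proof -
    define n where "n = nat \<lceil>T\<rceil>"
    have n: "2 \<le> n" "T \<le> real n" "real n \<le> 2 * T" using T unfolding n_def by linarith+
    have lnT: "0 < ln T" using T by simp
    have "exp (- (C * real n / ln (real n))) \<le> prob (hole_event M (poisson_positions X B) (real n) R)"
      by (rule ge[OF n(1)])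
    also have "\<dots> \<le> prob (hole_event M (poisson_positions X B) T R)"
      by (rule finite_measure_mono[OF _ poisson_hole_sets[OF pm]]) (use n in \<open>auto simp: hole_event_def\<close>)
    finally have "exp (- (C * real n / ln (real n))) \<le> prob (hole_event M (poisson_positions X B) T R)" .
    moreover have "C * real n / ln (real n) \<le> C * (2 * T) / ln T"
      using C n T lnT by (intro frac_le mult_left_mono) auto
    ultimately have "exp (- (C * (2 * T) / ln T)) \<le> prob (hole_event M (poisson_positions X B) T R)"
      by (meson exp_le_cancel_iff neg_le_iff_le order_trans)
    then have "ereal (1 / T) * ereal (- (C * (2 * T) / ln T)) \<le> hole_rate M (poisson_positions X B) R T"
      unfolding hole_rate_def using T by (intro ereal_mult_left_mono log_prob_ge) auto
    moreover have "1 / T * (- (C * (2 * T) / ln T)) = - (2 * C / ln T)" using T by simp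
    ultimately show ?thesis by (simp only: times_ereal.simps)
  qed
  have upper: "hole_rate M (poisson_positions X B) R T \<le> 0" if "2 \<le> T" for T
  proof -
    have "log_prob (prob (hole_event M (poisson_positions X B) T R)) \<le> ereal 0"
      by (rule log_prob_le) auto
    then have "hole_rate M (poisson_positions X B) R T \<le> ereal (1 / T) * ereal 0"
      unfolding hole_rate_def using that by (intro ereal_mult_left_mono) auto
    then show ?thesis by (simp add: zero_ereal_def)
  qed
  have "((\<lambda>T. - (2 * C / ln T)) \<longlongrightarrow> - 0) (at_top :: real filter)"
    by (intro tendsto_minus tendsto_divide_0[OF tendsto_const] filterlim_at_top_imp_at_infinity ln_at_top)
  then have "((\<lambda>T. ereal (- (2 * C / ln T))) \<longlongrightarrow> ereal 0) at_top"
    by (intro tendsto_intros) simp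
  then have lim: "((\<lambda>T. ereal (- (2 * C / ln T))) \<longlongrightarrow> 0) at_top" by (simp add: zero_ereal_def)
  show ?thesis
    by (rule tendsto_sandwich[OF _ _ lim tendsto_const])
      (auto simp: eventually_at_top_linorder intro!: exI[of _ "2::real"] lower upper)
qed

theorem proposition2:
  fixes c :: real
  assumes "c > 0"
  shows
    "(\<forall>(M :: 'w measure) X B. poisson_model M X B \<longrightarrow>
        (\<forall>R>0. (hole_rate M (poisson_positions X B) R \<longlongrightarrow> 0) at_top)) \<and>
     (\<forall>model \<in> {perturbed_lattice c, triangular_cluster c}.
        \<forall>R_star > 16. \<forall>T_star > (0 :: real). \<exists>c1 > 0. \<exists>c2 > 0.
          \<forall>(M :: 'w measure) \<zeta>. iid_ou_family M \<zeta> \<longrightarrow>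
            (\<forall>R > R_star.
               Limsup at_top (hole_rate M (model \<zeta>) R) \<le> ereal (- c1 * R ^ 4) \<and>
               Liminf at_top (hole_rate M (model \<zeta>) R) \<ge> ereal (- c2 * R ^ 4)))"
proof -
  have pl: "\<exists>c1 > 0. \<exists>c2 > 0. \<forall>(M :: 'w measure) \<zeta>. iid_ou_family M \<zeta> \<longrightarrow> (\<forall>R \<ge> 16.
      Limsup at_top (hole_rate M (perturbed_lattice c \<zeta>) R) \<le> ereal (- c1 * R ^ 4) \<and>
      Liminf at_top (hole_rate M (perturbed_lattice c \<zeta>) R) \<ge> ereal (- c2 * R ^ 4))"
    unfolding perturbed_lattice_eq
    by (rule cluster_lattice_rate[OF assms]) (use pi_ge_two pi_less_4 in auto)
  have tc: "\<exists>c1 > 0. \<exists>c2 > 0. \<forall>(M :: 'w measure) \<zeta>. iid_ou_family M \<zeta> \<longrightarrow> (\<forall>R \<ge> 16.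
      Limsup at_top (hole_rate M (triangular_cluster c \<zeta>) R) \<le> ereal (- c1 * R ^ 4) \<and>
      Liminf at_top (hole_rate M (triangular_cluster c \<zeta>) R) \<ge> ereal (- c2 * R ^ 4))"
    unfolding triangular_cluster_eq
  \<comment> \<open>The squared spacing 3 pi is at most 12 as pi < 4, which is where the 12 in the
    count of near sites comes from.\<close>
  proof (rule cluster_lattice_rate[OF assms])
    fix u assume "u \<in> (\<lambda>m::nat. exp (2 * of_real pi * \<i> * of_nat m / 3)) ` {0, 1, 2}"
    then obtain m :: nat where "u = exp (2 * of_real pi * \<i> * of_nat m / 3)"
      by blast
    also have "2 * of_real pi * \<i> * of_nat m / 3 = \<i> * of_real (2 * pi * real m / 3)" by simp
    finally show "cmod u = 1" by (simp only: norm_exp_i_times)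
  qed (use pi_ge_two pi_less_4 in auto)
  show ?thesis
  proof (intro conjI allI impI ballI)
    fix M :: "'w measure" and X B and R :: real assume "poisson_model M X B" "0 < R"
    then show "(hole_rate M (poisson_positions X B) R \<longlongrightarrow> 0) at_top" by (rule poisson_hole_rate)
  next
    fix model :: "(int \<times> int \<Rightarrow> real \<Rightarrow> 'w \<Rightarrow> complex) \<Rightarrow> real \<Rightarrow> 'w \<Rightarrow> complex set" and R_star T_star :: real
    assume model: "model \<in> {perturbed_lattice c, triangular_cluster c}" and R_star: "16 < R_star"
    then have "\<exists>c1 > 0. \<exists>c2 > 0. \<forall>(M :: 'w measure) \<zeta>. iid_ou_family M \<zeta> \<longrightarrow> (\<forall>R \<ge> 16.
      Limsup at_top (hole_rate M (model \<zeta>) R) \<le> ereal (- c1 * R ^ 4) \<and>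
      Liminf at_top (hole_rate M (model \<zeta>) R) \<ge> ereal (- c2 * R ^ 4))"
      using pl tc by blast
    then obtain c1 c2 where "0 < c1" "0 < c2"
      "\<forall>(M :: 'w measure) \<zeta>. iid_ou_family M \<zeta> \<longrightarrow> (\<forall>R \<ge> 16.
      Limsup at_top (hole_rate M (model \<zeta>) R) \<le> ereal (- c1 * R ^ 4) \<and>
      Liminf at_top (hole_rate M (model \<zeta>) R) \<ge> ereal (- c2 * R ^ 4))"
      by (elim exE conjE) (rule that)
    then show "\<exists>c1 > 0. \<exists>c2 > 0. \<forall>(M :: 'w measure) \<zeta>. iid_ou_family M \<zeta> \<longrightarrow> (\<forall>R > R_star.
        Limsup at_top (hole_rate M (model \<zeta>) R) \<le> ereal (- c1 * R ^ 4) \<and>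
        Liminf at_top (hole_rate M (model \<zeta>) R) \<ge> ereal (- c2 * R ^ 4))"
      using R_star by (intro exI[of _ c1] exI[of _ c2] conjI) simp_all
  qed
qed

end
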